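(* Let $(\overline{M},\overline{g},J)$ be a locally metallic Riemannian manifold. If $M:=M_\theta\times_f M_T$ is a warped product pointwise semi-slant submanifold of $\overline{M}$, where the base $M_\theta$ is a pointwise slant submanifold with pointwise slant angle $\theta_x\in(0,\frac{\pi}{2})$ for $x\in M_\theta$ and the fiber $M_T$ is an invariant submanifold, then $$A_{NT_1Y}X-A_{NT_1X}Y\in\Gamma(TM_\theta)$$ for any $X,Y\in\Gamma(TM_\theta)$.
   Context: A metallic Riemannian manifold $(\overline{M},\overline{g},J)$ is a Riemannian manifold $(\overline{M},\overline{g})$ with a $(1,1)$-tensor field $J$ such that $J^2=pJ+qI$ for some positive integers $p,q$ and $\overline{g}(JX,Y)=\overline{g}(X,JY)$ for all vector fields $X,Y$. It is locally metallic if $\overline{\nabla}J=0$, where $\overline{\nabla}$ is the Levi-Civita connection of $\overline{g}$. For an isometrically immersed submanifold $M$ of $\overline{M}$ and $X\in\Gamma(TM)$ write $JX=TX+NX$ with $TX$ tangent and $NX$ normal to $M$. For a normal vector field $V$, the shape operator $A_V$ is defined by the Weingarten formula $\overline{\nabla}_XV=-A_VX+\nabla^\perp_XV$ ($-A_VX$ tangent, $\nabla^\perp_XV$ normal). A submanifold is invariant if $J$ maps its tangent spaces into themselves. A distribution $D$ on $M$ is pointwise slant if for every $x\in M$ the angle $\theta_x$ between $JX$ and $D_x$ is the same for all nonzero $X\in D_x$; $x\mapsto\theta_x$ is its slant (Wirtinger) function. A submanifold is pointwise slant if its whole tangent bundle has this property, i.e. $\cos\theta_x=\|TX\|/\|JX\|$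 for all nonzero $X\in T_xM$. $M$ is a pointwise bi-slant submanifold if there are orthogonal distributions $D_1,D_2$ on $M$ with $TM=D_1\oplus D_2$, $J(D_1)\perp D_2$, $J(D_2)\perp D_1$, and $D_1,D_2$ pointwise slant. With $P_i$ the projection of $TM$ onto $D_i$, put $T_i=P_i\circ T$. The warped product $M_1\times_f M_2$ of Riemannian manifolds $(M_1,g_1)$ (the base) and $(M_2,g_2)$ (the fiber), both of positive dimension, with warping function a smooth $f:M_1\to(0,\infty)$ is $M_1\times M_2$ with metric $g=\pi_1^*g_1+(f\circ\pi_1)^2\pi_2^*g_2$, $\pi_i$ being the projections. A warped product pointwise bi-slant submanifold of $\overline{M}$ is a warped product $M_1\times_f M_2$ of two pointwise slant submanifolds $M_1,M_2$ of $\overline{M}$, isometrically immersed in $\overline{M}$ as a pointwise bi-slant submanifold with $D_1=TM_1$, $D_2=TM_2$. It is called a warped product pointwise semi-slant submanifold if one of $M_1,M_2$ is an invariant submanifold of $\overline{M}$ and the other is a pointwise slant submanifold of $\overline{M}$ with Wirtinger angle $\theta_x\in[0,\frac{\pi}{2}]$. Here $M_1=M_\theta$, so $D_1=TM_\theta$, and $M_2=M_T$. Vector fields on the factors are identified with their lifts to $M$, and $\Gamma(TM_\theta)$ in the conclusion means sections of the distribution $D_1$. *)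

theory Defs
  imports "HOL-Analysis.Analysis" "HOL-Library.Function_Algebras"
begin

section \<open>Pointwise real vector space structure on functions\<close>

instantiation "fun" :: (type, real_vector) real_vector
begin

definition scaleR_fun :: "real \<Rightarrow> ('a \<Rightarrow> 'b) \<Rightarrow> 'a \<Rightarrow> 'b" where
  "scaleR_fun a v = (\<lambda>x. a *\<^sub>R v x)"

instance
  by standard (simp_all add: scaleR_fun_def fun_eq_iff algebra_simps)

end


section \<open>Smooth maps between open subsets of normed spaces\<close>

text \<open>Only meant for open \<open>S\<close>; on finite-dimensional spaces \<open>Ck_on k S\<close> is the usual class
  \<open>C^k\<close>, because the maps \<open>x \<mapsto> Df(x)v\<close> determine \<open>Df\<close> continuously.\<close>

fun Ck_on :: "nat \<Rightarrow> 'a::real_normed_vector set \<Rightarrow> ('a \<Rightarrow> 'b::real_normed_vector) \<Rightarrow> bool" where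
  "Ck_on 0 S f \<longleftrightarrow> continuous_on S f"
| "Ck_on (Suc k) S f \<longleftrightarrow>
     (\<forall>x\<in>S. f differentiable (at x)) \<and> (\<forall>v. Ck_on k S (\<lambda>x. frechet_derivative f (at x) v))"

definition smooth_on :: "'a::real_normed_vector set \<Rightarrow> ('a \<Rightarrow> 'b::real_normed_vector) \<Rightarrow> bool" where
  "smooth_on S f \<longleftrightarrow> (\<forall>k. Ck_on k S f)"


section \<open>Smooth manifolds\<close>

text \<open>A manifold is a Hausdorff second countable type \<open>'m\<close> with a (not necessarily maximal) smooth
  atlas modelled on a Euclidean space \<open>'e\<close> of positive dimension. A chart is a domain together
  with a coordinate map whose values outside of the domain are irrelevant.\<close>

type_synonym ('m, 'e) chart = "'m set \<times> ('m \<Rightarrow> 'e)"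

definition cinv :: "('m, 'e) chart \<Rightarrow> 'e \<Rightarrow> 'm" where
  "cinv c = inv_into (fst c) (snd c)"

definition smooth_manifold ::
  "('m::{t2_space,second_countable_topology}, 'e::euclidean_space) chart set \<Rightarrow> bool" where
  "smooth_manifold A \<longleftrightarrow>
     (\<Union>c\<in>A. fst c) = UNIV \<and>
     (\<forall>c\<in>A. open (fst c) \<and> open (snd c ` fst c) \<and>
        homeomorphism (fst c) (snd c ` fst c) (snd c) (cinv c)) \<and>
     (\<forall>c\<in>A. \<forall>c'\<in>A. smooth_on (snd c ` (fst c \<inter> fst c')) (snd c' \<circ> cinv c))"

definition chart_at :: "('m, 'e) chart set \<Rightarrow> 'm \<Rightarrow> ('m, 'e) chart" where
  "chart_at A p = (SOME c. c \<in> A \<and> p \<in> fst c)"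

definition smooth_fun :: "('m, 'e::euclidean_space) chart set \<Rightarrow> 'm set \<Rightarrow> ('m \<Rightarrow> real) \<Rightarrow> bool" where
  "smooth_fun A U h \<longleftrightarrow> (\<forall>c\<in>A. smooth_on (snd c ` (fst c \<inter> U)) (h \<circ> cinv c))"

definition smooth_map ::
  "('m::topological_space, 'e::euclidean_space) chart set \<Rightarrow>
   ('n::topological_space, 'f::euclidean_space) chart set \<Rightarrow> ('m \<Rightarrow> 'n) \<Rightarrow> bool" where
  "smooth_map A B F \<longleftrightarrow> continuous_on UNIV F \<and>
     (\<forall>c\<in>A. \<forall>d\<in>B. smooth_on (snd c ` (fst c \<inter> F -` fst d)) (snd d \<circ> F \<circ> cinv c))"


section \<open>Tangent vectors and vector fields\<close>

text \<open>A tangent vector at \<open>p\<close> is the family of its components in all charts around \<open>p\<close>, related by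
  the derivatives of the coordinate changes (and zero for the charts that do not contain \<open>p\<close>).
  Addition and scaling are the pointwise ones.\<close>

type_synonym ('m, 'e) tvec = "('m, 'e) chart \<Rightarrow> 'e"

definition tangent_space ::
  "('m, 'e::euclidean_space) chart set \<Rightarrow> 'm \<Rightarrow> ('m, 'e) tvec set" where
  "tangent_space A p = {v.
     (\<forall>c\<in>A. \<forall>c'\<in>A. p \<in> fst c \<longrightarrow> p \<in> fst c' \<longrightarrow>
        v c' = frechet_derivative (snd c' \<circ> cinv c) (at (snd c p)) (v c)) \<and>
     (\<forall>c. \<not> (c \<in> A \<and> p \<in> fst c) \<longrightarrow> v c = 0)}"

text \<open>The tangent vector at \<open>p\<close> with component \<open>u\<close> in the chart \<open>c\<close>; for fixed \<open>u\<close> this is a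
  coordinate vector field on the domain of \<open>c\<close>.\<close>

definition coord_vec ::
  "('m, 'e::euclidean_space) chart set \<Rightarrow> ('m, 'e) chart \<Rightarrow> 'e \<Rightarrow> 'm \<Rightarrow> ('m, 'e) tvec" where
  "coord_vec A c u p = (\<lambda>c'. if c' \<in> A \<and> p \<in> fst c'
     then frechet_derivative (snd c' \<circ> cinv c) (at (snd c p)) u else 0)"

definition differential ::
  "('m, 'e::euclidean_space) chart set \<Rightarrow> ('n, 'f::euclidean_space) chart set \<Rightarrow> ('m \<Rightarrow> 'n) \<Rightarrow>
   'm \<Rightarrow> ('m, 'e) tvec \<Rightarrow> ('n, 'f) tvec" where
  "differential A B F p v = (\<lambda>d. if d \<in> B \<and> F p \<in> fst d
     then let c = chart_at A p
          in frechet_derivative (snd d \<circ> F \<circ> cinv c) (at (snd c p)) (v c)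
     else 0)"

definition dir_deriv ::
  "('m, 'e::euclidean_space) chart set \<Rightarrow> 'm \<Rightarrow> ('m, 'e) tvec \<Rightarrow> ('m \<Rightarrow> real) \<Rightarrow> real" where
  "dir_deriv A p v h =
     (let c = chart_at A p in frechet_derivative (h \<circ> cinv c) (at (snd c p)) (v c))"

definition vector_field_on ::
  "('m, 'e::euclidean_space) chart set \<Rightarrow> 'm set \<Rightarrow> ('m \<Rightarrow> ('m, 'e) tvec) \<Rightarrow> bool" where
  "vector_field_on A U X \<longleftrightarrow> (\<forall>p\<in>U. X p \<in> tangent_space A p) \<and>
     (\<forall>c\<in>A. smooth_on (snd c ` (fst c \<inter> U)) (\<lambda>x. X (cinv c x) c))"

definition lie_bracket ::
  "('m, 'e::euclidean_space) chart set \<Rightarrow> ('m \<Rightarrow> ('m, 'e) tvec) \<Rightarrow> ('m \<Rightarrow> ('m, 'e) tvec) \<Rightarrow>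
   'm \<Rightarrow> ('m, 'e) tvec" where
  "lie_bracket A X Y p = (\<lambda>c. if c \<in> A \<and> p \<in> fst c
     then frechet_derivative (\<lambda>x. Y (cinv c x) c) (at (snd c p)) (X p c)
        - frechet_derivative (\<lambda>x. X (cinv c x) c) (at (snd c p)) (Y p c)
     else 0)"


section \<open>Riemannian metrics and affine connections\<close>

type_synonym ('m, 'e) metric = "'m \<Rightarrow> ('m, 'e) tvec \<Rightarrow> ('m, 'e) tvec \<Rightarrow> real"

definition riemannian_manifold ::
  "('m::{t2_space,second_countable_topology}, 'e::euclidean_space) chart set \<Rightarrow>
   ('m, 'e) metric \<Rightarrow> bool" where
  "riemannian_manifold A g \<longleftrightarrow> smooth_manifold A \<and>
     (\<forall>p. \<forall>u\<in>tangent_space A p. \<forall>v\<in>tangent_space A p.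
        g p u v = g p v u \<and>
        (\<forall>w\<in>tangent_space A p. g p (u + v) w = g p u w + g p v w) \<and>
        (\<forall>a. g p (a *\<^sub>R u) v = a * g p u v) \<and>
        (u \<noteq> 0 \<longrightarrow> g p u u > 0)) \<and>
     (\<forall>U X Y. open U \<longrightarrow> vector_field_on A U X \<longrightarrow> vector_field_on A U Y \<longrightarrow>
        smooth_fun A U (\<lambda>p. g p (X p) (Y p)))"

text \<open>\<open>\<nabla> p v Y\<close> is the covariant derivative at \<open>p\<close> of a vector field \<open>Y\<close>, smooth near \<open>p\<close>, in the
  direction of the tangent vector \<open>v\<close>. Its values at other arguments are irrelevant.\<close>

type_synonym ('m, 'e) connection =
  "'m \<Rightarrow> ('m, 'e) tvec \<Rightarrow> ('m \<Rightarrow> ('m, 'e) tvec) \<Rightarrow> ('m, 'e) tvec"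

definition affine_connection ::
  "('m::topological_space, 'e::euclidean_space) chart set \<Rightarrow> ('m, 'e) connection \<Rightarrow> bool" where
  "affine_connection A nabla \<longleftrightarrow>
     (\<forall>U Y. open U \<longrightarrow> vector_field_on A U Y \<longrightarrow>
        (\<forall>p\<in>U. \<forall>v\<in>tangent_space A p.
           nabla p v Y \<in> tangent_space A p \<and>
           (\<forall>w\<in>tangent_space A p. nabla p (v + w) Y = nabla p v Y + nabla p w Y) \<and>
           (\<forall>a. nabla p (a *\<^sub>R v) Y = a *\<^sub>R nabla p v Y) \<and>
           (\<forall>Z. vector_field_on A U Z \<longrightarrow>
              nabla p v (\<lambda>q. Y q + Z q) = nabla p v Y + nabla p v Z) \<and>
           (\<forall>h. smooth_fun A U h \<longrightarrow>
              nabla p v (\<lambda>q. h q *\<^sub>R Y q) = dir_deriv A p v h *\<^sub>R Y p + h p *\<^sub>R nabla p v Y) \<and>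
           (\<forall>Z. (\<forall>q\<in>U. Z q = Y q) \<longrightarrow> nabla p v Z = nabla p v Y)) \<and>
        (\<forall>X. vector_field_on A U X \<longrightarrow> vector_field_on A U (\<lambda>p. nabla p (X p) Y)))"

definition torsion_free ::
  "('m::topological_space, 'e::euclidean_space) chart set \<Rightarrow> ('m, 'e) connection \<Rightarrow> bool" where
  "torsion_free A nabla \<longleftrightarrow>
     (\<forall>U X Y. open U \<longrightarrow> vector_field_on A U X \<longrightarrow> vector_field_on A U Y \<longrightarrow>
        (\<forall>p\<in>U. nabla p (X p) Y - nabla p (Y p) X = lie_bracket A X Y p))"

definition metric_connection ::
  "('m::topological_space, 'e::euclidean_space) chart set \<Rightarrow> ('m, 'e) metric \<Rightarrow>
   ('m, 'e) connection \<Rightarrow> bool" where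
  "metric_connection A g nabla \<longleftrightarrow>
     (\<forall>U Y Z. open U \<longrightarrow> vector_field_on A U Y \<longrightarrow> vector_field_on A U Z \<longrightarrow>
        (\<forall>p\<in>U. \<forall>v\<in>tangent_space A p.
           dir_deriv A p v (\<lambda>q. g q (Y q) (Z q)) = g p (nabla p v Y) (Z p) + g p (Y p) (nabla p v Z)))"

definition levi_civita ::
  "('m::topological_space, 'e::euclidean_space) chart set \<Rightarrow> ('m, 'e) metric \<Rightarrow>
   ('m, 'e) connection \<Rightarrow> bool" where
  "levi_civita A g nabla \<longleftrightarrow>
     affine_connection A nabla \<and> torsion_free A nabla \<and> metric_connection A g nabla"


section \<open>Metallic Riemannian manifolds\<close>

type_synonym ('m, 'e) endo_field = "'m \<Rightarrow> ('m, 'e) tvec \<Rightarrow> ('m, 'e) tvec"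

definition tensor_field_11 ::
  "('m::topological_space, 'e::euclidean_space) chart set \<Rightarrow> ('m, 'e) endo_field \<Rightarrow> bool" where
  "tensor_field_11 A J \<longleftrightarrow>
     (\<forall>p. \<forall>u\<in>tangent_space A p. J p u \<in> tangent_space A p \<and>
        (\<forall>v\<in>tangent_space A p. J p (u + v) = J p u + J p v) \<and>
        (\<forall>a. J p (a *\<^sub>R u) = a *\<^sub>R J p u)) \<and>
     (\<forall>U X. open U \<longrightarrow> vector_field_on A U X \<longrightarrow> vector_field_on A U (\<lambda>p. J p (X p)))"

definition metallic_riemannian_manifold ::
  "('m::{t2_space,second_countable_topology}, 'e::euclidean_space) chart set \<Rightarrow>
   ('m, 'e) metric \<Rightarrow> ('m, 'e) endo_field \<Rightarrow> bool" where
  "metallic_riemannian_manifold A g J \<longleftrightarrow>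
     riemannian_manifold A g \<and> tensor_field_11 A J \<and>
     (\<exists>a b :: nat. a > 0 \<and> b > 0 \<and>
        (\<forall>x. \<forall>u\<in>tangent_space A x. J x (J x u) = real a *\<^sub>R J x u + real b *\<^sub>R u)) \<and>
     (\<forall>x. \<forall>u\<in>tangent_space A x. \<forall>v\<in>tangent_space A x. g x (J x u) v = g x u (J x v))"

text \<open>\<open>\<nabla>J = 0\<close> is expressed as \<open>\<nabla>\<^sub>v (JY) = J (\<nabla>\<^sub>v Y)\<close> for all local vector fields \<open>Y\<close>.\<close>

definition locally_metallic ::
  "('m::{t2_space,second_countable_topology}, 'e::euclidean_space) chart set \<Rightarrow>
   ('m, 'e) metric \<Rightarrow> ('m, 'e) endo_field \<Rightarrow> ('m, 'e) connection \<Rightarrow> bool" where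
  "locally_metallic A g J nabla \<longleftrightarrow>
     metallic_riemannian_manifold A g J \<and> levi_civita A g nabla \<and>
     (\<forall>U Y. open U \<longrightarrow> vector_field_on A U Y \<longrightarrow>
        (\<forall>p\<in>U. \<forall>v\<in>tangent_space A p. nabla p v (\<lambda>q. J q (Y q)) = J p (nabla p v Y)))"


section \<open>Immersed submanifolds\<close>

definition oproj :: "('v \<Rightarrow> 'v \<Rightarrow> real) \<Rightarrow> 'v set \<Rightarrow> 'v \<Rightarrow> 'v::real_vector" where
  "oproj h S w = (THE u. u \<in> S \<and> (\<forall>z\<in>S. h (w - u) z = 0))"

definition isometric_immersion ::
  "('m::topological_space, 'e::euclidean_space) chart set \<Rightarrow> ('m, 'e) metric \<Rightarrow>
   ('n::topological_space, 'f::euclidean_space) chart set \<Rightarrow> ('n, 'f) metric \<Rightarrow> ('m \<Rightarrow> 'n) \<Rightarrow> bool" where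
  "isometric_immersion A g B gbar F \<longleftrightarrow> smooth_map A B F \<and>
     (\<forall>p. \<forall>u\<in>tangent_space A p. \<forall>v\<in>tangent_space A p.
        gbar (F p) (differential A B F p u) (differential A B F p v) = g p u v)"

definition immersion ::
  "('m::topological_space, 'e::euclidean_space) chart set \<Rightarrow>
   ('n::topological_space, 'f::euclidean_space) chart set \<Rightarrow> ('m \<Rightarrow> 'n) \<Rightarrow> bool" where
  "immersion A B F \<longleftrightarrow> smooth_map A B F \<and>
     (\<forall>p. inj_on (differential A B F p) (tangent_space A p))"

text \<open>Components of an ambient vector \<open>w\<close> at \<open>F p\<close>: the tangential one is regarded as a tangent
  vector of the submanifold, the normal one as a vector of the ambient space.\<close>

definition tan_part ::
  "('m, 'e::euclidean_space) chart set \<Rightarrow> ('n, 'f::euclidean_space) chart set \<Rightarrow> ('n, 'f) metric \<Rightarrow>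
   ('m \<Rightarrow> 'n) \<Rightarrow> 'm \<Rightarrow> ('n, 'f) tvec \<Rightarrow> ('m, 'e) tvec" where
  "tan_part A B gbar F p w = inv_into (tangent_space A p) (differential A B F p)
     (oproj (gbar (F p)) (differential A B F p ` tangent_space A p) w)"

definition nor_part ::
  "('m, 'e::euclidean_space) chart set \<Rightarrow> ('n, 'f::euclidean_space) chart set \<Rightarrow> ('n, 'f) metric \<Rightarrow>
   ('m \<Rightarrow> 'n) \<Rightarrow> 'm \<Rightarrow> ('n, 'f) tvec \<Rightarrow> ('n, 'f) tvec" where
  "nor_part A B gbar F p w = w - oproj (gbar (F p)) (differential A B F p ` tangent_space A p) w"

definition T_op ::
  "('m, 'e::euclidean_space) chart set \<Rightarrow> ('n, 'f::euclidean_space) chart set \<Rightarrow> ('n, 'f) metric \<Rightarrow>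
   ('n, 'f) endo_field \<Rightarrow> ('m \<Rightarrow> 'n) \<Rightarrow> ('m, 'e) endo_field" where
  "T_op A B gbar J F p v = tan_part A B gbar F p (J (F p) (differential A B F p v))"

definition N_op ::
  "('m, 'e::euclidean_space) chart set \<Rightarrow> ('n, 'f::euclidean_space) chart set \<Rightarrow> ('n, 'f) metric \<Rightarrow>
   ('n, 'f) endo_field \<Rightarrow> ('m \<Rightarrow> 'n) \<Rightarrow> 'm \<Rightarrow> ('m, 'e) tvec \<Rightarrow> ('n, 'f) tvec" where
  "N_op A B gbar J F p v = nor_part A B gbar F p (J (F p) (differential A B F p v))"

text \<open>The connection induced on vector fields \<open>V\<close> along \<open>F\<close> (sections of the pullback bundle).
  In a chart \<open>d\<close> of the ambient manifold it is \<open>D V\<^sup>d(v) + \<Gamma>\<^sup>d(dF v, V)\<close>, where \<open>\<Gamma>\<^sup>d\<close> are the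
  connection coefficients \<open>\<nabla>\<^sub>u \<partial>\<^sub>w\<close> of the coordinate fields of \<open>d\<close>.\<close>

definition connection_coeff ::
  "('n, 'f::euclidean_space) chart set \<Rightarrow> ('n, 'f) connection \<Rightarrow> ('n, 'f) chart \<Rightarrow> 'n \<Rightarrow>
   'f \<Rightarrow> 'f \<Rightarrow> 'f" where
  "connection_coeff B nabla d q u w = nabla q (coord_vec B d u q) (coord_vec B d w) d"

definition nabla_along ::
  "('m, 'e::euclidean_space) chart set \<Rightarrow> ('n, 'f::euclidean_space) chart set \<Rightarrow>
   ('n, 'f) connection \<Rightarrow> ('m \<Rightarrow> 'n) \<Rightarrow> 'm \<Rightarrow> ('m, 'e) tvec \<Rightarrow> ('m \<Rightarrow> ('n, 'f) tvec) \<Rightarrow> ('n, 'f) tvec" where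
  "nabla_along A B nabla F p v V = (\<lambda>d. if d \<in> B \<and> F p \<in> fst d
     then (let c = chart_at A p
           in frechet_derivative (\<lambda>x. V (cinv c x) d) (at (snd c p)) (v c))
          + connection_coeff B nabla d (F p) (differential A B F p v d) (V p d)
     else 0)"

definition shape_op ::
  "('m, 'e::euclidean_space) chart set \<Rightarrow> ('n, 'f::euclidean_space) chart set \<Rightarrow> ('n, 'f) metric \<Rightarrow>
   ('n, 'f) connection \<Rightarrow> ('m \<Rightarrow> 'n) \<Rightarrow> ('m \<Rightarrow> ('n, 'f) tvec) \<Rightarrow> 'm \<Rightarrow> ('m, 'e) tvec \<Rightarrow> ('m, 'e) tvec" where
  "shape_op A B gbar nabla F V p v = - tan_part A B gbar F p (nabla_along A B nabla F p v V)"

definition invariant_submanifold ::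
  "('m::topological_space, 'e::euclidean_space) chart set \<Rightarrow>
   ('n::topological_space, 'f::euclidean_space) chart set \<Rightarrow> ('n, 'f) endo_field \<Rightarrow>
   ('m \<Rightarrow> 'n) \<Rightarrow> bool" where
  "invariant_submanifold A B J F \<longleftrightarrow> immersion A B F \<and>
     (\<forall>p. J (F p) ` (differential A B F p ` tangent_space A p)
            \<subseteq> differential A B F p ` tangent_space A p)"


section \<open>Distributions and slant conditions\<close>

definition distribution ::
  "('m::topological_space, 'e::euclidean_space) chart set \<Rightarrow> ('m \<Rightarrow> ('m, 'e) tvec set) \<Rightarrow> bool" where
  "distribution A D \<longleftrightarrow>
     (\<exists>k::nat. \<forall>p. \<exists>U E. open U \<and> p \<in> U \<and> (\<forall>i<k. vector_field_on A U (E i)) \<and>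
        (\<forall>q\<in>U. inj_on (\<lambda>i. E i q) {..<k} \<and> independent ((\<lambda>i. E i q) ` {..<k}) \<and>
                D q = span ((\<lambda>i. E i q) ` {..<k})))"

definition smooth_sections ::
  "('m, 'e::euclidean_space) chart set \<Rightarrow> ('m \<Rightarrow> ('m, 'e) tvec set) \<Rightarrow> ('m \<Rightarrow> ('m, 'e) tvec) set" where
  "smooth_sections A D = {X. vector_field_on A UNIV X \<and> (\<forall>p. X p \<in> D p)}"

text \<open>The angle in \<open>[0, \<pi>/2]\<close> between a nonzero vector and a subspace.\<close>

definition angle_subspace :: "('v \<Rightarrow> 'v \<Rightarrow> real) \<Rightarrow> 'v \<Rightarrow> 'v::real_vector set \<Rightarrow> real" where
  "angle_subspace h w S =
     arccos (sqrt (h (oproj h S w) (oproj h S w)) / sqrt (h w w))"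

definition pointwise_slant ::
  "('m, 'e::euclidean_space) chart set \<Rightarrow> ('n, 'f::euclidean_space) chart set \<Rightarrow> ('n, 'f) metric \<Rightarrow>
   ('n, 'f) endo_field \<Rightarrow> ('m \<Rightarrow> 'n) \<Rightarrow> ('m \<Rightarrow> ('m, 'e) tvec set) \<Rightarrow> ('m \<Rightarrow> real) \<Rightarrow> bool" where
  "pointwise_slant A B gbar J F D \<theta> \<longleftrightarrow>
     (\<forall>p. \<forall>X\<in>D p. X \<noteq> 0 \<longrightarrow>
        angle_subspace (gbar (F p)) (J (F p) (differential A B F p X)) (differential A B F p ` D p)
          = \<theta> p)"

definition pointwise_slant_submanifold ::
  "('m::topological_space, 'e::euclidean_space) chart set \<Rightarrow>
   ('n::topological_space, 'f::euclidean_space) chart set \<Rightarrow> ('n, 'f) metric \<Rightarrow>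
   ('n, 'f) endo_field \<Rightarrow> ('m \<Rightarrow> 'n) \<Rightarrow> ('m \<Rightarrow> real) \<Rightarrow> bool" where
  "pointwise_slant_submanifold A B gbar J F \<theta> \<longleftrightarrow>
     immersion A B F \<and> pointwise_slant A B gbar J F (tangent_space A) \<theta>"

definition pointwise_bi_slant_submanifold ::
  "('m::topological_space, 'e::euclidean_space) chart set \<Rightarrow> ('m, 'e) metric \<Rightarrow>
   ('n::topological_space, 'f::euclidean_space) chart set \<Rightarrow> ('n, 'f) metric \<Rightarrow>
   ('n, 'f) endo_field \<Rightarrow> ('m \<Rightarrow> 'n) \<Rightarrow>
   ('m \<Rightarrow> ('m, 'e) tvec set) \<Rightarrow> ('m \<Rightarrow> ('m, 'e) tvec set) \<Rightarrow> bool" where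
  "pointwise_bi_slant_submanifold A g B gbar J F D1 D2 \<longleftrightarrow>
     isometric_immersion A g B gbar F \<and> distribution A D1 \<and> distribution A D2 \<and>
     (\<forall>p. \<forall>u\<in>D1 p. \<forall>v\<in>D2 p. g p u v = 0) \<and>
     (\<forall>p. tangent_space A p = {u + v | u v. u \<in> D1 p \<and> v \<in> D2 p} \<and> D1 p \<inter> D2 p = {0}) \<and>
     (\<forall>p. \<forall>u\<in>D1 p. \<forall>v\<in>D2 p.
        gbar (F p) (J (F p) (differential A B F p u)) (differential A B F p v) = 0 \<and>
        gbar (F p) (J (F p) (differential A B F p v)) (differential A B F p u) = 0) \<and>
     (\<exists>\<theta>1. pointwise_slant A B gbar J F D1 \<theta>1) \<and>
     (\<exists>\<theta>2. pointwise_slant A B gbar J F D2 \<theta>2)"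

text \<open>\<open>T\<^sub>i = P\<^sub>i \<circ> T\<close>, with \<open>P\<^sub>i\<close> the projection of \<open>TM = D\<^sub>i \<oplus> D'\<close> onto \<open>D\<^sub>i\<close>.\<close>

definition proj_along :: "'v::real_vector set \<Rightarrow> 'v set \<Rightarrow> 'v \<Rightarrow> 'v" where
  "proj_along S S' v = (THE u. u \<in> S \<and> v - u \<in> S')"

definition T_proj ::
  "('m, 'e::euclidean_space) chart set \<Rightarrow>
   ('n, 'f::euclidean_space) chart set \<Rightarrow> ('n, 'f) metric \<Rightarrow> ('n, 'f) endo_field \<Rightarrow>
   ('m \<Rightarrow> 'n) \<Rightarrow> ('m \<Rightarrow> ('m, 'e) tvec set) \<Rightarrow> ('m \<Rightarrow> ('m, 'e) tvec set) \<Rightarrow> ('m, 'e) endo_field" where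
  "T_proj A B gbar J F D D' p v = proj_along (D p) (D' p) (T_op A B gbar J F p v)"


section \<open>Warped products\<close>

definition product_atlas ::
  "('a, 'd) chart set \<Rightarrow> ('b, 'e) chart set \<Rightarrow> ('a \<times> 'b, 'd \<times> 'e) chart set" where
  "product_atlas A1 A2 =
     (\<lambda>(c1, c2). (fst c1 \<times> fst c2, map_prod (snd c1) (snd c2))) ` (A1 \<times> A2)"

definition warped_metric ::
  "('a, 'd::euclidean_space) chart set \<Rightarrow> ('a, 'd) metric \<Rightarrow>
   ('b, 'e::euclidean_space) chart set \<Rightarrow> ('b, 'e) metric \<Rightarrow> ('a \<Rightarrow> real) \<Rightarrow>
   ('a \<times> 'b, 'd \<times> 'e) metric" where
  "warped_metric A1 g1 A2 g2 f p u v =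
     g1 (fst p) (differential (product_atlas A1 A2) A1 fst p u)
                (differential (product_atlas A1 A2) A1 fst p v)
     + (f (fst p))\<^sup>2 *
       g2 (snd p) (differential (product_atlas A1 A2) A2 snd p u)
                  (differential (product_atlas A1 A2) A2 snd p v)"

text \<open>The distributions on the product that are tangent to the two factors.\<close>

definition TM1 ::
  "('a, 'd::euclidean_space) chart set \<Rightarrow> ('b, 'e::euclidean_space) chart set \<Rightarrow>
   'a \<times> 'b \<Rightarrow> ('a \<times> 'b, 'd \<times> 'e) tvec set" where
  "TM1 A1 A2 p = {v \<in> tangent_space (product_atlas A1 A2) p.
     differential (product_atlas A1 A2) A2 snd p v = 0}"

definition TM2 ::
  "('a, 'd::euclidean_space) chart set \<Rightarrow> ('b, 'e::euclidean_space) chart set \<Rightarrow>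
   'a \<times> 'b \<Rightarrow> ('a \<times> 'b, 'd \<times> 'e) tvec set" where
  "TM2 A1 A2 p = {v \<in> tangent_space (product_atlas A1 A2) p.
     differential (product_atlas A1 A2) A1 fst p v = 0}"

text \<open>The factors are submanifolds of the ambient manifold by means of the leaves
  \<open>M\<^sub>1 \<times> {y}\<close> and \<open>{x} \<times> M\<^sub>2\<close>.\<close>

definition warped_product_pointwise_bi_slant ::
  "('a::{t2_space,second_countable_topology}, 'd::euclidean_space) chart set \<Rightarrow> ('a, 'd) metric \<Rightarrow>
   ('b::{t2_space,second_countable_topology}, 'e::euclidean_space) chart set \<Rightarrow> ('b, 'e) metric \<Rightarrow>
   ('a \<Rightarrow> real) \<Rightarrow>
   ('n::{t2_space,second_countable_topology}, 'f::euclidean_space) chart set \<Rightarrow> ('n, 'f) metric \<Rightarrow>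
   ('n, 'f) endo_field \<Rightarrow> ('a \<times> 'b \<Rightarrow> 'n) \<Rightarrow> bool" where
  "warped_product_pointwise_bi_slant A1 g1 A2 g2 f B gbar J F \<longleftrightarrow>
     riemannian_manifold A1 g1 \<and> riemannian_manifold A2 g2 \<and>
     smooth_fun A1 UNIV f \<and> (\<forall>x. f x > 0) \<and>
     (\<forall>y. \<exists>\<theta>. pointwise_slant_submanifold A1 B gbar J (\<lambda>x. F (x, y)) \<theta>) \<and>
     (\<forall>x. \<exists>\<theta>. pointwise_slant_submanifold A2 B gbar J (\<lambda>y. F (x, y)) \<theta>) \<and>
     pointwise_bi_slant_submanifold (product_atlas A1 A2) (warped_metric A1 g1 A2 g2 f)
       B gbar J F (TM1 A1 A2) (TM2 A1 A2)"

definition warped_product_pointwise_semi_slant ::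
  "('a::{t2_space,second_countable_topology}, 'd::euclidean_space) chart set \<Rightarrow> ('a, 'd) metric \<Rightarrow>
   ('b::{t2_space,second_countable_topology}, 'e::euclidean_space) chart set \<Rightarrow> ('b, 'e) metric \<Rightarrow>
   ('a \<Rightarrow> real) \<Rightarrow>
   ('n::{t2_space,second_countable_topology}, 'f::euclidean_space) chart set \<Rightarrow> ('n, 'f) metric \<Rightarrow>
   ('n, 'f) endo_field \<Rightarrow> ('a \<times> 'b \<Rightarrow> 'n) \<Rightarrow> bool" where
  "warped_product_pointwise_semi_slant A1 g1 A2 g2 f B gbar J F \<longleftrightarrow>
     warped_product_pointwise_bi_slant A1 g1 A2 g2 f B gbar J F \<and>
     ((\<forall>y. invariant_submanifold A1 B J (\<lambda>x. F (x, y))) \<and>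
      (\<forall>x. \<exists>\<theta>. pointwise_slant_submanifold A2 B gbar J (\<lambda>y. F (x, y)) \<theta> \<and>
               (\<forall>y. \<theta> y \<in> {0..pi/2})) \<or>
      (\<forall>x. invariant_submanifold A2 B J (\<lambda>y. F (x, y))) \<and>
      (\<forall>y. \<exists>\<theta>. pointwise_slant_submanifold A1 B gbar J (\<lambda>x. F (x, y)) \<theta> \<and>
               (\<forall>x. \<theta> x \<in> {0..pi/2})))"

end

theory Submission
  imports Defs
begin

text \<open>Write \<open>D\<^sub>1 = TM\<^sub>\<theta>\<close> and \<open>D\<^sub>2 = TM\<^sub>T\<close>. Each of the two terms lies in \<open>D\<^sub>1\<close> by itself: if \<open>U\<close> and
  \<open>X\<close> are sections of \<open>D\<^sub>1\<close>, then so is \<open>A\<^bsub>NU\<^esub>X\<close>, and \<open>U = T\<^sub>1Y\<close> is a section of \<open>D\<^sub>1\<close>. As \<open>D\<^sub>1\<close> is the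
  orthogonal complement of \<open>D\<^sub>2\<close>, it has to be shown that \<open>A\<^bsub>NU\<^esub>X\<close> is orthogonal to every \<open>Z\<close> in \<open>D\<^sub>2\<close>.
  Since \<open>NU\<close> is orthogonal to \<open>Z\<close> and \<open>J\<close> is self-adjoint and parallel,

  \<open>g(A\<^bsub>NU\<^esub>X, Z) = - g(\<nabla>\<^sub>X NU, Z) = g(NU, \<nabla>\<^sub>X Z) = g(JU - TU, \<nabla>\<^sub>X Z) = g(U, \<nabla>\<^sub>X JZ) - g(TU, \<nabla>\<^sub>X Z)\<close>.

  Here \<open>Z\<close> and, by the invariance of the fiber, \<open>JZ\<close> are in \<open>D\<^sub>2\<close>, while \<open>U\<close> and \<open>TU\<close> are in \<open>D\<^sub>1\<close>. Both terms
  vanish because the copies \<open>M\<^sub>\<theta> \<times> {y}\<close> of the base are totally geodesic in a warped product. This is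
  \<open>base_totally_geodesic\<close>; it is the Koszul formula for coordinate fields, applied to the two facts
  that \<open>D\<^sub>1\<close> and \<open>D\<^sub>2\<close> are orthogonal and that the metric on \<open>D\<^sub>1\<close> is the one of the base. The
  displayed computation is \<open>shape_op_D1\<close>.

  Two bodies of tools carry this argument. The connection induced on vector fields along the
  immersion \<open>F\<close> is given by a formula in charts, and needs the rules of a connection: it has values
  in the tangent spaces (\<open>cov_tangent\<close>), differentiates inner products (\<open>pder_gbar\<close>), commutes with
  \<open>J\<close> (\<open>cov_J\<close>) and is torsion free on coordinate fields (\<open>cov_coord_vec_symmetric\<close>). A field along
  \<open>F\<close> need not extend to the ambient manifold, but locally it is a combination, with functions as
  coefficients, of ambient coordinate fields; so the rules follow from the case of a composition
  \<open>Y \<circ> F\<close>, where the induced connection is the ambient one (\<open>cov_field\<close>), and from the Leibniz rule.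
  The smoothness of \<open>A\<^bsub>NU\<^esub>X\<close> comes down to that of the tangential part of a smooth field along \<open>F\<close>
  (\<open>tan_part_field\<close>), for which Gram-Schmidt orthogonalization provides smooth local frames
  (\<open>gram_schmidt\<close>).\<close>

section \<open>Calculus of \<open>C\<^sup>k\<close> maps\<close>

lemma frechet_derivative_eqI:
  "(f has_derivative f') (at x) \<Longrightarrow> frechet_derivative f (at x) = f'"
  using frechet_derivative_at by metis

lemma Ck_on_cong:
  assumes "open S" "\<And>x. x \<in> S \<Longrightarrow> f x = g x" "Ck_on k S f"
  shows "Ck_on k S g"
  using assms(2,3)
proof (induction k arbitrary: f g)
  case 0
  then show ?case by (simp cong: continuous_on_cong)
next
  case (Suc k)
  have "f differentiable at x \<Longrightarrow> x \<in> S \<Longrightarrow> g differentiable at x" for x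
    using Suc.prems(1) \<open>open S\<close>
    by (meson differentiable_def has_derivative_transform_within_open)
  moreover have "frechet_derivative f (at x) = frechet_derivative g (at x)" if "x \<in> S" for x
    using Suc.prems that \<open>open S\<close>
    by (intro frechet_derivative_transform_within_open) auto
  ultimately show ?case
    using Suc.prems Suc.IH[of "\<lambda>x. frechet_derivative f (at x) v"
        "\<lambda>x. frechet_derivative g (at x) v" for v] by auto
qed

lemma Ck_on_subset: "Ck_on k S f \<Longrightarrow> T \<subseteq> S \<Longrightarrow> Ck_on k T f"
  by (induction k arbitrary: f) (auto intro: continuous_on_subset)

lemma Ck_on_local:
  assumes "\<And>x. x \<in> S \<Longrightarrow> \<exists>U. open U \<and> x \<in> U \<and> Ck_on k U f"
  shows "Ck_on k S f"
  using assms
proof (induction k arbitrary: f)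
  case 0
  then show ?case
    by simp (metis continuous_at_imp_continuous_on continuous_on_eq_continuous_at)
next
  case (Suc k)
  then show ?case by simp (metis (no_types, lifting))
qed

lemma Ck_on_Suc_D: "Ck_on (Suc k) S f \<Longrightarrow> Ck_on k S f"
proof (induction k arbitrary: f)
  case 0
  then show ?case
    by (auto intro!: continuous_at_imp_continuous_on differentiable_imp_continuous_within)
next
  case (Suc k)
  then show ?case by (metis Ck_on.simps(2))
qed

lemma Ck_on_const: "Ck_on k S (\<lambda>x. c)"
  by (induction k arbitrary: c) auto

text \<open>The closure properties below are proved by induction on \<open>k\<close>. This rule replaces the derivative
  that the definition chooses by the expression that a differentiation rule yields.\<close>

lemma Ck_on_SucI:
  assumes "open S" "\<And>x. x \<in> S \<Longrightarrow> (f has_derivative D x) (at x)" "\<And>v. Ck_on k S (\<lambda>x. D x v)"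
  shows "Ck_on (Suc k) S f"
proof -
  have "Ck_on k S (\<lambda>x. frechet_derivative f (at x) v)" for v
    by (rule Ck_on_cong[OF assms(1) _ assms(3)[of v]])
      (simp add: frechet_derivative_eqI[OF assms(2)])
  then show ?thesis using assms(2) unfolding Ck_on.simps differentiable_def by blast
qed

lemma Ck_on_Suc_has_derivative:
  "Ck_on (Suc k) S f \<Longrightarrow> x \<in> S \<Longrightarrow> (f has_derivative frechet_derivative f (at x)) (at x)"
  by (simp add: frechet_derivative_works)

lemma Ck_on_Suc_frechet_derivative:
  "Ck_on (Suc k) S f \<Longrightarrow> Ck_on k S (\<lambda>x. frechet_derivative f (at x) v)"
  by simp

lemma frechet_derivative_linear_compose:
  assumes "bounded_linear L" "f differentiable (at x)"
  shows "frechet_derivative (\<lambda>x. L (f x)) (at x) = (\<lambda>v. L (frechet_derivative f (at x) v))"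
  using assms(2) unfolding frechet_derivative_works
  by (intro frechet_derivative_eqI bounded_linear.has_derivative[OF assms(1)])

lemma Ck_on_linear:
  assumes "bounded_linear L" "open S" "Ck_on k S f"
  shows "Ck_on k S (\<lambda>x. L (f x))"
  using assms(3)
proof (induction k arbitrary: f)
  case 0
  then show ?case using bounded_linear.continuous_on[OF assms(1)] by auto
next
  case (Suc k)
  show ?case
    by (rule Ck_on_SucI[OF assms(2) bounded_linear.has_derivative[OF assms(1)
            Ck_on_Suc_has_derivative[OF Suc.prems]]
          Suc.IH[OF Ck_on_Suc_frechet_derivative[OF Suc.prems]]])
qed

lemma Ck_on_add:
  assumes "open S" "Ck_on k S f" "Ck_on k S g"
  shows "Ck_on k S (\<lambda>x. f x + g x)"
  using assms(2,3)
proof (induction k arbitrary: f g)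
  case 0
  then show ?case by (auto intro: continuous_on_add)
next
  case (Suc k)
  show ?case
    by (rule Ck_on_SucI[OF assms(1) has_derivative_add[OF Suc.prems[THEN Ck_on_Suc_has_derivative]]
          Suc.IH[OF Suc.prems[THEN Ck_on_Suc_frechet_derivative]]])
qed

lemma Ck_on_sum:
  assumes "open S" "\<And>i. i \<in> I \<Longrightarrow> Ck_on k S (f i)"
  shows "Ck_on k S (\<lambda>x. \<Sum>i\<in>I. f i x)"
  using assms(2)
  by (induction I rule: infinite_finite_induct) (simp_all add: Ck_on_const Ck_on_add assms(1))

lemma Ck_on_bilinear:
  assumes "bounded_bilinear B" "open S" "Ck_on k S f" "Ck_on k S g"
  shows "Ck_on k S (\<lambda>x. B (f x) (g x))"
  using assms(3,4)
proof (induction k arbitrary: f g)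
  case 0
  then show ?case using bounded_bilinear.continuous_on[OF assms(1)] by auto
next
  case (Suc k)
  note D = Suc.prems[THEN Ck_on_Suc_frechet_derivative] and C = Suc.prems[THEN Ck_on_Suc_D]
  show ?case
    by (rule Ck_on_SucI[OF assms(2)
          bounded_bilinear.FDERIV[OF assms(1) Suc.prems[THEN Ck_on_Suc_has_derivative]]
          Ck_on_add[OF assms(2) Suc.IH[OF C(1) D(2)] Suc.IH[OF D(1) C(2)]]])
qed

lemma frechet_derivative_expand:
  fixes f :: "'a::euclidean_space \<Rightarrow> 'b::real_normed_vector"
  assumes "f differentiable (at x)"
  shows "frechet_derivative f (at x) v = (\<Sum>b\<in>Basis. (v \<bullet> b) *\<^sub>R frechet_derivative f (at x) b)"
proof -
  have lin: "linear (frechet_derivative f (at x))"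
    using assms by (rule linear_frechet_derivative)
  have "frechet_derivative f (at x) v = frechet_derivative f (at x) (\<Sum>b\<in>Basis. (v \<bullet> b) *\<^sub>R b)"
    by (simp add: euclidean_representation)
  then show ?thesis by (simp only: linear_sum[OF lin] linear_cmul[OF lin])
qed

text \<open>The components of \<open>Df(x)v\<close> in a basis separate the two sources of \<open>x\<close> in
  \<open>Dg(f x)(Df(x)v)\<close>, so that the induction hypothesis applies to \<open>x \<mapsto> Dg(f x)b\<close> for fixed \<open>b\<close>.\<close>

lemma Ck_on_compose:
  fixes g :: "'b::euclidean_space \<Rightarrow> 'c::real_normed_vector"
  assumes "open S" "open T" "f ` S \<subseteq> T" "Ck_on k T g" "Ck_on k S f"
  shows "Ck_on k S (\<lambda>x. g (f x))"
  using assms(4,5)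
proof (induction k arbitrary: g)
  case 0
  then show ?case using assms(3) by (auto intro: continuous_on_compose2)
next
  case (Suc k)
  have "((\<lambda>x. g (f x)) has_derivative (\<lambda>v. \<Sum>b\<in>Basis.
      (frechet_derivative f (at x) v \<bullet> b) *\<^sub>R frechet_derivative g (at (f x)) b)) (at x)"
    if "x \<in> S" for x
  proof -
    have fx: "f x \<in> T" using assms(3) that by blast
    have "g differentiable (at (f x))"
      using Suc.prems(1) fx by simp
    then have "(\<lambda>v. frechet_derivative g (at (f x)) (frechet_derivative f (at x) v)) =
      (\<lambda>v. \<Sum>b\<in>Basis.
        (frechet_derivative f (at x) v \<bullet> b) *\<^sub>R frechet_derivative g (at (f x)) b)"
      by (intro ext frechet_derivative_expand)
    with has_derivative_compose[OF Ck_on_Suc_has_derivative[OF Suc.prems(2) that]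
        Ck_on_Suc_has_derivative[OF Suc.prems(1) fx]]
    show ?thesis by simp
  qed
  from Ck_on_SucI[OF assms(1) this] show ?case
    by this (assumption, intro Ck_on_sum Ck_on_bilinear[OF bounded_bilinear_scaleR] assms(1)
        Ck_on_linear[OF bounded_linear_inner_left] Ck_on_Suc_frechet_derivative[OF Suc.prems(2)]
        Suc.IH Ck_on_Suc_frechet_derivative[OF Suc.prems(1)] Ck_on_Suc_D[OF Suc.prems(2)])
qed

lemma Ck_on_inverse:
  fixes f :: "'a::real_normed_vector \<Rightarrow> real"
  assumes "open S" "\<And>x. x \<in> S \<Longrightarrow> f x \<noteq> 0" "Ck_on k S f"
  shows "Ck_on k S (\<lambda>x. inverse (f x))"
  using assms(3)
proof (induction k)
  case 0
  then show ?case using assms(2) by (auto intro!: continuous_on_inverse)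
next
  case (Suc k)
  have C: "Ck_on k S (\<lambda>x. inverse (f x))"
    by (intro Suc.IH Ck_on_Suc_D[OF Suc.prems])
  have "((\<lambda>x. inverse (f x)) has_derivative
      (\<lambda>v. - (inverse (f x) * frechet_derivative f (at x) v * inverse (f x)))) (at x)"
    if "x \<in> S" for x
    using that by (intro Deriv.has_derivative_inverse assms(2) Ck_on_Suc_has_derivative[OF Suc.prems])
  from Ck_on_SucI[OF assms(1) this] show ?case
    by this (assumption, intro Ck_on_linear[OF bounded_linear_minus[OF bounded_linear_ident]] C
        Ck_on_bilinear[OF bounded_bilinear_mult] assms(1) Ck_on_Suc_frechet_derivative[OF Suc.prems])
qed

lemma smooth_on_cong:
  "open S \<Longrightarrow> (\<And>x. x \<in> S \<Longrightarrow> f x = g x) \<Longrightarrow> smooth_on S f \<Longrightarrow> smooth_on S g"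
  unfolding smooth_on_def by (intro allI Ck_on_cong[of S f g]) auto

lemma smooth_on_subset: "smooth_on S f \<Longrightarrow> T \<subseteq> S \<Longrightarrow> smooth_on T f"
  unfolding smooth_on_def by (intro allI Ck_on_subset[of _ S f T]) auto

lemma smooth_on_local:
  "(\<And>x. x \<in> S \<Longrightarrow> \<exists>U. open U \<and> x \<in> U \<and> smooth_on U f) \<Longrightarrow> smooth_on S f"
  unfolding smooth_on_def by (intro allI Ck_on_local) blast

lemma smooth_on_const: "smooth_on S (\<lambda>x. c)"
  by (simp add: smooth_on_def Ck_on_const)

lemma smooth_on_linear:
  "bounded_linear L \<Longrightarrow> open S \<Longrightarrow> smooth_on S f \<Longrightarrow> smooth_on S (\<lambda>x. L (f x))"
  by (simp add: smooth_on_def Ck_on_linear)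

lemma smooth_on_bilinear:
  "bounded_bilinear B \<Longrightarrow> open S \<Longrightarrow> smooth_on S f \<Longrightarrow> smooth_on S g \<Longrightarrow>
    smooth_on S (\<lambda>x. B (f x) (g x))"
  by (simp add: smooth_on_def Ck_on_bilinear)

lemmas smooth_on_inner_left = smooth_on_linear[OF bounded_linear_inner_left]
  and smooth_on_minus = smooth_on_linear[OF bounded_linear_minus[OF bounded_linear_ident]]
  and smooth_on_scaleR = smooth_on_bilinear[OF bounded_bilinear_scaleR]
  and smooth_on_mult = smooth_on_bilinear[OF bounded_bilinear_mult]

lemma smooth_on_add:
  "open S \<Longrightarrow> smooth_on S f \<Longrightarrow> smooth_on S g \<Longrightarrow> smooth_on S (\<lambda>x. f x + g x)"
  by (simp add: smooth_on_def Ck_on_add)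

lemma smooth_on_diff:
  fixes f g :: "_ \<Rightarrow> 'a::real_normed_vector"
  shows "open S \<Longrightarrow> smooth_on S f \<Longrightarrow> smooth_on S g \<Longrightarrow> smooth_on S (\<lambda>x. f x - g x)"
  using smooth_on_add[OF _ _ smooth_on_minus, of S f g] by simp

lemma smooth_on_sum:
  "open S \<Longrightarrow> (\<And>i. i \<in> I \<Longrightarrow> smooth_on S (f i)) \<Longrightarrow> smooth_on S (\<lambda>x. \<Sum>i\<in>I. f i x)"
  by (simp add: smooth_on_def Ck_on_sum)

lemma smooth_on_compose:
  fixes g :: "'b::euclidean_space \<Rightarrow> 'c::real_normed_vector"
  shows "open S \<Longrightarrow> open T \<Longrightarrow> f ` S \<subseteq> T \<Longrightarrow> smooth_on T g \<Longrightarrow> smooth_on S f \<Longrightarrow>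
    smooth_on S (\<lambda>x. g (f x))"
  unfolding smooth_on_def by (rule allI, rule Ck_on_compose[of S T f]) simp_all

lemma smooth_on_inverse:
  fixes f :: "'a::real_normed_vector \<Rightarrow> real"
  shows "open S \<Longrightarrow> (\<And>x. x \<in> S \<Longrightarrow> f x \<noteq> 0) \<Longrightarrow> smooth_on S f \<Longrightarrow> smooth_on S (\<lambda>x. inverse (f x))"
  by (simp add: smooth_on_def Ck_on_inverse)

lemma smooth_on_Pair:
  assumes "open S" "smooth_on S f" "smooth_on S g"
  shows "smooth_on S (\<lambda>x. (f x, g x))"
proof -
  have "smooth_on S (\<lambda>x. (f x, 0) + (0, g x))"
    by (intro smooth_on_add assms(1)
        smooth_on_linear[OF bounded_linear_Pair[OF bounded_linear_ident bounded_linear_zero] assms(1,2)]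
        smooth_on_linear[OF bounded_linear_Pair[OF bounded_linear_zero bounded_linear_ident] assms(1,3)])
  then show ?thesis by simp
qed

lemma smooth_on_ident: "smooth_on S (\<lambda>x. x)"
proof -
  have "Ck_on k S (\<lambda>x. x)" for k by (cases k) (auto simp: Ck_on_const)
  then show ?thesis by (simp add: smooth_on_def)
qed

lemma smooth_on_differentiable: "smooth_on S f \<Longrightarrow> x \<in> S \<Longrightarrow> f differentiable (at x)"
  unfolding smooth_on_def using Ck_on.simps(2)[of 0 S f] by blast

lemma smooth_on_has_derivative:
  "smooth_on S f \<Longrightarrow> x \<in> S \<Longrightarrow> (f has_derivative frechet_derivative f (at x)) (at x)"
  using smooth_on_differentiable unfolding frechet_derivative_works .

lemma smooth_on_frechet_derivative:
  "smooth_on S f \<Longrightarrow> smooth_on S (\<lambda>x. frechet_derivative f (at x) v)"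
  unfolding smooth_on_def using Ck_on_Suc_frechet_derivative by blast

lemma smooth_on_frechet_derivative_apply:
  fixes f :: "'a::euclidean_space \<Rightarrow> 'b::real_normed_vector"
    and g :: "'c::real_normed_vector \<Rightarrow> 'a" and v :: "'c \<Rightarrow> 'a"
  assumes "open S" "open T" "g ` S \<subseteq> T" "smooth_on T f" "smooth_on S g" "smooth_on S v"
  shows "smooth_on S (\<lambda>x. frechet_derivative f (at (g x)) (v x))"
proof -
  have "smooth_on S (\<lambda>x. \<Sum>b\<in>Basis. (v x \<bullet> b) *\<^sub>R frechet_derivative f (at (g x)) b)"
    by (intro smooth_on_sum smooth_on_scaleR smooth_on_inner_left assms(1,6)
        smooth_on_compose[OF assms(1-3) _ assms(5)] smooth_on_frechet_derivative[OF assms(4)])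
  then show ?thesis
    using assms by (elim smooth_on_cong[rotated -1])
      (auto intro!: frechet_derivative_expand[symmetric] smooth_on_differentiable[OF assms(4)])
qed

text \<open>The second difference is symmetric in \<open>a\<close> and \<open>b\<close>, while the mean value theorem, applied first in
  the direction \<open>a\<close> and then in the direction \<open>b\<close>, turns it into the second derivative taken in this
  order. Comparing both orders in the limit \<open>h \<rightarrow> 0\<close> gives Schwarz's theorem.\<close>

lemma second_difference_mvt:
  fixes f :: "'a::real_normed_vector \<Rightarrow> real"
  assumes h: "h > 0" and S: "\<And>s t. 0 \<le> s \<Longrightarrow> s \<le> h \<Longrightarrow> 0 \<le> t \<Longrightarrow> t \<le> h \<Longrightarrow> x + s *\<^sub>R a + t *\<^sub>R b \<in> S"
    and f: "Ck_on 2 S f"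
  shows "\<exists>s t. 0 < s \<and> s < h \<and> 0 < t \<and> t < h \<and>
    f (x + h *\<^sub>R a + h *\<^sub>R b) - f (x + h *\<^sub>R a) - f (x + h *\<^sub>R b) + f x =
    h * h * frechet_derivative (\<lambda>y. frechet_derivative f (at y) a) (at (x + s *\<^sub>R a + t *\<^sub>R b)) b"
proof -
  let ?fa = "\<lambda>y. frechet_derivative f (at y) a"
  have line: "DERIV (\<lambda>s. g (y + s *\<^sub>R v)) s :> frechet_derivative g (at (y + s *\<^sub>R v)) v"
    if "g differentiable (at (y + s *\<^sub>R v))" for g :: "'a \<Rightarrow> real" and y v s
  proof -
    have "(g has_derivative frechet_derivative g (at (y + s *\<^sub>R v))) (at (y + s *\<^sub>R v))"
      using that frechet_derivative_works by blast
    moreover have "((\<lambda>s. y + s *\<^sub>R v) has_derivative (\<lambda>t. t *\<^sub>R v)) (at s)"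
      by (auto intro!: derivative_eq_intros)
    ultimately have "((\<lambda>s. g (y + s *\<^sub>R v)) has_derivative
        (\<lambda>t. frechet_derivative g (at (y + s *\<^sub>R v)) (t *\<^sub>R v))) (at s)"
      by (rule has_derivative_compose[rotated])
    then show ?thesis
      by (simp add: has_field_derivative_def linear_cmul[OF linear_frechet_derivative[OF that]])
        (simp add: mult_commute_abs)
  qed
  have df: "f differentiable (at y)" "?fa differentiable (at y)" if "y \<in> S" for y
    using f that by (auto simp: numeral_2_eq_2)
  have "\<exists>s. 0 < s \<and> s < h \<and> (f (x + h *\<^sub>R b + h *\<^sub>R a) - f (x + h *\<^sub>R a))
      - (f (x + h *\<^sub>R b + 0 *\<^sub>R a) - f (x + 0 *\<^sub>R a))
     = (h - 0) * (?fa (x + h *\<^sub>R b + s *\<^sub>R a) - ?fa (x + s *\<^sub>R a))"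
  proof (intro MVT2 h DERIV_diff line df)
    fix s assume "0 \<le> s" "s \<le> h"
    then show "x + h *\<^sub>R b + s *\<^sub>R a \<in> S" "x + s *\<^sub>R a \<in> S"
      using h S[of s h] S[of s 0] by (simp_all add: ac_simps)
  qed
  then obtain s where s: "0 < s" "s < h" and 
    1: "f (x + h *\<^sub>R a + h *\<^sub>R b) - f (x + h *\<^sub>R a) - f (x + h *\<^sub>R b) + f x
     = h * (?fa (x + s *\<^sub>R a + h *\<^sub>R b) - ?fa (x + s *\<^sub>R a))"
    by (auto simp: algebra_simps)
  have "\<exists>t. 0 < t \<and> t < h \<and> ?fa (x + s *\<^sub>R a + h *\<^sub>R b) - ?fa (x + s *\<^sub>R a + 0 *\<^sub>R b)
     = (h - 0) * frechet_derivative ?fa (at (x + s *\<^sub>R a + t *\<^sub>R b)) b"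
    using s S[of s] by (intro MVT2 h line df) simp_all
  then show ?thesis using s 1 by auto
qed

lemma second_derivative_symmetric_real:
  fixes f :: "'a::real_normed_vector \<Rightarrow> real"
  assumes S: "open S" "x \<in> S" and f: "Ck_on 2 S f"
  shows "frechet_derivative (\<lambda>y. frechet_derivative f (at y) a) (at x) b =
         frechet_derivative (\<lambda>y. frechet_derivative f (at y) b) (at x) a" (is "?P a b = ?P b a")
proof (rule ccontr)
  define P where "P a b y = frechet_derivative (\<lambda>y. frechet_derivative f (at y) a) (at y) b" for a b y
  assume "?P a b \<noteq> ?P b a"
  then have ne: "dist (P a b x) (P b a x) > 0" (is "?e > 0") by (simp add: P_def)
  have "continuous_on S (P a b)" for a b
    using f by (simp add: numeral_2_eq_2 P_def[abs_def])
  then have "(P a b \<longlongrightarrow> P a b x) (nhds x)" for a b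
    using S by (simp add: continuous_on_eq_continuous_at tendsto_nhds_iff isCont_def)
  then have near: "\<forall>\<^sub>F y in nhds x. dist (P a b y) (P a b x) < ?e / 2" for a b
    by (rule tendstoD) (use ne in simp)
  have "\<forall>\<^sub>F y in nhds x. y \<in> S \<and> dist (P a b y) (P a b x) < ?e / 2 \<and> dist (P b a y) (P b a x) < ?e / 2"
    by (intro eventually_conj near eventually_nhds_in_open S)
  then obtain r where r: "r > 0" "\<And>y. dist y x < r \<Longrightarrow>
      y \<in> S \<and> dist (P a b y) (P a b x) < ?e / 2 \<and> dist (P b a y) (P b a x) < ?e / 2"
    unfolding eventually_nhds_metric by blast
  \<comment> \<open>Small enough for the parallelogram with sides \<open>h a\<close> and \<open>h b\<close> to stay in the ball of radius \<open>r\<close>.\<close>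
  define h where "h = r / (2 * (norm a + norm b + 1))"
  have h: "h > 0" unfolding h_def using r by (auto intro!: divide_pos_pos add_nonneg_pos)
  have small: "dist (x + s *\<^sub>R a + t *\<^sub>R b) x < r" if "0 \<le> s" "s \<le> h" "0 \<le> t" "t \<le> h" for s t
  proof -
    have "norm (s *\<^sub>R a + t *\<^sub>R b) \<le> s * norm a + t * norm b"
      using that norm_triangle_ineq[of "s *\<^sub>R a" "t *\<^sub>R b"] by simp
    also have "\<dots> \<le> h * norm a + h * norm b" using that by (intro add_mono mult_right_mono) auto
    also have "\<dots> < 2 * (h * (norm a + norm b + 1))"
      using h mult_nonneg_nonneg[of h "norm a"] mult_nonneg_nonneg[of h "norm b"] 
      by (simp add: algebra_simps del: mult_nonneg_nonneg)
    also have "\<dots> = r" 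
      using add_nonneg_pos[of "norm a + norm b" 1] by (simp add: h_def field_simps)
    finally show ?thesis by (simp add: dist_norm add.assoc)
  qed
  obtain s t where st: "0 < s" "s < h" "0 < t" "t < h" and
    1: "f (x + h *\<^sub>R a + h *\<^sub>R b) - f (x + h *\<^sub>R a) - f (x + h *\<^sub>R b) + f x
     = h * h * P a b (x + s *\<^sub>R a + t *\<^sub>R b)"
    using second_difference_mvt[OF h r(2)[OF small, THEN conjunct1] f]
    unfolding P_def by (auto elim!: exE conjE)
  have small': "dist (x + s *\<^sub>R b + t *\<^sub>R a) x < r" if "0 \<le> s" "s \<le> h" "0 \<le> t" "t \<le> h" for s t
    using small[of t s] that by (simp add: algebra_simps)
  obtain s' t' where st': "0 < s'" "s' < h" "0 < t'" "t' < h" and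
    2: "f (x + h *\<^sub>R b + h *\<^sub>R a) - f (x + h *\<^sub>R b) - f (x + h *\<^sub>R a) + f x
     = h * h * P b a (x + s' *\<^sub>R b + t' *\<^sub>R a)"
    using second_difference_mvt[OF h r(2)[OF small', THEN conjunct1] f]
    unfolding P_def by (auto elim!: exE conjE)
  from 1 2 have "h * h * P a b (x + s *\<^sub>R a + t *\<^sub>R b) = h * h * P b a (x + s' *\<^sub>R b + t' *\<^sub>R a)"
    by (simp add: algebra_simps)
  then have "P a b (x + s *\<^sub>R a + t *\<^sub>R b) = P b a (x + s' *\<^sub>R b + t' *\<^sub>R a)" using h by simp
  moreover have "dist (P a b (x + s *\<^sub>R a + t *\<^sub>R b)) (P a b x) < ?e / 2"
    "dist (P b a (x + s' *\<^sub>R b + t' *\<^sub>R a)) (P b a x) < ?e / 2"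
    using r(2)[OF small[of s t]] r(2)[OF small'[of s' t']] st st' by simp_all
  ultimately have "dist (P a b x) (P b a x) < ?e"
    by (metis dist_commute dist_triangle_half_r)
  then show False by simp
qed

lemma second_derivative_symmetric:
  fixes f :: "'a::real_normed_vector \<Rightarrow> 'b::euclidean_space"
  assumes S: "open S" "x \<in> S" and f: "smooth_on S f"
  shows "frechet_derivative (\<lambda>y. frechet_derivative f (at y) a) (at x) b =
         frechet_derivative (\<lambda>y. frechet_derivative f (at y) b) (at x) a"
proof (rule euclidean_eqI)
  fix e :: 'b assume "e \<in> Basis"
  let ?g = "\<lambda>y. f y \<bullet> e"
  have g: "Ck_on 2 S ?g"
    using smooth_on_inner_left[OF S(1) f] by (simp add: smooth_on_def)
  have 1: "frechet_derivative ?g (at y) v = frechet_derivative f (at y) v \<bullet> e" if "y \<in> S" for y v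
    using frechet_derivative_linear_compose[OF bounded_linear_inner_left smooth_on_differentiable[OF f that]]
    by metis
  have 2: "frechet_derivative (\<lambda>y. frechet_derivative ?g (at y) u) (at x) v
    = frechet_derivative (\<lambda>y. frechet_derivative f (at y) u) (at x) v \<bullet> e" for u v
  proof -
    have "frechet_derivative (\<lambda>y. frechet_derivative f (at y) u \<bullet> e) (at x)
       = frechet_derivative (\<lambda>y. frechet_derivative ?g (at y) u) (at x)"
      using S 1 smooth_on_differentiable[OF smooth_on_inner_left[OF S(1) smooth_on_frechet_derivative[OF f]]]
      by (intro frechet_derivative_transform_within_open) auto
    then show ?thesis
      using frechet_derivative_linear_compose[OF bounded_linear_inner_left
          smooth_on_differentiable[OF smooth_on_frechet_derivative[OF f] S(2)]] by metis
  qed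
  show "frechet_derivative (\<lambda>y. frechet_derivative f (at y) a) (at x) b \<bullet> e =
      frechet_derivative (\<lambda>y. frechet_derivative f (at y) b) (at x) a \<bullet> e"
    using second_derivative_symmetric_real[OF S g, of a b] by (simp add: 2)
qed

section \<open>Charts and tangent vectors\<close>

lemma sum_fun_apply: "(\<Sum>i\<in>I. f i) x = (\<Sum>i\<in>I. f i x)"
  by (induction I rule: infinite_finite_induct) simp_all

lemma scaleR_fun_apply [simp]: "(a *\<^sub>R f) x = a *\<^sub>R f x"
  by (simp add: scaleR_fun_def)

text \<open>This extends \<open>dir_deriv\<close> to functions with values in a normed space, such as the components of
  vector fields in a chart.\<close>

definition pder :: "('m, 'e::euclidean_space) chart set \<Rightarrow> 'm \<Rightarrow> ('m, 'e) tvec \<Rightarrow>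
    ('m \<Rightarrow> 'v::real_normed_vector) \<Rightarrow> 'v" where
  "pder A p v \<phi> =
     (let c = chart_at A p in frechet_derivative (\<phi> \<circ> cinv c) (at (snd c p)) (v c))"

lemma dir_deriv_eq_pder: "dir_deriv = pder"
  by (simp add: fun_eq_iff dir_deriv_def pder_def)

locale manifold =
  fixes A :: "('m::{t2_space,second_countable_topology}, 'e::euclidean_space) chart set"
  assumes smooth_manifold: "smooth_manifold A"
begin

lemma chart_at: "chart_at A p \<in> A" "p \<in> fst (chart_at A p)"
proof -
  have "\<exists>c. c \<in> A \<and> p \<in> fst c"
    using smooth_manifold unfolding smooth_manifold_def by blast
  from someI_ex[OF this] show "chart_at A p \<in> A" "p \<in> fst (chart_at A p)"
    unfolding chart_at_def by auto
qed

lemma chart_homeomorphism: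
  "c \<in> A \<Longrightarrow> open (fst c)" "c \<in> A \<Longrightarrow> open (snd c ` fst c)"
  "c \<in> A \<Longrightarrow> homeomorphism (fst c) (snd c ` fst c) (snd c) (cinv c)"
  using smooth_manifold unfolding smooth_manifold_def by auto

lemma cinv_chart: "c \<in> A \<Longrightarrow> p \<in> fst c \<Longrightarrow> cinv c (snd c p) = p"
  using chart_homeomorphism(3) by (rule homeomorphism_apply1)

lemma chart_cinv: "c \<in> A \<Longrightarrow> x \<in> snd c ` fst c \<Longrightarrow> snd c (cinv c x) = x"
  using chart_homeomorphism(3) by (rule homeomorphism_apply2)

lemma cinv_in_domain: "c \<in> A \<Longrightarrow> x \<in> snd c ` fst c \<Longrightarrow> cinv c x \<in> fst c"
  by (auto simp: cinv_chart)

lemma continuous_on_cinv: "c \<in> A \<Longrightarrow> continuous_on (snd c ` fst c) (cinv c)"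
  using chart_homeomorphism(3) by (simp add: homeomorphism_def)

lemma chart_image_eq:
  assumes "c \<in> A"
  shows "snd c ` (fst c \<inter> U) = snd c ` fst c \<inter> cinv c -` U"
  using assms by (auto simp: cinv_chart)

lemma open_chart_image: "c \<in> A \<Longrightarrow> open U \<Longrightarrow> open (snd c ` (fst c \<inter> U))"
  unfolding chart_image_eq
  using continuous_on_open_vimage[OF chart_homeomorphism(2)] continuous_on_cinv
  by (metis Int_commute)

lemma transition_smooth:
  "c \<in> A \<Longrightarrow> c' \<in> A \<Longrightarrow> smooth_on (snd c ` (fst c \<inter> fst c')) (snd c' \<circ> cinv c)"
  using smooth_manifold unfolding smooth_manifold_def by blast

lemma transition_differentiable:
  assumes "c \<in> A" "c' \<in> A" "p \<in> fst c" "p \<in> fst c'"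
  shows "(snd c' \<circ> cinv c) differentiable (at (snd c p))"
  using assms by (intro smooth_on_differentiable[OF transition_smooth]) auto

lemma differentiable_chart_change:
  assumes "c \<in> A" "c' \<in> A" "p \<in> fst c" "p \<in> fst c'"
    and "(\<phi> \<circ> cinv c') differentiable (at (snd c' p))"
  shows "(\<phi> \<circ> cinv c) differentiable (at (snd c p))"
    and "frechet_derivative (\<phi> \<circ> cinv c) (at (snd c p)) u =
      frechet_derivative (\<phi> \<circ> cinv c') (at (snd c' p))
        (frechet_derivative (snd c' \<circ> cinv c) (at (snd c p)) u)"
proof -
  have "((\<phi> \<circ> cinv c') has_derivative frechet_derivative (\<phi> \<circ> cinv c') (at (snd c' p)))
      (at ((snd c' \<circ> cinv c) (snd c p)))"
    using assms by (simp add: cinv_chart frechet_derivative_works)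
  from diff_chain_at[OF transition_differentiable[OF assms(1-4), unfolded frechet_derivative_works] this]
  have "((\<lambda>x. \<phi> (cinv c' (snd c' (cinv c x)))) has_derivative
      (\<lambda>u. frechet_derivative (\<phi> \<circ> cinv c') (at (snd c' p))
        (frechet_derivative (snd c' \<circ> cinv c) (at (snd c p)) u))) (at (snd c p))"
    by (simp add: o_def)
  then have *: "((\<phi> \<circ> cinv c) has_derivative
      (\<lambda>u. frechet_derivative (\<phi> \<circ> cinv c') (at (snd c' p))
        (frechet_derivative (snd c' \<circ> cinv c) (at (snd c p)) u))) (at (snd c p))"
  proof (rule has_derivative_transform_within_open)
    show "open (snd c ` (fst c \<inter> fst c'))"
      using assms by (intro open_chart_image chart_homeomorphism(1))
    show "snd c p \<in> snd c ` (fst c \<inter> fst c')" using assms by blast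
  qed (use assms in \<open>auto simp: cinv_chart\<close>)
  then show "(\<phi> \<circ> cinv c) differentiable (at (snd c p))"
    by (rule differentiableI)
  show "frechet_derivative (\<phi> \<circ> cinv c) (at (snd c p)) u =
      frechet_derivative (\<phi> \<circ> cinv c') (at (snd c' p))
        (frechet_derivative (snd c' \<circ> cinv c) (at (snd c p)) u)"
    by (simp add: frechet_derivative_eqI[OF *])
qed

lemma tangent_spaceD:
  "v \<in> tangent_space A p \<Longrightarrow> c \<in> A \<Longrightarrow> c' \<in> A \<Longrightarrow> p \<in> fst c \<Longrightarrow> p \<in> fst c' \<Longrightarrow>
    v c' = frechet_derivative (snd c' \<circ> cinv c) (at (snd c p)) (v c)"
  unfolding tangent_space_def by blast

lemma tangent_space_zero: "v \<in> tangent_space A p \<Longrightarrow> \<not> (c \<in> A \<and> p \<in> fst c) \<Longrightarrow> v c = 0"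
  unfolding tangent_space_def by blast

text \<open>The components of a tangent vector transform by the derivatives of the coordinate changes, so by
  the chain rule any chart may take the place of the chosen one.\<close>

lemma pder_chart:
  assumes "c \<in> A" "p \<in> fst c" "v \<in> tangent_space A p"
    and "(\<phi> \<circ> cinv c) differentiable (at (snd c p))"
  shows "pder A p v \<phi> = frechet_derivative (\<phi> \<circ> cinv c) (at (snd c p)) (v c)"
  unfolding pder_def Let_def
  using differentiable_chart_change(2)[OF chart_at(1) assms(1) chart_at(2) assms(2,4)]
    tangent_spaceD[OF assms(3) chart_at(1) assms(1) chart_at(2) assms(2)]
  by simp

lemma linear_transition:
  assumes "c \<in> A" "c' \<in> A" "p \<in> fst c" "p \<in> fst c'"
  shows "linear (frechet_derivative (snd c' \<circ> cinv c) (at (snd c p)))"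
  by (rule linear_frechet_derivative[OF transition_differentiable[OF assms]])

lemma frechet_derivative_chart_cinv:
  assumes "c \<in> A" "p \<in> fst c"
  shows "frechet_derivative (snd c \<circ> cinv c) (at (snd c p)) = (\<lambda>u. u)"
proof (rule frechet_derivative_eqI, rule has_derivative_transform_within_open)
  show "((\<lambda>x. x) has_derivative (\<lambda>u. u)) (at (snd c p))" by simp
  show "open (snd c ` fst c)" using assms by (intro chart_homeomorphism)
qed (use assms in \<open>auto simp: cinv_chart\<close>)

lemma coord_vec_chart: "c \<in> A \<Longrightarrow> p \<in> fst c \<Longrightarrow> coord_vec A c u p c = u"
  by (simp add: coord_vec_def frechet_derivative_chart_cinv)

lemma coord_vec_tangent:
  assumes "c \<in> A" "p \<in> fst c"
  shows "coord_vec A c u p \<in> tangent_space A p"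
  unfolding tangent_space_def coord_vec_def using assms
  by (auto intro!: differentiable_chart_change(2) transition_differentiable)

lemma tangent_eq_coord_vec:
  assumes "c \<in> A" "p \<in> fst c" "v \<in> tangent_space A p"
  shows "v = coord_vec A c (v c) p"
  unfolding coord_vec_def
  using tangent_spaceD[OF assms(3,1) _ assms(2)] tangent_space_zero[OF assms(3)] by auto

lemma tangent_vec_eqI:
  assumes "c \<in> A" "p \<in> fst c" "v \<in> tangent_space A p" "w \<in> tangent_space A p" "v c = w c"
  shows "v = w"
  using tangent_eq_coord_vec[OF assms(1-3)] tangent_eq_coord_vec[OF assms(1,2,4)] assms(5) by simp

lemma coord_vec_add:
  assumes "c \<in> A" "p \<in> fst c"
  shows "coord_vec A c (u + v) p = coord_vec A c u p + coord_vec A c v p"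
  using linear_add[OF linear_transition[OF assms(1) _ assms(2)]]
  by (auto simp: coord_vec_def fun_eq_iff)

lemma coord_vec_scaleR:
  assumes "c \<in> A" "p \<in> fst c"
  shows "coord_vec A c (a *\<^sub>R u) p = a *\<^sub>R coord_vec A c u p"
  using linear_cmul[OF linear_transition[OF assms(1) _ assms(2)]]
  by (auto simp: coord_vec_def fun_eq_iff)

lemma tangent_spaceI:
  "(\<And>c c'. c \<in> A \<Longrightarrow> c' \<in> A \<Longrightarrow> p \<in> fst c \<Longrightarrow> p \<in> fst c' \<Longrightarrow>
      v c' = frechet_derivative (snd c' \<circ> cinv c) (at (snd c p)) (v c)) \<Longrightarrow>
    (\<And>c. \<not> (c \<in> A \<and> p \<in> fst c) \<Longrightarrow> v c = 0) \<Longrightarrow> v \<in> tangent_space A p"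
  unfolding tangent_space_def by blast

lemma subspace_tangent_space: "subspace (tangent_space A p)"
proof (rule subspaceI)
  show "0 \<in> tangent_space A p"
    by (rule tangent_spaceI) (simp_all add: linear_0[OF linear_transition])
  show "x + y \<in> tangent_space A p" if "x \<in> tangent_space A p" "y \<in> tangent_space A p" for x y
  proof (rule tangent_spaceI)
    fix c c' assume "c \<in> A" "c' \<in> A" "p \<in> fst c" "p \<in> fst c'"
    then show "(x + y) c' = frechet_derivative (snd c' \<circ> cinv c) (at (snd c p)) ((x + y) c)"
      using that[THEN tangent_spaceD, of c c'] by (simp add: linear_add[OF linear_transition])
  next
    fix c assume "\<not> (c \<in> A \<and> p \<in> fst c)"
    from that[THEN tangent_space_zero, OF this] show "(x + y) c = 0" by simp
  qed
  show "r *\<^sub>R x \<in> tangent_space A p" if "x \<in> tangent_space A p" for x r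
  proof (rule tangent_spaceI)
    fix c c' assume "c \<in> A" "c' \<in> A" "p \<in> fst c" "p \<in> fst c'"
    then show "(r *\<^sub>R x) c' = frechet_derivative (snd c' \<circ> cinv c) (at (snd c p)) ((r *\<^sub>R x) c)"
      using that[THEN tangent_spaceD, of c c'] by (simp add: linear_cmul[OF linear_transition])
  next
    fix c assume "\<not> (c \<in> A \<and> p \<in> fst c)"
    from tangent_space_zero[OF that this] show "(r *\<^sub>R x) c = 0" by simp
  qed
qed

lemmas tangent_space_closed =
  subspace_0[OF subspace_tangent_space] subspace_add[OF subspace_tangent_space]
  subspace_scale[OF subspace_tangent_space] subspace_diff[OF subspace_tangent_space]
  subspace_neg[OF subspace_tangent_space] subspace_sum[OF subspace_tangent_space]

lemma tangent_vec_expand: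
  assumes "c \<in> A" "p \<in> fst c" "v \<in> tangent_space A p"
  shows "v = (\<Sum>b\<in>Basis. (v c \<bullet> b) *\<^sub>R coord_vec A c b p)"
proof (rule tangent_vec_eqI[OF assms])
  show "(\<Sum>b\<in>Basis. (v c \<bullet> b) *\<^sub>R coord_vec A c b p) \<in> tangent_space A p"
    using assms by (intro tangent_space_closed coord_vec_tangent)
  show "v c = (\<Sum>b\<in>Basis. (v c \<bullet> b) *\<^sub>R coord_vec A c b p) c"
    using assms by (simp add: sum_fun_apply coord_vec_chart euclidean_representation)
qed

lemma smooth_chart_change:
  assumes "c \<in> A" "c' \<in> A" "open U" "smooth_on (snd c ` (fst c \<inter> U)) (h \<circ> cinv c)"
  shows "smooth_on (snd c' ` (fst c' \<inter> (fst c \<inter> U))) (h \<circ> cinv c')"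
proof (rule smooth_on_cong)
  show op: "open (snd c' ` (fst c' \<inter> (fst c \<inter> U)))"
    using assms by (intro open_chart_image open_Int chart_homeomorphism)
  show "smooth_on (snd c' ` (fst c' \<inter> (fst c \<inter> U))) (\<lambda>x. (h \<circ> cinv c) ((snd c \<circ> cinv c') x))"
    using assms
    by (intro smooth_on_compose[OF op _ _ assms(4)]
        smooth_on_subset[OF transition_smooth[OF assms(2,1)]] open_chart_image)
      (auto simp: cinv_chart)
qed (use assms in \<open>auto simp: cinv_chart\<close>)

lemma coord_vec_field:
  assumes "c \<in> A"
  shows "vector_field_on A (fst c) (coord_vec A c u)"
  unfolding vector_field_on_def
proof (intro conjI ballI)
  fix c' assume c': "c' \<in> A"
  have op: "open (snd c' ` (fst c' \<inter> fst c))"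
    using assms c' by (intro open_chart_image chart_homeomorphism)
  have "smooth_on (snd c' ` (fst c' \<inter> fst c))
      (\<lambda>x. frechet_derivative (snd c' \<circ> cinv c) (at ((snd c \<circ> cinv c') x)) u)"
    using assms c'
    by (intro smooth_on_frechet_derivative_apply[OF op _ _ transition_smooth[OF assms c']]
        transition_smooth smooth_on_const open_chart_image chart_homeomorphism)
      (auto simp: cinv_chart)
  then show "smooth_on (snd c' ` (fst c' \<inter> fst c)) (\<lambda>x. coord_vec A c u (cinv c' x) c')"
    using assms c'
    by (elim smooth_on_cong[OF op, rotated]) (auto simp: coord_vec_def cinv_chart)
qed (rule coord_vec_tangent[OF assms])

lemma vector_field_subset:
  assumes "vector_field_on A U X" "V \<subseteq> U"
  shows "vector_field_on A V X"
  unfolding vector_field_on_def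
proof (intro conjI ballI)
  fix c assume "c \<in> A"
  then have "smooth_on (snd c ` (fst c \<inter> U)) (\<lambda>x. X (cinv c x) c)"
    using assms(1) by (simp add: vector_field_on_def)
  then show "smooth_on (snd c ` (fst c \<inter> V)) (\<lambda>x. X (cinv c x) c)"
    by (rule smooth_on_subset) (use assms(2) in blast)
qed (use assms in \<open>auto simp: vector_field_on_def\<close>)

lemma smooth_fun_chart:
  assumes "c \<in> A" "open U" "smooth_on (snd c ` (fst c \<inter> U)) (h \<circ> cinv c)"
  shows "smooth_fun A (fst c \<inter> U) h"
  unfolding smooth_fun_def using smooth_chart_change[OF assms(1) _ assms(2,3)] by blast

lemma vector_field_component:
  assumes "c \<in> A" "open U" "vector_field_on A U X"
  shows "smooth_fun A (fst c \<inter> U) (\<lambda>q. X q c \<bullet> b)"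
  using assms
  by (intro smooth_fun_chart) (auto simp: o_def vector_field_on_def
      intro!: smooth_on_inner_left open_chart_image)

lemma vector_field_scaleR:
  assumes "open U" "smooth_fun A U h" "vector_field_on A U X"
  shows "vector_field_on A U (\<lambda>q. h q *\<^sub>R X q)"
  using assms unfolding vector_field_on_def smooth_fun_def
  by (auto simp: o_def intro!: tangent_space_closed smooth_on_scaleR open_chart_image)

lemma vector_field_add:
  assumes "open U" "vector_field_on A U X" "vector_field_on A U Y"
  shows "vector_field_on A U (\<lambda>q. X q + Y q)"
  using assms unfolding vector_field_on_def
  by (auto intro!: tangent_space_closed smooth_on_add open_chart_image)

lemma vector_field_diff:
  assumes "open U" "vector_field_on A U X" "vector_field_on A U Y"
  shows "vector_field_on A U (\<lambda>q. X q - Y q)"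
  using assms unfolding vector_field_on_def
  by (auto intro!: tangent_space_closed smooth_on_diff open_chart_image)

lemma vector_field_zero: "vector_field_on A U (\<lambda>q. 0)"
  unfolding vector_field_on_def by (auto simp: tangent_space_closed smooth_on_const)

lemma vector_field_sum:
  assumes "open U" "finite I" "\<And>i. i \<in> I \<Longrightarrow> vector_field_on A U (X i)"
  shows "vector_field_on A U (\<lambda>q. \<Sum>i\<in>I. X i q)"
  using assms(2,3)
  by (induction I rule: finite_induct) (simp_all add: vector_field_zero vector_field_add assms(1))

end

text \<open>By \<open>differentiable_chart_change\<close> the choice of the chart does not matter. The rules for \<open>pder\<close> are
  the usual differentiation rules under this assumption at a single point.\<close>

definition pdiff :: "('m, 'e::euclidean_space) chart set \<Rightarrow> 'm \<Rightarrow> ('m \<Rightarrow> 'v::real_normed_vector) \<Rightarrow> bool"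
  where "pdiff A p \<phi> \<longleftrightarrow> (\<phi> \<circ> cinv (chart_at A p)) differentiable (at (snd (chart_at A p) p))"

context manifold
begin

lemma pdiff_has_derivative:
  "pdiff A p \<phi> \<Longrightarrow> ((\<lambda>x. \<phi> (cinv (chart_at A p) x)) has_derivative
     frechet_derivative (\<phi> \<circ> cinv (chart_at A p)) (at (snd (chart_at A p) p)))
     (at (snd (chart_at A p) p))"
  unfolding pdiff_def frechet_derivative_works by (simp add: o_def)

lemma pderI:
  assumes "((\<lambda>x. \<phi> (cinv (chart_at A p) x)) has_derivative D) (at (snd (chart_at A p) p))"
  shows "pdiff A p \<phi>" and "pder A p v \<phi> = D (v (chart_at A p))"
  using assms frechet_derivative_eqI[OF assms]
  by (auto simp: pdiff_def pder_def Let_def o_def differentiable_def)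

lemma pdiff_chart:
  assumes "c \<in> A" "p \<in> fst c" "(\<phi> \<circ> cinv c) differentiable (at (snd c p))"
  shows "pdiff A p \<phi>"
  unfolding pdiff_def
  by (rule differentiable_chart_change(1)[OF chart_at(1) assms(1) chart_at(2) assms(2,3)])

lemma pdiff_in_chart:
  assumes "c \<in> A" "p \<in> fst c" "pdiff A p \<phi>"
  shows "(\<phi> \<circ> cinv c) differentiable (at (snd c p))"
  by (rule differentiable_chart_change(1)[OF assms(1) chart_at(1) assms(2) chart_at(2)
        assms(3)[unfolded pdiff_def]])

lemma smooth_fun_pdiff:
  assumes "smooth_fun A U h" "p \<in> U"
  shows "pdiff A p h"
proof (rule pdiff_chart[OF chart_at])
  have "smooth_on (snd (chart_at A p) ` (fst (chart_at A p) \<inter> U)) (h \<circ> cinv (chart_at A p))"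
    using assms chart_at unfolding smooth_fun_def by blast
  then show "(h \<circ> cinv (chart_at A p)) differentiable (at (snd (chart_at A p) p))"
    by (rule smooth_on_differentiable) (use assms chart_at in blast)
qed

lemma pder_const: "pdiff A p (\<lambda>q. k)" "pder A p v (\<lambda>q. k) = 0"
  by (auto simp: pdiff_def pder_def o_def)

lemma pder_cong:
  assumes "open U" "p \<in> U" "\<forall>q\<in>U. \<phi> q = \<psi> q"
  shows "pdiff A p \<phi> \<longleftrightarrow> pdiff A p \<psi>" and "pdiff A p \<phi> \<Longrightarrow> pder A p v \<phi> = pder A p v \<psi>"
proof -
  let ?c = "chart_at A p" and ?S = "snd (chart_at A p) ` (fst (chart_at A p) \<inter> U)"
  have S: "open ?S" "snd ?c p \<in> ?S"
    using open_chart_image[OF chart_at(1) assms(1)] chart_at(2)[of p] assms(2) by auto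
  have eq: "\<phi> (cinv ?c x) = \<psi> (cinv ?c x)" if "x \<in> ?S" for x
    using that assms(3) chart_at by (auto simp: cinv_chart)
  have trans: "((\<lambda>x. \<phi> (cinv ?c x)) has_derivative D) (at (snd ?c p)) \<longleftrightarrow>
    ((\<lambda>x. \<psi> (cinv ?c x)) has_derivative D) (at (snd ?c p))" for D
    using has_derivative_transform_within_open[OF _ S, of "\<lambda>x. \<phi> (cinv ?c x)" D UNIV "\<lambda>x. \<psi> (cinv ?c x)"]
      has_derivative_transform_within_open[OF _ S, of "\<lambda>x. \<psi> (cinv ?c x)" D UNIV "\<lambda>x. \<phi> (cinv ?c x)"] eq
    by auto
  then show "pdiff A p \<phi> \<longleftrightarrow> pdiff A p \<psi>"
    by (simp add: pdiff_def differentiable_def o_def)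
  show "pder A p v \<phi> = pder A p v \<psi>" if "pdiff A p \<phi>"
    using pderI(2)[OF pdiff_has_derivative[OF that]]
      pderI(2)[OF pdiff_has_derivative[OF that, unfolded trans]] by simp
qed

lemma pder_linear_compose:
  assumes "bounded_linear L" "pdiff A p \<phi>"
  shows "pdiff A p (\<lambda>q. L (\<phi> q))" and "pder A p v (\<lambda>q. L (\<phi> q)) = L (pder A p v \<phi>)"
  using pderI[OF bounded_linear.has_derivative[OF assms(1) pdiff_has_derivative[OF assms(2)]]]
    pderI(2)[OF pdiff_has_derivative[OF assms(2)]] by auto

lemma pder_plus:
  assumes "pdiff A p \<phi>" "pdiff A p \<psi>"
  shows "pdiff A p (\<lambda>q. \<phi> q + \<psi> q)" and "pder A p v (\<lambda>q. \<phi> q + \<psi> q) = pder A p v \<phi> + pder A p v \<psi>"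
  using pderI[OF has_derivative_add[OF assms[THEN pdiff_has_derivative]]]
    assms[THEN pdiff_has_derivative, THEN pderI(2)] by auto

lemma pder_bilinear:
  assumes "bounded_bilinear h" "pdiff A p \<phi>" "pdiff A p \<psi>"
  shows "pdiff A p (\<lambda>q. h (\<phi> q) (\<psi> q))"
    and "pder A p v (\<lambda>q. h (\<phi> q) (\<psi> q)) = h (\<phi> p) (pder A p v \<psi>) + h (pder A p v \<phi>) (\<psi> p)"
  using pderI[OF bounded_bilinear.FDERIV[OF assms(1) assms(2,3)[THEN pdiff_has_derivative]]]
    assms(2,3)[THEN pdiff_has_derivative, THEN pderI(2)] cinv_chart[OF chart_at] by auto

lemma pder_compose:
  assumes "pdiff A p \<psi>" "g differentiable (at (\<psi> p))"
  shows "pdiff A p (\<lambda>q. g (\<psi> q))"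
    and "pder A p v (\<lambda>q. g (\<psi> q)) = frechet_derivative g (at (\<psi> p)) (pder A p v \<psi>)"
proof -
  have "(g has_derivative frechet_derivative g (at (\<psi> p)))
      (at (\<psi> (cinv (chart_at A p) (snd (chart_at A p) p))))"
    using assms(2) by (simp add: cinv_chart chart_at frechet_derivative_works)
  from pderI[OF has_derivative_compose[OF pdiff_has_derivative[OF assms(1)] this]]
    pderI(2)[OF pdiff_has_derivative[OF assms(1)]]
  show "pdiff A p (\<lambda>q. g (\<psi> q))"
    "pder A p v (\<lambda>q. g (\<psi> q)) = frechet_derivative g (at (\<psi> p)) (pder A p v \<psi>)" by auto
qed

lemma linear_pder:
  assumes "pdiff A p \<phi>"
  shows "pder A p (v + w) \<phi> = pder A p v \<phi> + pder A p w \<phi>"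
    and "pder A p (a *\<^sub>R v) \<phi> = a *\<^sub>R pder A p v \<phi>"
  using linear_add[OF linear_frechet_derivative[OF assms[unfolded pdiff_def]]]
    linear_cmul[OF linear_frechet_derivative[OF assms[unfolded pdiff_def]]]
  by (auto simp: pder_def Let_def)

end


section \<open>The ambient manifold\<close>

locale locally_metallic_space =
  fixes B :: "('n::{t2_space,second_countable_topology}, 'f::euclidean_space) chart set"
    and gbar :: "('n, 'f) metric" and J :: "('n, 'f) endo_field" and nabla :: "('n, 'f) connection"
  assumes locally_metallic: "locally_metallic B gbar J nabla"

sublocale locally_metallic_space \<subseteq> manifold B
  using locally_metallic
  by unfold_locales (simp add: locally_metallic_def metallic_riemannian_manifold_def
      riemannian_manifold_def)

context locally_metallic_space
begin

lemma riemannian: "riemannian_manifold B gbar"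
  and tensor_J: "tensor_field_11 B J"
  and metallic: "\<And>x u v. u \<in> tangent_space B x \<Longrightarrow> v \<in> tangent_space B x \<Longrightarrow>
      gbar x (J x u) v = gbar x u (J x v)"
  and affine: "affine_connection B nabla"
  and torsion: "torsion_free B nabla"
  and metric: "metric_connection B gbar nabla"
  and parallel_J: "\<And>U Y p v. open U \<Longrightarrow> vector_field_on B U Y \<Longrightarrow> p \<in> U \<Longrightarrow>
      v \<in> tangent_space B p \<Longrightarrow> nabla p v (\<lambda>q. J q (Y q)) = J p (nabla p v Y)"
  using locally_metallic
  unfolding locally_metallic_def metallic_riemannian_manifold_def levi_civita_def by simp_all

lemma gbar_sym: "u \<in> tangent_space B x \<Longrightarrow> v \<in> tangent_space B x \<Longrightarrow> gbar x u v = gbar x v u"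
  and gbar_add_left: "u \<in> tangent_space B x \<Longrightarrow> v \<in> tangent_space B x \<Longrightarrow> w \<in> tangent_space B x \<Longrightarrow>
      gbar x (u + v) w = gbar x u w + gbar x v w"
  and gbar_scale_left: "u \<in> tangent_space B x \<Longrightarrow> v \<in> tangent_space B x \<Longrightarrow>
      gbar x (a *\<^sub>R u) v = a * gbar x u v"
  and gbar_pos: "u \<in> tangent_space B x \<Longrightarrow> u \<noteq> 0 \<Longrightarrow> gbar x u u > 0"
  and smooth_gbar: "open U \<Longrightarrow> vector_field_on B U X \<Longrightarrow> vector_field_on B U Y \<Longrightarrow>
      smooth_fun B U (\<lambda>p. gbar p (X p) (Y p))"
  using riemannian unfolding riemannian_manifold_def by blast+

lemma gbar_add_right: "u \<in> tangent_space B x \<Longrightarrow> v \<in> tangent_space B x \<Longrightarrow> w \<in> tangent_space B x \<Longrightarrow>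
      gbar x w (u + v) = gbar x w u + gbar x w v"
  using gbar_sym gbar_add_left tangent_space_closed(2) by metis

lemma gbar_scale_right: "u \<in> tangent_space B x \<Longrightarrow> v \<in> tangent_space B x \<Longrightarrow>
      gbar x u (a *\<^sub>R v) = a * gbar x u v"
  using gbar_sym gbar_scale_left tangent_space_closed(3) by metis

lemma gbar_zero: "v \<in> tangent_space B x \<Longrightarrow> gbar x 0 v = 0" "v \<in> tangent_space B x \<Longrightarrow> gbar x v 0 = 0"
  using gbar_scale_left[of v x v 0] gbar_scale_right[of v x v 0] by auto

lemma gbar_diff_left: "u \<in> tangent_space B x \<Longrightarrow> v \<in> tangent_space B x \<Longrightarrow> w \<in> tangent_space B x \<Longrightarrow>
      gbar x (u - v) w = gbar x u w - gbar x v w"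
  using gbar_add_left[of "u - v" x v w] tangent_space_closed(4) by simp

lemma gbar_minus_left: "u \<in> tangent_space B x \<Longrightarrow> v \<in> tangent_space B x \<Longrightarrow>
      gbar x (- u) v = - gbar x u v"
  using gbar_scale_left[of u x v "-1"] by simp

lemma gbar_sum_left:
  assumes "finite I" "\<And>i. i \<in> I \<Longrightarrow> u i \<in> tangent_space B x" "w \<in> tangent_space B x"
  shows "gbar x (\<Sum>i\<in>I. u i) w = (\<Sum>i\<in>I. gbar x (u i) w)"
  using assms(1,2)
  by (induction I rule: finite_induct) (simp_all add: gbar_zero gbar_add_left tangent_space_closed assms(3))

lemma gbar_sum_right:
  assumes "finite I" "\<And>i. i \<in> I \<Longrightarrow> u i \<in> tangent_space B x" "w \<in> tangent_space B x"
  shows "gbar x w (\<Sum>i\<in>I. u i) = (\<Sum>i\<in>I. gbar x w (u i))"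
  using assms(1,2)
  by (induction I rule: finite_induct) (simp_all add: gbar_zero gbar_add_right tangent_space_closed assms(3))

lemma J_tangent: "u \<in> tangent_space B x \<Longrightarrow> J x u \<in> tangent_space B x"
  and J_add: "u \<in> tangent_space B x \<Longrightarrow> v \<in> tangent_space B x \<Longrightarrow> J x (u + v) = J x u + J x v"
  and J_scale: "u \<in> tangent_space B x \<Longrightarrow> J x (a *\<^sub>R u) = a *\<^sub>R J x u"
  and J_field: "open U \<Longrightarrow> vector_field_on B U X \<Longrightarrow> vector_field_on B U (\<lambda>p. J p (X p))"
  using tensor_J unfolding tensor_field_11_def by blast+

lemma J_sum:
  assumes "finite I" "\<And>i. i \<in> I \<Longrightarrow> u i \<in> tangent_space B x"
  shows "J x (\<Sum>i\<in>I. u i) = (\<Sum>i\<in>I. J x (u i))"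
  using assms J_scale[of 0 x 0]
  by (induction I rule: finite_induct) (simp_all add: J_add tangent_space_closed)

context
  fixes U Y
  assumes U: "open U" and Y: "vector_field_on B U Y"
begin

lemmas affine_at = affine[unfolded affine_connection_def dir_deriv_eq_pder,
    THEN spec, of U, THEN spec, of Y, THEN mp, OF U, THEN mp, OF Y]
lemmas affine_at_point = affine_at[THEN conjunct1, THEN bspec, THEN bspec]

lemma nabla_field: "vector_field_on B U X \<Longrightarrow> vector_field_on B U (\<lambda>p. nabla p (X p) Y)"
  by (rule affine_at[THEN conjunct2, THEN spec, THEN mp])

lemma nabla_tangent: "p \<in> U \<Longrightarrow> v \<in> tangent_space B p \<Longrightarrow> nabla p v Y \<in> tangent_space B p"
  by (rule affine_at_point[THEN conjunct1])

lemma nabla_add_dir: "p \<in> U \<Longrightarrow> v \<in> tangent_space B p \<Longrightarrow>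
    w \<in> tangent_space B p \<Longrightarrow> nabla p (v + w) Y = nabla p v Y + nabla p w Y"
  by (rule affine_at_point[THEN conjunct2, THEN conjunct1, THEN bspec])

lemma nabla_scale_dir: "p \<in> U \<Longrightarrow> v \<in> tangent_space B p \<Longrightarrow>
    nabla p (a *\<^sub>R v) Y = a *\<^sub>R nabla p v Y"
  by (rule affine_at_point[THEN conjunct2, THEN conjunct2, THEN conjunct1, THEN spec])

lemma nabla_add: "vector_field_on B U Z \<Longrightarrow> p \<in> U \<Longrightarrow> v \<in> tangent_space B p \<Longrightarrow>
    nabla p v (\<lambda>q. Y q + Z q) = nabla p v Y + nabla p v Z"
  by (rule affine_at_point[THEN conjunct2, THEN conjunct2, THEN conjunct2, THEN conjunct1,
        THEN spec, THEN mp])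

lemma nabla_scale: "smooth_fun B U h \<Longrightarrow> p \<in> U \<Longrightarrow> v \<in> tangent_space B p \<Longrightarrow>
    nabla p v (\<lambda>q. h q *\<^sub>R Y q) = pder B p v h *\<^sub>R Y p + h p *\<^sub>R nabla p v Y"
  by (rule affine_at_point[THEN conjunct2, THEN conjunct2, THEN conjunct2, THEN conjunct2,
        THEN conjunct1, THEN spec, THEN mp])

lemma nabla_cong: "p \<in> U \<Longrightarrow> v \<in> tangent_space B p \<Longrightarrow> (\<And>q. q \<in> U \<Longrightarrow> Z q = Y q) \<Longrightarrow>
    nabla p v Z = nabla p v Y"
  by (rule affine_at_point[THEN conjunct2, THEN conjunct2, THEN conjunct2, THEN conjunct2,
        THEN conjunct2, THEN spec, THEN mp]) auto

end

lemma nabla_zero: "v \<in> tangent_space B p \<Longrightarrow> nabla p v (\<lambda>q. 0) = 0"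
  using nabla_add[OF open_UNIV vector_field_zero vector_field_zero, of p v] by simp

lemma nabla_sum:
  assumes "open U" "p \<in> U" "v \<in> tangent_space B p"
    and "finite I" "\<And>i. i \<in> I \<Longrightarrow> vector_field_on B U (Y i)"
  shows "nabla p v (\<lambda>q. \<Sum>i\<in>I. Y i q) = (\<Sum>i\<in>I. nabla p v (Y i))"
  using assms(4,5)
  by (induction I rule: finite_induct)
    (simp_all add: nabla_zero assms(1-3) nabla_add[OF assms(1)] vector_field_sum)

lemma pder_metric: "open U \<Longrightarrow> vector_field_on B U Y \<Longrightarrow> vector_field_on B U Z \<Longrightarrow> p \<in> U \<Longrightarrow>
    v \<in> tangent_space B p \<Longrightarrow>
    pder B p v (\<lambda>q. gbar q (Y q) (Z q)) = gbar p (nabla p v Y) (Z p) + gbar p (Y p) (nabla p v Z)"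
  using metric unfolding metric_connection_def dir_deriv_eq_pder by blast

abbreviation "christoffel \<equiv> connection_coeff B nabla"

lemma christoffel_eq_nabla:
  assumes "d \<in> B" "q \<in> fst d" "v \<in> tangent_space B q"
  shows "christoffel d q (v d) w = nabla q v (coord_vec B d w) d"
  unfolding connection_coeff_def using tangent_eq_coord_vec[OF assms] by simp

lemma christoffel_add_left:
  assumes "d \<in> B" "q \<in> fst d"
  shows "christoffel d q (u + v) w = christoffel d q u w + christoffel d q v w"
  using assms unfolding connection_coeff_def coord_vec_add[OF assms]
  by (subst nabla_add_dir[OF chart_homeomorphism(1) coord_vec_field]) (auto intro: coord_vec_tangent)

lemma christoffel_scale_left:
  assumes "d \<in> B" "q \<in> fst d"
  shows "christoffel d q (a *\<^sub>R u) w = a *\<^sub>R christoffel d q u w"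
  using assms unfolding connection_coeff_def coord_vec_scaleR[OF assms]
  by (subst nabla_scale_dir[OF chart_homeomorphism(1) coord_vec_field]) (auto intro: coord_vec_tangent)

text \<open>Coordinate fields commute, so this is the absence of torsion.\<close>

lemma christoffel_symmetric:
  assumes d: "d \<in> B" "q \<in> fst d"
  shows "christoffel d q u w = christoffel d q w u"
proof -
  have 0: "frechet_derivative (\<lambda>x. coord_vec B d w (cinv d x) d) (at (snd d q)) = (\<lambda>v. 0)" for w
  proof (rule frechet_derivative_eqI, rule has_derivative_transform_within_open)
    show "((\<lambda>x. w) has_derivative (\<lambda>v. 0)) (at (snd d q))" by simp
    show "open (snd d ` fst d)" using d by (intro chart_homeomorphism)
  qed (use d in \<open>auto simp: cinv_chart coord_vec_chart\<close>)
  have "nabla q (coord_vec B d u q) (coord_vec B d w) - nabla q (coord_vec B d w q) (coord_vec B d u)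
    = lie_bracket B (coord_vec B d u) (coord_vec B d w) q"
    using torsion[unfolded torsion_free_def] chart_homeomorphism(1)[OF d(1)]
      coord_vec_field[OF d(1)] d(2) by blast
  from fun_cong[OF this, of d] show ?thesis
    using d by (simp add: connection_coeff_def lie_bracket_def 0)
qed

lemma christoffel_add_right:
  assumes "d \<in> B" "q \<in> fst d"
  shows "christoffel d q w (u + v) = christoffel d q w u + christoffel d q w v"
  using assms by (simp add: christoffel_symmetric[of d q w] christoffel_add_left)

lemma christoffel_scale_right:
  assumes "d \<in> B" "q \<in> fst d"
  shows "christoffel d q w (a *\<^sub>R u) = a *\<^sub>R christoffel d q w u"
  using assms by (simp add: christoffel_symmetric[of d q w] christoffel_scale_left)

lemma linear_christoffel: "d \<in> B \<Longrightarrow> q \<in> fst d \<Longrightarrow> linear (christoffel d q w)"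
  by (intro linearI christoffel_add_right christoffel_scale_right)

lemma christoffel_expand:
  assumes "d \<in> B" "q \<in> fst d"
  shows "christoffel d q u w = (\<Sum>b\<in>Basis. (w \<bullet> b) *\<^sub>R christoffel d q u b)"
proof -
  have "christoffel d q u w = christoffel d q u (\<Sum>b\<in>Basis. (w \<bullet> b) *\<^sub>R b)"
    by (simp add: euclidean_representation)
  then show ?thesis
    by (simp only: linear_sum[OF linear_christoffel[OF assms]] linear_cmul[OF linear_christoffel[OF assms]])
qed

text \<open>Expanding \<open>Y\<close> in the coordinate fields of \<open>d\<close> and applying the Leibniz rule gives the coordinate
  expression of the connection. It has the shape of the definition of \<open>nabla_along\<close>, and so
  it links the two notions.\<close>

lemma nabla_chart:
  assumes d: "d \<in> B" "p \<in> fst d" and U: "open U" "p \<in> U" and Y: "vector_field_on B U Y"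
    and v: "v \<in> tangent_space B p"
  shows "pdiff B p (\<lambda>q. Y q d)"
    and "nabla p v Y d = pder B p v (\<lambda>q. Y q d) + christoffel d p (v d) (Y p d)"
proof -
  let ?U = "fst d \<inter> U"
  have op: "open ?U" "p \<in> ?U" using d U chart_homeomorphism(1)[OF d(1)] by auto
  have vf: "vector_field_on B ?U (coord_vec B d b)" for b
    by (rule vector_field_subset[OF coord_vec_field[OF d(1)]]) simp
  have sf: "smooth_fun B ?U (\<lambda>q. Y q d \<bullet> b)" for b
    by (rule vector_field_component[OF d(1) U(1) Y])
  have "smooth_on (snd d ` ?U) (\<lambda>x. Y (cinv d x) d)"
    using Y d by (simp add: vector_field_on_def)
  then have "((\<lambda>q. Y q d) \<circ> cinv d) differentiable (at (snd d p))"
    unfolding o_def by (rule smooth_on_differentiable) (use d U in blast)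
  then show dif: "pdiff B p (\<lambda>q. Y q d)" by (rule pdiff_chart[OF d])
  have "nabla p v Y = nabla p v (\<lambda>q. \<Sum>b\<in>Basis. (Y q d \<bullet> b) *\<^sub>R coord_vec B d b q)"
  proof (rule nabla_cong[OF op(1) _ op(2) v])
    show "vector_field_on B ?U (\<lambda>q. \<Sum>b\<in>Basis. (Y q d \<bullet> b) *\<^sub>R coord_vec B d b q)"
      by (intro vector_field_sum vector_field_scaleR vf sf op) simp
    show "Y q = (\<Sum>b\<in>Basis. (Y q d \<bullet> b) *\<^sub>R coord_vec B d b q)" if "q \<in> ?U" for q
      using that Y by (intro tangent_vec_expand[OF d(1)]) (auto simp: vector_field_on_def)
  qed
  also have "\<dots> = (\<Sum>b\<in>Basis. nabla p v (\<lambda>q. (Y q d \<bullet> b) *\<^sub>R coord_vec B d b q))"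
    by (intro nabla_sum[OF op v] vector_field_scaleR vf sf op) simp
  also have "\<dots> = (\<Sum>b\<in>Basis. (pder B p v (\<lambda>q. Y q d) \<bullet> b) *\<^sub>R coord_vec B d b p +
      (Y p d \<bullet> b) *\<^sub>R nabla p v (coord_vec B d b))"
    by (intro sum.cong refl, subst nabla_scale[OF op(1) vf sf op(2) v])
      (simp add: pder_linear_compose[OF bounded_linear_inner_left dif])
  finally show "nabla p v Y d = pder B p v (\<lambda>q. Y q d) + christoffel d p (v d) (Y p d)"
    using d by (simp add: sum_fun_apply sum.distrib coord_vec_chart euclidean_representation
        christoffel_expand[OF d, of _ "Y p d"] christoffel_eq_nabla[OF d v])
qed

end

section \<open>Vector fields along an immersion\<close>

locale immersed_submanifold =
  A: manifold A + N: locally_metallic_space B gbar J nabla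
  for A :: "('m::{t2_space,second_countable_topology}, 'e::euclidean_space) chart set"
    and B :: "('n::{t2_space,second_countable_topology}, 'f::euclidean_space) chart set"
    and gbar J nabla +
  fixes F :: "'m \<Rightarrow> 'n"
  assumes immersion: "immersion A B F"
begin

abbreviation "dF \<equiv> differential A B F"
abbreviation "cov \<equiv> nabla_along A B nabla F"

lemma continuous_F: "continuous_on UNIV F"
  and smooth_F: "c \<in> A \<Longrightarrow> d \<in> B \<Longrightarrow>
      smooth_on (snd c ` (fst c \<inter> F -` fst d)) (snd d \<circ> F \<circ> cinv c)"
  and inj_dF: "inj_on (dF p) (tangent_space A p)"
  using immersion unfolding immersion_def smooth_map_def by auto

lemma open_preimage: "open U \<Longrightarrow> open (F -` U)"
  using continuous_F by (simp add: continuous_on_open_vimage[OF open_UNIV])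

lemma pdiff_F:
  assumes "d \<in> B" "F p \<in> fst d"
  shows "pdiff A p (\<lambda>q. snd d (F q))"
proof -
  have "(snd d \<circ> F \<circ> cinv (chart_at A p)) differentiable (at (snd (chart_at A p) p))"
    using assms A.chart_at
    by (intro smooth_on_differentiable[OF smooth_F]) auto
  then show ?thesis by (simp add: pdiff_def o_def)
qed

lemma dF_chart:
  assumes "d \<in> B" "F p \<in> fst d"
  shows "dF p v d = pder A p v (\<lambda>q. snd d (F q))"
  using assms by (simp add: differential_def pder_def o_def)

lemma pder_comp_chart:
  assumes d: "d \<in> B" "F p \<in> fst d" and "(\<psi> \<circ> cinv d) differentiable (at (snd d (F p)))"
  shows "pdiff A p (\<lambda>q. \<psi> (F q))"
    and "pder A p v (\<lambda>q. \<psi> (F q)) = frechet_derivative (\<psi> \<circ> cinv d) (at (snd d (F p))) (dF p v d)"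
proof -
  note * = A.pder_compose[OF pdiff_F[OF d] assms(3)]
  have U: "open (F -` fst d)" "p \<in> F -` fst d"
    using d by (auto intro: open_preimage N.chart_homeomorphism)
  have eq: "\<forall>q\<in>F -` fst d. (\<psi> \<circ> cinv d) (snd d (F q)) = \<psi> (F q)"
    using d by (simp add: N.cinv_chart)
  show "pdiff A p (\<lambda>q. \<psi> (F q))"
    using A.pder_cong(1)[OF U eq] *(1) by blast
  show "pder A p v (\<lambda>q. \<psi> (F q)) = frechet_derivative (\<psi> \<circ> cinv d) (at (snd d (F p))) (dF p v d)"
    using A.pder_cong(2)[OF U eq *(1), of v] *(2)[of v] dF_chart[OF d, of v] by (simp add: o_def)
qed

lemma pder_comp_F:
  assumes "pdiff B (F p) \<psi>"
  shows "pdiff A p (\<lambda>q. \<psi> (F q))" and "pder A p v (\<lambda>q. \<psi> (F q)) = pder B (F p) (dF p v) \<psi>"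
  using pder_comp_chart[OF N.chart_at assms[unfolded pdiff_def]] by (auto simp: pder_def Let_def)

lemma dF_tangent: "dF p v \<in> tangent_space B (F p)"
proof (rule N.tangent_spaceI)
  fix d d' assume d: "d \<in> B" "d' \<in> B" "F p \<in> fst d" "F p \<in> fst d'"
  show "dF p v d' = frechet_derivative (snd d' \<circ> cinv d) (at (snd d (F p))) (dF p v d)"
    using pder_comp_chart(2)[OF d(1,3) N.transition_differentiable[OF d]] dF_chart[OF d(2,4)]
    by metis
qed (auto simp: differential_def)

lemma dF_add: "dF p (v + w) = dF p v + dF p w"
proof
  fix d show "dF p (v + w) d = (dF p v + dF p w) d"
  proof (cases "d \<in> B \<and> F p \<in> fst d")
    case True
    then show ?thesis by (simp add: dF_chart A.linear_pder pdiff_F)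
  qed (simp only: differential_def plus_fun_def if_False, simp)
qed

lemma dF_scaleR: "dF p (a *\<^sub>R v) = a *\<^sub>R dF p v"
proof
  fix d show "dF p (a *\<^sub>R v) d = (a *\<^sub>R dF p v) d"
  proof (cases "d \<in> B \<and> F p \<in> fst d")
    case True
    then show ?thesis by (simp add: dF_chart A.linear_pder pdiff_F)
  qed (simp only: differential_def scaleR_fun_apply if_False, simp)
qed

lemma linear_dF: "linear (dF p)"
  by (intro linearI dF_add dF_scaleR)

text \<open>The rules for the induced connection hold at a single point. They apply to fields that are
  tangent to the ambient manifold near \<open>p\<close> and differentiable at \<open>p\<close>; this includes the coordinate
  fields of a chart of the submanifold, which do not exist globally.\<close>

definition diff_along :: "'m \<Rightarrow> ('m \<Rightarrow> ('n, 'f) tvec) \<Rightarrow> bool" where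
  "diff_along p V \<longleftrightarrow> (\<exists>U. open U \<and> p \<in> U \<and> (\<forall>q\<in>U. V q \<in> tangent_space B (F q))) \<and>
     (\<forall>d\<in>B. F p \<in> fst d \<longrightarrow> pdiff A p (\<lambda>q. V q d))"

lemma diff_along_pdiff: "diff_along p V \<Longrightarrow> d \<in> B \<Longrightarrow> F p \<in> fst d \<Longrightarrow> pdiff A p (\<lambda>q. V q d)"
  by (simp add: diff_along_def)

lemma diff_along_tangent: "diff_along p V \<Longrightarrow> V p \<in> tangent_space B (F p)"
  by (auto simp: diff_along_def)

lemma diff_along_cong:
  assumes U: "open U" "p \<in> U" "\<forall>q\<in>U. V q = W q" and V: "diff_along p V"
  shows "diff_along p W"
proof -
  obtain O' where O': "open O'" "p \<in> O'" "\<forall>q\<in>O'. V q \<in> tangent_space B (F q)"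
    using V by (auto simp: diff_along_def)
  have "open (U \<inter> O') \<and> p \<in> U \<inter> O' \<and> (\<forall>q\<in>U \<inter> O'. W q \<in> tangent_space B (F q))"
    using O' U by (metis IntD1 IntD2 IntI open_Int)
  moreover have "pdiff A p (\<lambda>q. W q d)" if "d \<in> B" "F p \<in> fst d" for d
    using A.pder_cong(1)[OF U(1,2), of "\<lambda>q. V q d" "\<lambda>q. W q d"] U(3) diff_along_pdiff[OF V that] by simp
  ultimately show ?thesis unfolding diff_along_def by blast
qed

lemma diff_along_field:
  assumes "open U" "F p \<in> U" "vector_field_on B U Y"
  shows "diff_along p (\<lambda>q. Y (F q))"
  unfolding diff_along_def
proof (intro conjI exI ballI impI)
  show "open (F -` U)" by (rule open_preimage[OF assms(1)])
  show "p \<in> F -` U" using assms(2) by simp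
  show "Y (F q) \<in> tangent_space B (F q)" if "q \<in> F -` U" for q
    using that assms(3) by (auto simp: vector_field_on_def)
  show "pdiff A p (\<lambda>q. Y (F q) d)" if "d \<in> B" "F p \<in> fst d" for d
    by (rule pder_comp_F(1))
      (rule N.nabla_chart(1)[OF that assms N.tangent_space_closed(1)])
qed

lemma diff_along_add:
  assumes "diff_along p V" "diff_along p W"
  shows "diff_along p (\<lambda>q. V q + W q)"
proof -
  obtain U where "open U" "p \<in> U" "\<forall>q\<in>U. V q \<in> tangent_space B (F q)"
    using assms(1) by (auto simp: diff_along_def)
  moreover obtain U' where "open U'" "p \<in> U'" "\<forall>q\<in>U'. W q \<in> tangent_space B (F q)"
    using assms(2) by (auto simp: diff_along_def)
  ultimately have "open (U \<inter> U') \<and> p \<in> U \<inter> U' \<and>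
      (\<forall>q\<in>U \<inter> U'. V q + W q \<in> tangent_space B (F q))"
    by (auto intro: N.tangent_space_closed)
  then show ?thesis
    using assms[THEN diff_along_pdiff]
    unfolding diff_along_def by (auto intro!: A.pder_plus(1))
qed

lemma diff_along_scaleR:
  assumes "pdiff A p h" "diff_along p V"
  shows "diff_along p (\<lambda>q. h q *\<^sub>R V q)"
proof -
  obtain U where "open U" "p \<in> U" "\<forall>q\<in>U. V q \<in> tangent_space B (F q)"
    using assms(2) by (auto simp: diff_along_def)
  then have "open U \<and> p \<in> U \<and> (\<forall>q\<in>U. h q *\<^sub>R V q \<in> tangent_space B (F q))"
    by (auto intro: N.tangent_space_closed)
  then show ?thesis
    using assms(2)[THEN diff_along_pdiff]
    unfolding diff_along_def by (auto intro!: A.pder_bilinear(1)[OF bounded_bilinear_scaleR assms(1)])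
qed

lemma diff_along_zero: "diff_along p (\<lambda>q. 0)"
  unfolding diff_along_def by (auto simp: N.tangent_space_closed A.pder_const)

lemma diff_along_sum:
  assumes "finite I" "\<And>i. i \<in> I \<Longrightarrow> diff_along p (V i)"
  shows "diff_along p (\<lambda>q. \<Sum>i\<in>I. V i q)"
  using assms by (induction I rule: finite_induct) (simp_all add: diff_along_zero diff_along_add)

lemma cov_chart:
  "d \<in> B \<Longrightarrow> F p \<in> fst d \<Longrightarrow>
    cov p v V d = pder A p v (\<lambda>q. V q d) + N.christoffel d (F p) (dF p v d) (V p d)"
  by (simp add: nabla_along_def pder_def o_def)

lemma cov_outside: "d \<in> B \<longrightarrow> F p \<notin> fst d \<Longrightarrow> cov p v V d = 0"
  by (auto simp: nabla_along_def)

lemma cov_cong: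
  assumes U: "open U" "p \<in> U" "\<forall>q\<in>U. V q = W q" and V: "diff_along p V"
  shows "cov p v V = cov p v W"
proof
  fix d show "cov p v V d = cov p v W d"
  proof (cases "d \<in> B \<and> F p \<in> fst d")
    case True
    then have d: "d \<in> B" "F p \<in> fst d" by auto
    have "pder A p v (\<lambda>q. V q d) = pder A p v (\<lambda>q. W q d)"
      using U by (intro A.pder_cong(2)[OF U(1,2) _ diff_along_pdiff[OF V d]]) simp
    then show ?thesis using U by (simp add: cov_chart d)
  qed (simp add: cov_outside)
qed

lemma cov_add:
  assumes "diff_along p V" "diff_along p W"
  shows "cov p v (\<lambda>q. V q + W q) = cov p v V + cov p v W"
proof
  fix d show "cov p v (\<lambda>q. V q + W q) d = (cov p v V + cov p v W) d"
  proof (cases "d \<in> B \<and> F p \<in> fst d")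
    case True
    then show ?thesis using assms[THEN diff_along_pdiff]
      by (simp add: cov_chart A.pder_plus N.christoffel_add_right)
  qed (simp add: cov_outside)
qed

lemma cov_scaleR:
  assumes "pdiff A p h" "diff_along p V"
  shows "cov p v (\<lambda>q. h q *\<^sub>R V q) = pder A p v h *\<^sub>R V p + h p *\<^sub>R cov p v V"
proof
  fix d show "cov p v (\<lambda>q. h q *\<^sub>R V q) d = (pder A p v h *\<^sub>R V p + h p *\<^sub>R cov p v V) d"
  proof (cases "d \<in> B \<and> F p \<in> fst d")
    case True
    then show ?thesis using diff_along_pdiff[OF assms(2)]
      by (simp add: cov_chart A.pder_bilinear[OF bounded_bilinear_scaleR assms(1)]
          N.christoffel_scale_right algebra_simps)
  next
    case False
    then show ?thesis
      using N.tangent_space_zero[OF diff_along_tangent[OF assms(2)] False]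
      by (simp add: cov_outside)
  qed
qed

lemma cov_zero: "cov p v (\<lambda>q. 0) = 0"
  using cov_add[OF diff_along_zero diff_along_zero, of p v] by simp

lemma cov_sum:
  assumes "finite I" "\<And>i. i \<in> I \<Longrightarrow> diff_along p (V i)"
  shows "cov p v (\<lambda>q. \<Sum>i\<in>I. V i q) = (\<Sum>i\<in>I. cov p v (V i))"
  using assms
  by (induction I rule: finite_induct) (simp_all add: cov_zero cov_add diff_along_sum)

text \<open>In every chart of the ambient manifold both sides have the same expression: the chain rule turns
  the derivative of \<open>Y \<circ> F\<close> along \<open>v\<close> into that of \<open>Y\<close> along \<open>dF v\<close>.\<close>

lemma cov_field:
  assumes U: "open U" "F p \<in> U" and Y: "vector_field_on B U Y"
  shows "cov p v (\<lambda>q. Y (F q)) = nabla (F p) (dF p v) Y"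
proof
  fix d show "cov p v (\<lambda>q. Y (F q)) d = nabla (F p) (dF p v) Y d"
  proof (cases "d \<in> B \<and> F p \<in> fst d")
    case True
    then have d: "d \<in> B" "F p \<in> fst d" by auto
    show ?thesis
      using N.nabla_chart[OF d U Y dF_tangent] pder_comp_F(2)[of p "\<lambda>y. Y y d" v]
      by (simp add: cov_chart[OF d])
  next
    case False
    then show ?thesis
      using N.tangent_space_zero[OF N.nabla_tangent[OF U(1) Y U(2) dF_tangent] False]
      by (simp add: cov_outside)
  qed
qed

lemma diff_along_frame:
  assumes d: "d \<in> B" "F p \<in> fst d" and V: "diff_along p V"
  obtains U where "open U" "p \<in> U"
    "\<forall>q\<in>U. V q = (\<Sum>b\<in>Basis. (V q d \<bullet> b) *\<^sub>R coord_vec B d b (F q))"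
proof -
  obtain U where U: "open U" "p \<in> U" "\<forall>q\<in>U. V q \<in> tangent_space B (F q)"
    using V by (auto simp: diff_along_def)
  show ?thesis
  proof (rule that)
    show "open (U \<inter> F -` fst d)" "p \<in> U \<inter> F -` fst d"
      using U d by (auto intro: open_preimage N.chart_homeomorphism)
    show "\<forall>q\<in>U \<inter> F -` fst d. V q = (\<Sum>b\<in>Basis. (V q d \<bullet> b) *\<^sub>R coord_vec B d b (F q))"
      using U d by (intro ballI N.tangent_vec_expand) auto
  qed
qed

lemma diff_along_coord_vec:
  "d \<in> B \<Longrightarrow> F p \<in> fst d \<Longrightarrow> diff_along p (\<lambda>q. coord_vec B d b (F q))"
  by (rule diff_along_field[OF N.chart_homeomorphism(1) _ N.coord_vec_field])

lemma pdiff_component: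
  "diff_along p V \<Longrightarrow> d \<in> B \<Longrightarrow> F p \<in> fst d \<Longrightarrow> pdiff A p (\<lambda>q. V q d \<bullet> b)"
  by (rule A.pder_linear_compose[OF bounded_linear_inner_left diff_along_pdiff])

text \<open>While \<open>cov\<close> is defined by components in each chart separately, the right-hand side is visibly a
  tangent vector. It also reduces statements about \<open>cov\<close> to coordinate fields of the ambient
  manifold.\<close>

lemma cov_expand:
  assumes d: "d \<in> B" "F p \<in> fst d" and V: "diff_along p V"
  shows "cov p v V = (\<Sum>b\<in>Basis. pder A p v (\<lambda>q. V q d \<bullet> b) *\<^sub>R coord_vec B d b (F p) +
    (V p d \<bullet> b) *\<^sub>R nabla (F p) (dF p v) (coord_vec B d b))"
proof -
  obtain U where U: "open U" "p \<in> U"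
    "\<forall>q\<in>U. V q = (\<Sum>b\<in>Basis. (V q d \<bullet> b) *\<^sub>R coord_vec B d b (F q))"
    using diff_along_frame[OF assms] .
  have "cov p v V = cov p v (\<lambda>q. \<Sum>b\<in>Basis. (V q d \<bullet> b) *\<^sub>R coord_vec B d b (F q))"
    by (rule cov_cong[OF U V])
  also have "\<dots> = (\<Sum>b\<in>Basis. cov p v (\<lambda>q. (V q d \<bullet> b) *\<^sub>R coord_vec B d b (F q)))"
    by (intro cov_sum diff_along_scaleR pdiff_component[OF V] diff_along_coord_vec d) simp
  also have "\<dots> = (\<Sum>b\<in>Basis. pder A p v (\<lambda>q. V q d \<bullet> b) *\<^sub>R coord_vec B d b (F p) +
      (V p d \<bullet> b) *\<^sub>R nabla (F p) (dF p v) (coord_vec B d b))"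
    by (simp add: cov_scaleR pdiff_component[OF V] diff_along_coord_vec d
        cov_field[OF N.chart_homeomorphism(1) _ N.coord_vec_field])
  finally show ?thesis .
qed

lemma cov_tangent:
  assumes "diff_along p V"
  shows "cov p v V \<in> tangent_space B (F p)"
proof -
  obtain d where d: "d \<in> B" "F p \<in> fst d" using N.chart_at by blast
  show ?thesis
    unfolding cov_expand[OF d assms]
    by (intro N.tangent_space_closed N.coord_vec_tangent d dF_tangent
        N.nabla_tangent[OF N.chart_homeomorphism(1) N.coord_vec_field])
qed

text \<open>With respect to a frame of coordinate fields \<open>E\<^sub>b\<close>, both sides are obtained by the Leibniz rule, with
  \<open>J\<close> applied to \<open>E\<^sub>b\<close> before or after the differentiation; \<open>\<nabla>J = 0\<close> identifies them.\<close>

lemma cov_J: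
  assumes V: "diff_along p V"
  shows "diff_along p (\<lambda>q. J (F q) (V q))" and "cov p v (\<lambda>q. J (F q) (V q)) = J (F p) (cov p v V)"
proof -
  obtain d where d: "d \<in> B" "F p \<in> fst d" using N.chart_at by blast
  have op: "open (fst d)" using d(1) by (rule N.chart_homeomorphism)
  let ?E = "\<lambda>b. coord_vec B d b"
  obtain U where U: "open U" "p \<in> U"
    "\<forall>q\<in>U. V q = (\<Sum>b\<in>Basis. (V q d \<bullet> b) *\<^sub>R ?E b (F q))"
    using diff_along_frame[OF d V] by blast
  let ?U = "U \<inter> F -` fst d"
  have U': "open ?U" "p \<in> ?U" using U d op by (auto intro: open_preimage)
  have eq: "\<forall>q\<in>?U. (\<Sum>b\<in>Basis. (V q d \<bullet> b) *\<^sub>R J (F q) (?E b (F q))) = J (F q) (V q)"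
  proof
    fix q assume that: "q \<in> ?U"
    have "J (F q) (V q) = J (F q) (\<Sum>b\<in>Basis. (V q d \<bullet> b) *\<^sub>R ?E b (F q))"
      using U(3) that by simp
    also have "\<dots> = (\<Sum>b\<in>Basis. (V q d \<bullet> b) *\<^sub>R J (F q) (?E b (F q)))"
      using that d
      by (subst N.J_sum) (auto intro!: N.tangent_space_closed N.coord_vec_tangent sum.cong N.J_scale)
    finally show "(\<Sum>b\<in>Basis. (V q d \<bullet> b) *\<^sub>R J (F q) (?E b (F q))) = J (F q) (V q)" ..
  qed
  have JE: "vector_field_on B (fst d) (\<lambda>y. J y (?E b y))" for b
    by (rule N.J_field[OF op N.coord_vec_field[OF d(1)]])
  have dJE: "diff_along p (\<lambda>q. J (F q) (?E b (F q)))" for b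
    by (rule diff_along_field[OF op d(2) JE])
  have dsum: "diff_along p (\<lambda>q. \<Sum>b\<in>Basis. (V q d \<bullet> b) *\<^sub>R J (F q) (?E b (F q)))"
    by (intro diff_along_sum diff_along_scaleR dJE pdiff_component[OF V] d) simp
  show "diff_along p (\<lambda>q. J (F q) (V q))"
    by (rule diff_along_cong[OF U' eq dsum])
  have T: "?E b (F p) \<in> tangent_space B (F p)" "nabla (F p) (dF p v) (?E b) \<in> tangent_space B (F p)" for b
    by (intro N.coord_vec_tangent d) (rule N.nabla_tangent[OF op N.coord_vec_field[OF d(1)] d(2) dF_tangent])
  have "cov p v (\<lambda>q. J (F q) (V q)) = cov p v (\<lambda>q. \<Sum>b\<in>Basis. (V q d \<bullet> b) *\<^sub>R J (F q) (?E b (F q)))"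
    using cov_cong[OF U' eq dsum] by simp
  also have "\<dots> = (\<Sum>b\<in>Basis. cov p v (\<lambda>q. (V q d \<bullet> b) *\<^sub>R J (F q) (?E b (F q))))"
    by (intro cov_sum diff_along_scaleR pdiff_component[OF V] dJE d) simp
  also have "\<dots> = (\<Sum>b\<in>Basis. pder A p v (\<lambda>q. V q d \<bullet> b) *\<^sub>R J (F p) (?E b (F p)) +
      (V p d \<bullet> b) *\<^sub>R J (F p) (nabla (F p) (dF p v) (?E b)))"
    by (simp add: cov_scaleR pdiff_component[OF V] dJE d cov_field[OF op d(2) JE]
        N.parallel_J[OF op N.coord_vec_field[OF d(1)] d(2) dF_tangent])
  also have "\<dots> = J (F p) (cov p v V)"
    unfolding cov_expand[OF d V]
    by (subst N.J_sum) (auto intro!: N.tangent_space_closed T sum.cong simp: N.J_add N.J_scale T N.tangent_space_closed)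
  finally show "cov p v (\<lambda>q. J (F q) (V q)) = J (F p) (cov p v V)" .
qed

text \<open>The property that \<open>pder_gbar\<close> establishes, as a predicate of both fields: it holds for
  restrictions of ambient fields and is inherited by linear combinations with functions as
  coefficients, first in one argument and then, by symmetry, in the other.\<close>

definition metric_rule :: "'m \<Rightarrow> ('m \<Rightarrow> ('n, 'f) tvec) \<Rightarrow> ('m \<Rightarrow> ('n, 'f) tvec) \<Rightarrow> bool" where
  "metric_rule p V W \<longleftrightarrow> pdiff A p (\<lambda>q. gbar (F q) (V q) (W q)) \<and>
     (\<forall>v. pder A p v (\<lambda>q. gbar (F q) (V q) (W q)) =
       gbar (F p) (cov p v V) (W p) + gbar (F p) (V p) (cov p v W))"

lemma metric_rule_cong:
  assumes U: "open U" "p \<in> U" "\<forall>q\<in>U. V q = V' q" "\<forall>q\<in>U. W q = W' q"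
    and "diff_along p V" "diff_along p W" "metric_rule p V W"
  shows "metric_rule p V' W'"
proof -
  have eq: "\<forall>q\<in>U. gbar (F q) (V q) (W q) = gbar (F q) (V' q) (W' q)"
    using U by simp
  have "pdiff A p (\<lambda>q. gbar (F q) (V q) (W q))" using assms(7) by (simp add: metric_rule_def)
  note A.pder_cong(1)[OF U(1,2) eq] A.pder_cong(2)[OF U(1,2) eq this]
  moreover have "cov p v V = cov p v V'" "cov p v W = cov p v W'" for v
    by (rule cov_cong[OF U(1-3) assms(5)]) (rule cov_cong[OF U(1,2,4) assms(6)])
  moreover have "V p = V' p" "W p = W' p" using U by auto
  ultimately show ?thesis using assms(7) by (simp add: metric_rule_def)
qed

lemma metric_rule_sym:
  assumes V: "diff_along p V" and W: "diff_along p W" and "metric_rule p V W"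
  shows "metric_rule p W V"
proof -
  obtain U where "open U" "p \<in> U" "\<forall>q\<in>U. V q \<in> tangent_space B (F q)"
    using V by (auto simp: diff_along_def)
  moreover obtain U' where "open U'" "p \<in> U'" "\<forall>q\<in>U'. W q \<in> tangent_space B (F q)"
    using W by (auto simp: diff_along_def)
  ultimately have U: "open (U \<inter> U')" "p \<in> U \<inter> U'" and
    eq: "\<forall>q\<in>U \<inter> U'. gbar (F q) (V q) (W q) = gbar (F q) (W q) (V q)"
    by (auto intro: N.gbar_sym)
  note A.pder_cong(1)[OF U eq] A.pder_cong(2)[OF U eq]
  then show ?thesis
    using assms(3) N.gbar_sym[OF cov_tangent[OF V] diff_along_tangent[OF W]]
      N.gbar_sym[OF cov_tangent[OF W] diff_along_tangent[OF V]]
    by (simp add: metric_rule_def add.commute)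
qed

lemma metric_rule_scaleR:
  assumes h: "pdiff A p h" and V: "diff_along p V" and W: "diff_along p W" and VW: "metric_rule p V W"
  shows "metric_rule p (\<lambda>q. h q *\<^sub>R V q) W"
proof -
  obtain U where "open U" "p \<in> U" "\<forall>q\<in>U. V q \<in> tangent_space B (F q)"
    using V by (auto simp: diff_along_def)
  moreover obtain U' where "open U'" "p \<in> U'" "\<forall>q\<in>U'. W q \<in> tangent_space B (F q)"
    using W by (auto simp: diff_along_def)
  ultimately have U: "open (U \<inter> U')" "p \<in> U \<inter> U'" and
    eq: "\<forall>q\<in>U \<inter> U'. h q * gbar (F q) (V q) (W q) = gbar (F q) (h q *\<^sub>R V q) (W q)"
    by (auto intro: N.gbar_scale_left[symmetric])
  have pd: "pdiff A p (\<lambda>q. gbar (F q) (V q) (W q))" using VW by (simp add: metric_rule_def)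
  note 1 = A.pder_bilinear[OF bounded_bilinear_mult h pd]
  have "pder A p v (\<lambda>q. gbar (F q) (h q *\<^sub>R V q) (W q)) =
      gbar (F p) (cov p v (\<lambda>q. h q *\<^sub>R V q)) (W p) + gbar (F p) (h p *\<^sub>R V p) (cov p v W)" for v
    using A.pder_cong(2)[OF U eq 1(1), of v] VW diff_along_tangent[OF V] diff_along_tangent[OF W]
      cov_tangent[OF V] cov_tangent[OF W]
    by (simp add: 1(2) metric_rule_def cov_scaleR[OF h V] N.gbar_add_left N.gbar_scale_left
        N.tangent_space_closed algebra_simps)
  then show ?thesis
    using A.pder_cong(1)[OF U eq] 1(1) by (simp add: metric_rule_def)
qed

lemma metric_rule_add:
  assumes V: "diff_along p V" and V': "diff_along p V'" and W: "diff_along p W"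
    and VW: "metric_rule p V W" "metric_rule p V' W"
  shows "metric_rule p (\<lambda>q. V q + V' q) W"
proof -
  obtain U where "open U" "p \<in> U" "\<forall>q\<in>U. V q \<in> tangent_space B (F q)"
    using V by (auto simp: diff_along_def)
  moreover obtain U' where "open U'" "p \<in> U'" "\<forall>q\<in>U'. W q \<in> tangent_space B (F q)"
    using W by (auto simp: diff_along_def)
  moreover obtain U'' where "open U''" "p \<in> U''" "\<forall>q\<in>U''. V' q \<in> tangent_space B (F q)"
    using V' by (auto simp: diff_along_def)
  ultimately have U: "open (U \<inter> U' \<inter> U'')" "p \<in> U \<inter> U' \<inter> U''" and
    eq: "\<forall>q\<in>U \<inter> U' \<inter> U''.
      gbar (F q) (V q) (W q) + gbar (F q) (V' q) (W q) = gbar (F q) (V q + V' q) (W q)"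
    by (auto intro: N.gbar_add_left[symmetric])
  have pd: "pdiff A p (\<lambda>q. gbar (F q) (V q) (W q))" "pdiff A p (\<lambda>q. gbar (F q) (V' q) (W q))"
    using VW by (simp_all add: metric_rule_def)
  note 1 = A.pder_plus[OF pd]
  have "pder A p v (\<lambda>q. gbar (F q) (V q + V' q) (W q)) =
      gbar (F p) (cov p v (\<lambda>q. V q + V' q)) (W p) + gbar (F p) (V p + V' p) (cov p v W)" for v
    using A.pder_cong(2)[OF U eq 1(1), of v] VW diff_along_tangent[OF V] diff_along_tangent[OF W]
      cov_tangent[OF V] cov_tangent[OF W] diff_along_tangent[OF V'] cov_tangent[OF V']
    by (simp add: 1(2) metric_rule_def cov_add[OF V V'] N.gbar_add_left)
  then show ?thesis
    using A.pder_cong(1)[OF U eq] 1(1) by (simp add: metric_rule_def)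
qed

lemma metric_rule_zero: 
  assumes W: "diff_along p W"
  shows "metric_rule p (\<lambda>q. 0) W"
proof -
  obtain U where U: "open U" "p \<in> U" "\<forall>q\<in>U. W q \<in> tangent_space B (F q)"
    using W by (auto simp: diff_along_def)
  have eq: "\<forall>q\<in>U. 0 = gbar (F q) 0 (W q)"
    using U by (simp add: N.gbar_zero)
  show ?thesis
    using A.pder_cong[OF U(1,2) eq] A.pder_const[where k = "0::real" and p = p]
    by (simp add: metric_rule_def cov_zero N.gbar_zero diff_along_tangent[OF W] cov_tangent[OF W])
qed

lemma metric_rule_sum:
  assumes "finite I" "\<And>i. i \<in> I \<Longrightarrow> diff_along p (V i)" "diff_along p W"
    "\<And>i. i \<in> I \<Longrightarrow> metric_rule p (V i) W"
  shows "metric_rule p (\<lambda>q. \<Sum>i\<in>I. V i q) W"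
  using assms
  by (induction I rule: finite_induct)
    (simp_all add: metric_rule_zero metric_rule_add diff_along_sum)

lemma metric_rule_field:
  assumes U: "open U" "F p \<in> U" and Y: "vector_field_on B U Y" "vector_field_on B U Z"
  shows "metric_rule p (\<lambda>q. Y (F q)) (\<lambda>q. Z (F q))"
proof -
  have "pdiff B (F p) (\<lambda>y. gbar y (Y y) (Z y))"
    by (rule N.smooth_fun_pdiff[OF N.smooth_gbar[OF U(1) Y] U(2)])
  from pder_comp_F[OF this] show ?thesis
    using N.pder_metric[OF U(1) Y U(2) dF_tangent]
    by (simp add: metric_rule_def cov_field[OF U Y(1)] cov_field[OF U Y(2)])
qed

lemma metric_rule_coord_vec:
  assumes d: "d \<in> B" "F p \<in> fst d" and V: "diff_along p V"
    and e: "\<And>b. metric_rule p (\<lambda>q. coord_vec B d b (F q)) W" and W: "diff_along p W"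
  shows "metric_rule p V W"
proof -
  obtain U where U: "open U" "p \<in> U"
    "\<forall>q\<in>U. V q = (\<Sum>b\<in>Basis. (V q d \<bullet> b) *\<^sub>R coord_vec B d b (F q))"
    using diff_along_frame[OF d V] by blast
  have 1: "diff_along p (\<lambda>q. (V q d \<bullet> b) *\<^sub>R coord_vec B d b (F q))" for b
    by (intro diff_along_scaleR pdiff_component[OF V] diff_along_coord_vec d)
  have 2: "metric_rule p (\<lambda>q. (V q d \<bullet> b) *\<^sub>R coord_vec B d b (F q)) W" for b
    by (intro metric_rule_scaleR pdiff_component[OF V] diff_along_coord_vec d W e)
  show ?thesis
  proof (rule metric_rule_cong[OF U(1,2)])
    show "metric_rule p (\<lambda>q. \<Sum>b\<in>Basis. (V q d \<bullet> b) *\<^sub>R coord_vec B d b (F q)) W"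
      by (intro metric_rule_sum 1 2 W) simp
    show "diff_along p (\<lambda>q. \<Sum>b\<in>Basis. (V q d \<bullet> b) *\<^sub>R coord_vec B d b (F q))"
      by (intro diff_along_sum 1) simp
  qed (use U(3) W in auto)
qed

lemma pder_gbar:
  assumes V: "diff_along p V" and W: "diff_along p W"
  shows "pdiff A p (\<lambda>q. gbar (F q) (V q) (W q))"
    and "pder A p v (\<lambda>q. gbar (F q) (V q) (W q)) =
       gbar (F p) (cov p v V) (W p) + gbar (F p) (V p) (cov p v W)"
proof -
  obtain d where d: "d \<in> B" "F p \<in> fst d" using N.chart_at by blast
  have "metric_rule p (\<lambda>q. coord_vec B d b (F q)) (\<lambda>q. coord_vec B d b' (F q))" for b b'
    by (rule metric_rule_field[OF N.chart_homeomorphism(1) d(2) N.coord_vec_field N.coord_vec_field])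
      (fact d)+
  then have "metric_rule p (\<lambda>q. coord_vec B d b (F q)) W" for b
    by (intro metric_rule_sym[OF W diff_along_coord_vec[OF d]]
        metric_rule_coord_vec[OF d W _ diff_along_coord_vec[OF d]])
  then have "metric_rule p V W" by (intro metric_rule_coord_vec[OF d V _ W])
  then show "pdiff A p (\<lambda>q. gbar (F q) (V q) (W q))"
    "pder A p v (\<lambda>q. gbar (F q) (V q) (W q)) =
       gbar (F p) (cov p v V) (W p) + gbar (F p) (V p) (cov p v W)"
    by (auto simp: metric_rule_def)
qed

lemma cov_orthogonal:
  assumes U: "open U" "p \<in> U" "\<forall>q\<in>U. gbar (F q) (V q) (W q) = 0"
    and V: "diff_along p V" and W: "diff_along p W"
  shows "gbar (F p) (cov p v V) (W p) = - gbar (F p) (V p) (cov p v W)"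
proof -
  have "pder A p v (\<lambda>q. gbar (F q) (V q) (W q)) = pder A p v (\<lambda>q. 0)"
    by (rule A.pder_cong(2)[OF U pder_gbar(1)[OF V W]])
  then show ?thesis using pder_gbar(2)[OF V W] by (simp add: A.pder_const)
qed

lemma dF_coord_vec:
  assumes c: "c \<in> A" "q \<in> fst c" and d: "d \<in> B" "F q \<in> fst d"
  shows "dF q (coord_vec A c b q) d = frechet_derivative (snd d \<circ> F \<circ> cinv c) (at (snd c q)) b"
proof -
  have "(snd d \<circ> F \<circ> cinv c) differentiable (at (snd c q))"
    using assms by (intro smooth_on_differentiable[OF smooth_F]) auto
  then show ?thesis
    using A.pder_chart[OF c A.coord_vec_tangent[OF c], of "\<lambda>q. snd d (F q)" b]
    by (simp add: dF_chart[OF d] A.coord_vec_chart[OF c] o_def)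
qed

lemma dF_coord_vec_chart:
  assumes c: "c \<in> A" "p \<in> fst c" and d: "d \<in> B" "F p \<in> fst d"
  shows "((\<lambda>q. dF q (coord_vec A c b q) d) \<circ> cinv c) differentiable (at (snd c p))"
    and "frechet_derivative ((\<lambda>q. dF q (coord_vec A c b q) d) \<circ> cinv c) (at (snd c p)) =
      frechet_derivative (\<lambda>x. frechet_derivative (snd d \<circ> F \<circ> cinv c) (at x) b) (at (snd c p))"
proof -
  let ?S = "snd c ` (fst c \<inter> F -` fst d)"
  let ?f = "\<lambda>x. frechet_derivative (snd d \<circ> F \<circ> cinv c) (at x) b"
  have S: "open ?S" "snd c p \<in> ?S"
    using assms by (auto intro!: A.open_chart_image open_preimage N.chart_homeomorphism)
  have "(?f has_derivative frechet_derivative ?f (at (snd c p))) (at (snd c p))"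
    by (rule smooth_on_has_derivative[OF smooth_on_frechet_derivative[OF smooth_F[OF c(1) d(1)]] S(2)])
  then have "(((\<lambda>q. dF q (coord_vec A c b q) d) \<circ> cinv c) has_derivative
      frechet_derivative ?f (at (snd c p))) (at (snd c p))"
    by (rule has_derivative_transform_within_open[OF _ S])
      (use c d in \<open>auto simp: dF_coord_vec A.cinv_chart\<close>)
  then show "((\<lambda>q. dF q (coord_vec A c b q) d) \<circ> cinv c) differentiable (at (snd c p))"
    "frechet_derivative ((\<lambda>q. dF q (coord_vec A c b q) d) \<circ> cinv c) (at (snd c p)) =
      frechet_derivative ?f (at (snd c p))"
    by (auto simp: frechet_derivative_eqI intro: differentiableI)
qed

lemma diff_along_dF_coord_vec:
  assumes c: "c \<in> A" "p \<in> fst c"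
  shows "diff_along p (\<lambda>q. dF q (coord_vec A c b q))"
  unfolding diff_along_def
  using dF_tangent A.pdiff_chart[OF c dF_coord_vec_chart(1)[OF c]] by blast

text \<open>In a chart of the ambient manifold, the two sides are second derivatives of \<open>F\<close> in exchanged
  order, plus connection coefficients with exchanged arguments. In the proof of the Koszul formula
  this plays the role of the vanishing bracket of coordinate fields.\<close>

lemma cov_coord_vec_symmetric:
  assumes c: "c \<in> A" "p \<in> fst c"
  shows "cov p (coord_vec A c a p) (\<lambda>q. dF q (coord_vec A c b q)) =
         cov p (coord_vec A c b p) (\<lambda>q. dF q (coord_vec A c a q))"
proof
  fix d
  show "cov p (coord_vec A c a p) (\<lambda>q. dF q (coord_vec A c b q)) d =
        cov p (coord_vec A c b p) (\<lambda>q. dF q (coord_vec A c a q)) d"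
  proof (cases "d \<in> B \<and> F p \<in> fst d")
    case True
    then have d: "d \<in> B" "F p \<in> fst d" by auto
    have S: "open (snd c ` (fst c \<inter> F -` fst d))" "snd c p \<in> snd c ` (fst c \<inter> F -` fst d)"
      using c d by (auto intro!: A.open_chart_image open_preimage N.chart_homeomorphism)
    have "pder A p (coord_vec A c a p) (\<lambda>q. dF q (coord_vec A c b q) d) =
      frechet_derivative (\<lambda>x. frechet_derivative (snd d \<circ> F \<circ> cinv c) (at x) b) (at (snd c p)) a" for a b
      using A.pder_chart[OF c A.coord_vec_tangent[OF c] dF_coord_vec_chart(1)[OF c d]]
      by (simp add: dF_coord_vec_chart(2)[OF c d] A.coord_vec_chart[OF c])
    then show ?thesis
      using second_derivative_symmetric[OF S smooth_F[OF c(1) d(1)], of b a]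
      by (simp add: cov_chart[OF d] N.christoffel_symmetric[OF d])
  qed (simp add: cov_outside)
qed

end

section \<open>Smooth orthogonal frames\<close>

context
  fixes S :: "'e::euclidean_space set" and h :: "'e \<Rightarrow> 'e \<Rightarrow> 'e \<Rightarrow> real"
  assumes S: "open S"
    and add: "\<And>x u v w. x \<in> S \<Longrightarrow> h x (u + v) w = h x u w + h x v w"
    and scale: "\<And>x a u w. x \<in> S \<Longrightarrow> h x (a *\<^sub>R u) w = a * h x u w"
    and sym: "\<And>x u w. x \<in> S \<Longrightarrow> h x u w = h x w u"
    and pos: "\<And>x u. x \<in> S \<Longrightarrow> u \<noteq> 0 \<Longrightarrow> h x u u > 0"
    and smooth: "\<And>u v. smooth_on S u \<Longrightarrow> smooth_on S v \<Longrightarrow> smooth_on S (\<lambda>x. h x (u x) (v x))"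
begin

lemma linear_form: "x \<in> S \<Longrightarrow> linear (\<lambda>u. h x u w)"
  by (intro linearI) (simp_all add: add scale)

lemma form_sum_left: "x \<in> S \<Longrightarrow> h x (\<Sum>i\<in>I. u i) w = (\<Sum>i\<in>I. h x (u i) w)"
  using linear_sum[OF linear_form] .

lemma orthogonal_sum:
  assumes "x \<in> S" "finite I" "b \<in> I" "\<And>b'. b' \<in> I \<Longrightarrow> b' \<noteq> b \<Longrightarrow> h x (E b') (E b) = 0"
  shows "h x (\<Sum>b'\<in>I. a b' *\<^sub>R E b') (E b) = a b * h x (E b) (E b)"
proof -
  have "h x (\<Sum>b'\<in>I. a b' *\<^sub>R E b') (E b) = (\<Sum>b'\<in>I. a b' * h x (E b') (E b))"
    using assms(1) by (simp add: form_sum_left scale)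
  also have "\<dots> = (\<Sum>b'\<in>I. if b' = b then a b * h x (E b) (E b) else 0)"
    by (intro sum.cong refl) (auto simp: assms(4))
  finally show ?thesis using assms(2,3) by simp
qed

text \<open>Gram-Schmidt orthogonalization uses only inner products, quotients and sums, and so it turns the
  constant basis into an orthogonal frame that depends smoothly on \<open>x\<close>. The frame is not normalized,
  which spares the square roots.\<close>

lemma gram_schmidt:
  assumes "finite I" "I \<subseteq> Basis"
  shows "\<exists>E :: 'e \<Rightarrow> 'e \<Rightarrow> 'e. (\<forall>b\<in>I. smooth_on S (E b)) \<and> (\<forall>x\<in>S. (\<forall>b\<in>I. E b x \<noteq> 0) \<and>
    (\<forall>b\<in>I. \<forall>b'\<in>I. b \<noteq> b' \<longrightarrow> h x (E b x) (E b' x) = 0) \<and> span ((\<lambda>b. E b x) ` I) = span I)"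
  using assms
proof (induction I rule: finite_induct)
  case empty
  then show ?case by simp
next
  case (insert b0 I)
  have "I \<subseteq> Basis" using insert.prems by simp
  from insert.IH[OF this] obtain E where E':
    "(\<forall>b\<in>I. smooth_on S (E b)) \<and> (\<forall>x\<in>S. (\<forall>b\<in>I. E b x \<noteq> 0) \<and>
    (\<forall>b\<in>I. \<forall>b'\<in>I. b \<noteq> b' \<longrightarrow> h x (E b x) (E b' x) = 0) \<and> span ((\<lambda>b. E b x) ` I) = span I)"
    by (rule exE)
  then have E: "\<And>b. b \<in> I \<Longrightarrow> smooth_on S (E b)"
    "\<And>x b. x \<in> S \<Longrightarrow> b \<in> I \<Longrightarrow> E b x \<noteq> 0"
    "\<And>x b b'. x \<in> S \<Longrightarrow> b \<in> I \<Longrightarrow> b' \<in> I \<Longrightarrow> b \<noteq> b' \<Longrightarrow> h x (E b x) (E b' x) = 0"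
    "\<And>x. x \<in> S \<Longrightarrow> span ((\<lambda>b. E b x) ` I) = span I"
    by blast+
  \<comment> \<open>The projection of the new basis vector onto the span of the vectors constructed so far.\<close>
  define s where "s x = (\<Sum>b\<in>I. (h x b0 (E b x) * inverse (h x (E b x) (E b x))) *\<^sub>R E b x)" for x
  define E' where "E' = E(b0 := (\<lambda>x. b0 - s x))"
  have ne: "h x (E b x) (E b x) \<noteq> 0" if "x \<in> S" "b \<in> I" for x b
    using pos[OF that(1) E(2)[OF that]] by simp
  have "smooth_on S s"
    unfolding s_def
    by (intro smooth_on_sum smooth_on_scaleR smooth_on_mult smooth_on_inverse S smooth
        smooth_on_const E ne)
  then have E0: "smooth_on S (E' b0)"
    unfolding E'_def by (simp add: smooth_on_diff S smooth_on_const)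
  have orth: "h x (b0 - s x) (E b x) = 0" if "x \<in> S" "b \<in> I" for x b
  proof -
    have "h x (s x) (E b x) = h x b0 (E b x) * inverse (h x (E b x) (E b x)) * h x (E b x) (E b x)"
      unfolding s_def using that insert(1) E(3)
      by (intro orthogonal_sum[where E = "\<lambda>b. E b x"]) auto
    then show ?thesis
      using linear_diff[OF linear_form[OF that(1)]] ne[OF that] by simp
  qed
  have sp: "s x \<in> span ((\<lambda>b. E b x) ` I)" for x
    unfolding s_def by (intro span_sum span_scale span_base) auto
  have "b0 \<notin> span I"
  proof -
    have "b0 \<notin> span (Basis - {b0})"
      using independent_Basis[where 'a = 'e] insert.prems unfolding dependent_def by blast
    moreover have "I \<subseteq> Basis - {b0}" using insert.prems insert.hyps(2) by auto
    ultimately show ?thesis using span_mono by blast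
  qed
  then have ne0: "b0 - s x \<noteq> 0" if "x \<in> S" for x
    using sp[of x] E(4)[OF that] by auto
  have im: "(\<lambda>b. E' b x) ` insert b0 I = insert (b0 - s x) ((\<lambda>b. E b x) ` I)" for x
    using insert(2) unfolding E'_def by auto
  have "span (insert (b0 - s x) ((\<lambda>b. E b x) ` I)) = span (insert b0 I)" if "x \<in> S" for x
  proof -
    have "span (insert (b0 - s x) ((\<lambda>b. E b x) ` I)) = span (insert b0 ((\<lambda>b. E b x) ` I))"
    proof (rule span_eq[THEN iffD2], intro conjI insert_subsetI)
      let ?T = "(\<lambda>b. E b x) ` I"
      have "s x \<in> span (insert b0 ?T)" "s x \<in> span (insert (b0 - s x) ?T)"
        using sp[of x] span_mono[of ?T "insert b0 ?T"] span_mono[of ?T "insert (b0 - s x) ?T"] by auto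
      then show "b0 - s x \<in> span (insert b0 ?T)"
        by (intro span_diff) (auto intro: span_base)
      have "(b0 - s x) + s x \<in> span (insert (b0 - s x) ?T)"
        using \<open>s x \<in> span (insert (b0 - s x) ?T)\<close> by (intro span_add) (auto intro: span_base)
      then show "b0 \<in> span (insert (b0 - s x) ?T)" by simp
    qed (auto intro: span_base)
    also have "\<dots> = span (insert b0 I)"
      unfolding span_insert using E(4)[OF that] by simp
    finally show ?thesis .
  qed
  then have "(\<forall>b\<in>insert b0 I. smooth_on S (E' b)) \<and> (\<forall>x\<in>S. (\<forall>b\<in>insert b0 I. E' b x \<noteq> 0) \<and>
    (\<forall>b\<in>insert b0 I. \<forall>b'\<in>insert b0 I. b \<noteq> b' \<longrightarrow> h x (E' b x) (E' b' x) = 0) \<and>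
    span ((\<lambda>b. E' b x) ` insert b0 I) = span (insert b0 I))"
    using E0 E(1-3) ne0 orth sym insert(2) unfolding im by (auto simp: E'_def)
  then show ?case by blast
qed

text \<open>The representing vector of a linear form is explicit in terms of the frame. It exists at each
  single point, and it depends smoothly on \<open>x\<close> whenever the values of the form on the frame do.\<close>

lemma smooth_riesz:
  obtains E :: "'e \<Rightarrow> 'e \<Rightarrow> 'e" where "\<forall>b\<in>Basis. smooth_on S (E b)"
    and "\<forall>x\<in>S. \<forall>b\<in>Basis. h x (E b x) (E b x) \<noteq> 0"
    and "\<forall>x\<in>S. \<forall>\<beta> z. linear \<beta> \<longrightarrow>
      h x (\<Sum>b\<in>Basis. (\<beta> (E b x) * inverse (h x (E b x) (E b x))) *\<^sub>R E b x) z = \<beta> z"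
proof -
  from gram_schmidt[OF finite_Basis order_refl] obtain E :: "'e \<Rightarrow> 'e \<Rightarrow> 'e" where
    "(\<forall>b\<in>Basis. smooth_on S (E b)) \<and> (\<forall>x\<in>S. (\<forall>b\<in>Basis. E b x \<noteq> 0) \<and>
    (\<forall>b\<in>Basis. \<forall>b'\<in>Basis. b \<noteq> b' \<longrightarrow> h x (E b x) (E b' x) = 0) \<and>
    span ((\<lambda>b. E b x) ` Basis) = span Basis)"
    by (rule exE)
  then have E: "\<And>b. b \<in> Basis \<Longrightarrow> smooth_on S (E b)"
    "\<And>x b. x \<in> S \<Longrightarrow> b \<in> Basis \<Longrightarrow> E b x \<noteq> 0"
    "\<And>x b b'. x \<in> S \<Longrightarrow> b \<in> Basis \<Longrightarrow> b' \<in> Basis \<Longrightarrow> b \<noteq> b' \<Longrightarrow> h x (E b x) (E b' x) = 0"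
    "\<And>x. x \<in> S \<Longrightarrow> span ((\<lambda>b. E b x) ` Basis) = UNIV"
    unfolding span_Basis by blast+
  have ne: "h x (E b x) (E b x) \<noteq> 0" if "x \<in> S" "b \<in> Basis" for x b
    using pos[OF that(1) E(2)[OF that]] by simp
  show ?thesis
  proof (rule that, safe)
    fix x z and \<beta> :: "'e \<Rightarrow> real" assume x: "x \<in> S" and \<beta>: "linear \<beta>"
    define u where "u = (\<Sum>b\<in>Basis. (\<beta> (E b x) * inverse (h x (E b x) (E b x))) *\<^sub>R E b x)"
    have on_frame: "h x u (E b x) = \<beta> (E b x)" if "b \<in> Basis" for b
      unfolding u_def
      using orthogonal_sum[OF x finite_Basis that, where E = "\<lambda>b. E b x"] E(3)[OF x] that ne[OF x that]
      by simp
    have "linear (h x u)"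
    proof -
      have "(\<lambda>z. h x z u) = h x u" by (rule ext) (rule sym[OF x])
      with linear_form[OF x, of u] show ?thesis by simp
    qed
    then have "h x u z = \<beta> z"
      by (rule linear_eq_on_span[OF _ \<beta>, of _ "(\<lambda>b. E b x) ` Basis"])
        (use on_frame in \<open>auto simp: E(4)[OF x]\<close>)
    then show "h x (\<Sum>b\<in>Basis. (\<beta> (E b x) * inverse (h x (E b x) (E b x))) *\<^sub>R E b x) z = \<beta> z"
      by (simp only: u_def)
  qed (use E(1) ne in auto)
qed

end


section \<open>Smooth vector fields along an immersion\<close>

context immersed_submanifold
begin

text \<open>Smoothness over the domain of one chart of the submanifold is the notion that also applies to
  the coordinate fields of this chart.\<close>

definition smooth_over :: "('m, 'e) chart \<Rightarrow> ('m \<Rightarrow> ('n, 'f) tvec) \<Rightarrow> bool" where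
  "smooth_over c V \<longleftrightarrow> (\<forall>q\<in>fst c. V q \<in> tangent_space B (F q)) \<and>
     (\<forall>d\<in>B. smooth_on (snd c ` (fst c \<inter> F -` fst d)) (\<lambda>x. V (cinv c x) d))"

lemma smooth_over_tangent: "smooth_over c V \<Longrightarrow> q \<in> fst c \<Longrightarrow> V q \<in> tangent_space B (F q)"
  by (simp add: smooth_over_def)

lemma smooth_over_smooth:
  "smooth_over c V \<Longrightarrow> d \<in> B \<Longrightarrow> smooth_on (snd c ` (fst c \<inter> F -` fst d)) (\<lambda>x. V (cinv c x) d)"
  by (simp add: smooth_over_def)

lemma open_chart_preimage:
  "c \<in> A \<Longrightarrow> d \<in> B \<Longrightarrow> open (snd c ` (fst c \<inter> F -` fst d))"
  by (intro A.open_chart_image open_preimage N.chart_homeomorphism)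

lemma smooth_over_diff_along:
  assumes "c \<in> A" "p \<in> fst c" "smooth_over c V"
  shows "diff_along p V"
  unfolding diff_along_def
proof (intro conjI exI ballI impI)
  show "open (fst c)" "p \<in> fst c" by (rule A.chart_homeomorphism) (fact assms)+
  show "V q \<in> tangent_space B (F q)" if "q \<in> fst c" for q
    using assms(3) that by (rule smooth_over_tangent)
  fix d assume d: "d \<in> B" "F p \<in> fst d"
  have "(\<lambda>x. V (cinv c x) d) differentiable (at (snd c p))"
    using assms d by (intro smooth_on_differentiable[OF smooth_over_smooth]) auto
  then show "pdiff A p (\<lambda>q. V q d)"
    by (intro A.pdiff_chart[OF assms(1,2)]) (simp add: o_def)
qed

lemma smooth_over_diff:
  assumes "c \<in> A" "smooth_over c V" "smooth_over c W"
  shows "smooth_over c (\<lambda>q. V q - W q)"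
  using assms open_chart_preimage unfolding smooth_over_def
  by (auto intro!: N.tangent_space_closed smooth_on_diff)

lemma smooth_comp_F:
  assumes "c \<in> A" "d \<in> B" "smooth_on (snd d ` fst d) (h \<circ> cinv d)"
  shows "smooth_on (snd c ` (fst c \<inter> F -` fst d)) (\<lambda>x. h (F (cinv c x)))"
proof (rule smooth_on_cong)
  show op: "open (snd c ` (fst c \<inter> F -` fst d))" using assms by (intro open_chart_preimage)
  show "smooth_on (snd c ` (fst c \<inter> F -` fst d)) (\<lambda>x. (h \<circ> cinv d) ((snd d \<circ> F \<circ> cinv c) x))"
    using assms by (intro smooth_on_compose[OF op _ _ assms(3) smooth_F] N.chart_homeomorphism)
      (auto simp: A.cinv_chart)
qed (use assms in \<open>auto simp: A.cinv_chart N.cinv_chart\<close>)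

lemma smooth_comp_field:
  assumes "c \<in> A" "d \<in> B" "vector_field_on B (fst d) Y"
  shows "smooth_on (snd c ` (fst c \<inter> F -` fst d)) (\<lambda>x. Y (F (cinv c x)) d)"
  using assms by (intro smooth_comp_F[where h = "\<lambda>y. Y y d"]) (auto simp: vector_field_on_def o_def)

lemma smooth_over_dF:
  assumes c: "c \<in> A" and u: "smooth_on (snd c ` fst c) u"
  shows "smooth_over c (\<lambda>q. dF q (coord_vec A c (u (snd c q)) q))"
  unfolding smooth_over_def
proof (intro conjI ballI dF_tangent)
  fix d assume d: "d \<in> B"
  let ?S = "snd c ` (fst c \<inter> F -` fst d)"
  have S: "open ?S" using c d by (rule open_chart_preimage)
  have "smooth_on ?S (\<lambda>x. frechet_derivative (snd d \<circ> F \<circ> cinv c) (at x) (u x))"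
    by (rule smooth_on_frechet_derivative_apply[OF S S _ smooth_F[OF c d] smooth_on_ident
          smooth_on_subset[OF u]]) auto
  then show "smooth_on ?S (\<lambda>x. dF (cinv c x) (coord_vec A c (u (snd c (cinv c x))) (cinv c x)) d)"
    by (rule smooth_on_cong[OF S, rotated]) (use c d in \<open>auto simp: A.cinv_chart dF_coord_vec\<close>)
qed

lemma smooth_over_cong:
  assumes c: "c \<in> A" and eq: "\<And>q. q \<in> fst c \<Longrightarrow> V q = W q" and V: "smooth_over c V"
  shows "smooth_over c W"
  unfolding smooth_over_def
proof (intro conjI ballI)
  show "W q \<in> tangent_space B (F q)" if "q \<in> fst c" for q
    using smooth_over_tangent[OF V that] eq[OF that] by simp
  show "smooth_on (snd c ` (fst c \<inter> F -` fst d)) (\<lambda>x. W (cinv c x) d)" if d: "d \<in> B" for d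
    by (rule smooth_on_cong[OF open_chart_preimage[OF c d] _ smooth_over_smooth[OF V d]])
      (use c eq in \<open>auto simp: A.cinv_chart\<close>)
qed

lemma smooth_over_dF_field:
  assumes c: "c \<in> A" and X: "vector_field_on A UNIV X"
  shows "smooth_over c (\<lambda>q. dF q (X q))"
proof (rule smooth_over_cong[OF c])
  have "smooth_on (snd c ` fst c) (\<lambda>x. X (cinv c x) c)"
    using X c unfolding vector_field_on_def by simp
  then show "smooth_over c (\<lambda>q. dF q (coord_vec A c (X (cinv c (snd c q)) c) q))"
    by (rule smooth_over_dF[OF c])
  show "dF q (coord_vec A c (X (cinv c (snd c q)) c) q) = dF q (X q)" if "q \<in> fst c" for q
    using X that c A.tangent_eq_coord_vec[OF c that, of "X q"]
    by (simp add: vector_field_on_def A.cinv_chart)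
qed

text \<open>Smoothness is checked near each point, where both fields are expanded in the coordinate fields of
  an ambient chart.\<close>

lemma smooth_over_gbar:
  assumes c: "c \<in> A" and V: "smooth_over c V" and W: "smooth_over c W"
  shows "smooth_on (snd c ` fst c) (\<lambda>x. gbar (F (cinv c x)) (V (cinv c x)) (W (cinv c x)))"
proof (rule smooth_on_local)
  fix x assume x: "x \<in> snd c ` fst c"
  obtain d where d: "d \<in> B" "F (cinv c x) \<in> fst d" using N.chart_at by blast
  let ?S = "snd c ` (fst c \<inter> F -` fst d)"
  have S: "open ?S" using c d(1) by (rule open_chart_preimage)
  let ?E = "coord_vec B d"
  have op: "open (fst d)" using d(1) by (rule N.chart_homeomorphism)
  have g: "smooth_on ?S (\<lambda>x. gbar (F (cinv c x)) (?E b (F (cinv c x))) (?E b' (F (cinv c x))))" for b b'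
  proof (rule smooth_comp_F[OF c d(1), where h = "\<lambda>y. gbar y (?E b y) (?E b' y)"])
    have "smooth_fun B (fst d) (\<lambda>y. gbar y (?E b y) (?E b' y))"
      using N.smooth_gbar[OF op N.coord_vec_field[OF d(1)] N.coord_vec_field[OF d(1)]] .
    then have "smooth_on (snd d ` (fst d \<inter> fst d)) ((\<lambda>y. gbar y (?E b y) (?E b' y)) \<circ> cinv d)"
      using d(1) unfolding smooth_fun_def by blast
    then show "smooth_on (snd d ` fst d) ((\<lambda>y. gbar y (?E b y) (?E b' y)) \<circ> cinv d)" by simp
  qed
  have "smooth_on ?S (\<lambda>x. \<Sum>b\<in>Basis. \<Sum>b'\<in>Basis. (V (cinv c x) d \<bullet> b) * ((W (cinv c x) d \<bullet> b') *
      gbar (F (cinv c x)) (?E b (F (cinv c x))) (?E b' (F (cinv c x)))))"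
    by (intro smooth_on_sum smooth_on_mult smooth_on_inner_left g S smooth_over_smooth V W d)
  then have "smooth_on ?S (\<lambda>x. gbar (F (cinv c x)) (V (cinv c x)) (W (cinv c x)))"
  proof (rule smooth_on_cong[OF S, rotated])
    fix x assume "x \<in> ?S"
    then obtain q where q: "q \<in> fst c" "F q \<in> fst d" "x = snd c q" "cinv c x = q"
      using c by (auto simp: A.cinv_chart)
    have T: "V q \<in> tangent_space B (F q)" "W q \<in> tangent_space B (F q)"
      "?E b (F q) \<in> tangent_space B (F q)" for b
      using smooth_over_tangent V W q(1) N.coord_vec_tangent[OF d(1) q(2)] by auto
    have "gbar (F q) (V q) (W q) = gbar (F q) (\<Sum>b\<in>Basis. (V q d \<bullet> b) *\<^sub>R ?E b (F q)) (W q)"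
      using N.tangent_vec_expand[OF d(1) q(2) T(1)] by simp
    also have "\<dots> = (\<Sum>b\<in>Basis. (V q d \<bullet> b) * gbar (F q) (?E b (F q)) (W q))"
      by (simp add: N.gbar_sum_left N.gbar_scale_left T N.tangent_space_closed)
    also have "\<dots> = (\<Sum>b\<in>Basis. (V q d \<bullet> b) *
        gbar (F q) (?E b (F q)) (\<Sum>b'\<in>Basis. (W q d \<bullet> b') *\<^sub>R ?E b' (F q)))"
      using N.tangent_vec_expand[OF d(1) q(2) T(2)] by simp
    also have "\<dots> = (\<Sum>b\<in>Basis. \<Sum>b'\<in>Basis. (V q d \<bullet> b) * ((W q d \<bullet> b') * gbar (F q) (?E b (F q)) (?E b' (F q))))"
      by (simp add: N.gbar_sum_right N.gbar_scale_right T N.tangent_space_closed sum_distrib_left)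
    finally show "(\<Sum>b\<in>Basis. \<Sum>b'\<in>Basis. (V (cinv c x) d \<bullet> b) * ((W (cinv c x) d \<bullet> b') *
      gbar (F (cinv c x)) (?E b (F (cinv c x))) (?E b' (F (cinv c x))))) =
      gbar (F (cinv c x)) (V (cinv c x)) (W (cinv c x))" by (simp add: q(4))
  qed
  moreover have "x \<in> ?S" using x d c by (auto simp: A.cinv_chart)
  ultimately show "\<exists>U. open U \<and> x \<in> U \<and>
      smooth_on U (\<lambda>x. gbar (F (cinv c x)) (V (cinv c x)) (W (cinv c x)))"
    using S by blast
qed

lemma smooth_over_J:
  assumes c: "c \<in> A" and V: "smooth_over c V"
  shows "smooth_over c (\<lambda>q. J (F q) (V q))"
  unfolding smooth_over_def
proof (intro conjI ballI)
  show "J (F q) (V q) \<in> tangent_space B (F q)" if "q \<in> fst c" for q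
    by (rule N.J_tangent[OF smooth_over_tangent[OF V that]])
  fix d assume d: "d \<in> B"
  let ?S = "snd c ` (fst c \<inter> F -` fst d)"
  have S: "open ?S" using c d(1) by (rule open_chart_preimage)
  have op: "open (fst d)" using d(1) by (rule N.chart_homeomorphism)
  have "smooth_on ?S (\<lambda>x. \<Sum>b\<in>Basis. (V (cinv c x) d \<bullet> b) *\<^sub>R
      J (F (cinv c x)) (coord_vec B d b (F (cinv c x))) d)"
    by (intro smooth_on_sum smooth_on_scaleR smooth_on_inner_left smooth_over_smooth S V d
        smooth_comp_field[OF c d N.J_field[OF op N.coord_vec_field[OF d]]])
  then show "smooth_on ?S (\<lambda>x. J (F (cinv c x)) (V (cinv c x)) d)"
  proof (rule smooth_on_cong[OF S, rotated])
    fix x assume "x \<in> ?S"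
    then obtain q where q: "q \<in> fst c" "F q \<in> fst d" "x = snd c q" "cinv c x = q"
      using c by (auto simp: A.cinv_chart)
    have T: "coord_vec B d b (F q) \<in> tangent_space B (F q)" for b
      using N.coord_vec_tangent[OF d(1) q(2)] by auto
    have "J (F q) (V q) = J (F q) (\<Sum>b\<in>Basis. (V q d \<bullet> b) *\<^sub>R coord_vec B d b (F q))"
      using N.tangent_vec_expand[OF d(1) q(2) smooth_over_tangent[OF V q(1)]] by simp
    also have "\<dots> = (\<Sum>b\<in>Basis. (V q d \<bullet> b) *\<^sub>R J (F q) (coord_vec B d b (F q)))"
      by (simp add: N.J_sum N.J_scale T N.tangent_space_closed)
    finally show "(\<Sum>b\<in>Basis. (V (cinv c x) d \<bullet> b) *\<^sub>R
      J (F (cinv c x)) (coord_vec B d b (F (cinv c x))) d) = J (F (cinv c x)) (V (cinv c x)) d"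
      by (simp add: q(4) sum_fun_apply)
  qed
qed

lemma smooth_over_cov:
  assumes c: "c \<in> A" and V: "smooth_over c V" and X: "vector_field_on A UNIV X"
  shows "smooth_over c (\<lambda>q. cov q (X q) V)"
  unfolding smooth_over_def
proof (intro conjI ballI)
  show "cov q (X q) V \<in> tangent_space B (F q)" if "q \<in> fst c" for q
    by (rule cov_tangent[OF smooth_over_diff_along[OF c that V]])
  fix d assume d: "d \<in> B"
  let ?S = "snd c ` (fst c \<inter> F -` fst d)"
  have S: "open ?S" using c d(1) by (rule open_chart_preimage)
  have op: "open (fst d)" using d(1) by (rule N.chart_homeomorphism)
  have Xc: "smooth_on (snd c ` fst c) (\<lambda>x. X (cinv c x) c)"
    using X c unfolding vector_field_on_def by simp
  note Vd = smooth_over_smooth[OF V d]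
  have "smooth_on ?S (\<lambda>x. N.christoffel d (F (cinv c x)) b b')" for b b'
    unfolding connection_coeff_def
    by (rule smooth_comp_field[OF c d N.nabla_field[OF op N.coord_vec_field[OF d] N.coord_vec_field[OF d]]])
  then have "smooth_on ?S (\<lambda>x. frechet_derivative (\<lambda>x. V (cinv c x) d) (at x) (X (cinv c x) c) +
      (\<Sum>b\<in>Basis. (V (cinv c x) d \<bullet> b) *\<^sub>R (\<Sum>b'\<in>Basis. (dF (cinv c x) (X (cinv c x)) d \<bullet> b') *\<^sub>R
        N.christoffel d (F (cinv c x)) b b')))"
    by (intro smooth_on_add smooth_on_sum smooth_on_scaleR smooth_on_inner_left S Vd
        smooth_over_smooth[OF smooth_over_dF_field[OF c X] d]
        smooth_on_frechet_derivative_apply[OF S S _ Vd smooth_on_ident smooth_on_subset[OF Xc]]) auto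
  then show "smooth_on ?S (\<lambda>x. cov (cinv c x) (X (cinv c x)) V d)"
  proof (rule smooth_on_cong[OF S, rotated])
    fix x assume x: "x \<in> ?S"
    then obtain q where q: "q \<in> fst c" "F q \<in> fst d" "x = snd c q" "cinv c x = q"
      using c by (auto simp: A.cinv_chart)
    have dif: "((\<lambda>q. V q d) \<circ> cinv c) differentiable (at (snd c q))"
      using smooth_on_differentiable[OF Vd x] q(3) by (simp add: o_def)
    have Xq: "X q \<in> tangent_space A q" using X by (simp add: vector_field_on_def)
    have "N.christoffel d (F q) (dF q (X q) d) (V q d) =
        (\<Sum>b\<in>Basis. (V q d \<bullet> b) *\<^sub>R N.christoffel d (F q) b (dF q (X q) d))"
      unfolding N.christoffel_expand[OF d q(2), of _ "V q d"]
      by (simp add: N.christoffel_symmetric[OF d q(2), of "dF q (X q) d"])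
    also have "\<dots> = (\<Sum>b\<in>Basis. (V q d \<bullet> b) *\<^sub>R (\<Sum>b'\<in>Basis. (dF q (X q) d \<bullet> b') *\<^sub>R
        N.christoffel d (F q) b b'))"
      by (intro sum.cong refl arg_cong[where f = "scaleR _"] N.christoffel_expand[OF d q(2)])
    finally show "frechet_derivative (\<lambda>x. V (cinv c x) d) (at x) (X (cinv c x) c) +
      (\<Sum>b\<in>Basis. (V (cinv c x) d \<bullet> b) *\<^sub>R (\<Sum>b'\<in>Basis. (dF (cinv c x) (X (cinv c x)) d \<bullet> b') *\<^sub>R
        N.christoffel d (F (cinv c x)) b b')) = cov (cinv c x) (X (cinv c x)) V d"
      using A.pder_chart[OF c q(1) Xq dif]
      by (simp add: q(4) cov_chart[OF d q(2)] o_def) (simp add: q(3))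
  qed
qed

section \<open>Tangential and normal parts\<close>

abbreviation "tang \<equiv> tan_part A B gbar F"

text \<open>Two vectors that satisfy the conditions differ by a tangent vector that is orthogonal to itself,
  so that the definite descriptions are determined.\<close>

lemma oproj_tangent:
  assumes w: "w \<in> tangent_space B (F p)" and u: "u \<in> tangent_space A p"
    and orth: "\<And>z. z \<in> tangent_space A p \<Longrightarrow> gbar (F p) (w - dF p u) (dF p z) = 0"
  shows "oproj (gbar (F p)) (dF p ` tangent_space A p) w = dF p u" and "tang p w = u"
proof -
  let ?S = "dF p ` tangent_space A p"
  show *: "oproj (gbar (F p)) ?S w = dF p u"
    unfolding oproj_def
  proof (rule the_equality)
    show "dF p u \<in> ?S \<and> (\<forall>z\<in>?S. gbar (F p) (w - dF p u) z = 0)" using u orth by auto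
    fix y assume y: "y \<in> ?S \<and> (\<forall>z\<in>?S. gbar (F p) (w - y) z = 0)"
    then obtain u' where u': "u' \<in> tangent_space A p" "y = dF p u'" by blast
    let ?z = "dF p u - y"
    have "?z = dF p (u - u')" using linear_diff[OF linear_dF] u' by simp
    then have z: "?z \<in> ?S" using A.tangent_space_closed(4)[OF u u'(1)] by blast
    have T: "?z \<in> tangent_space B (F p)" "w - y \<in> tangent_space B (F p)" "w - dF p u \<in> tangent_space B (F p)"
      using w u' by (auto intro: N.tangent_space_closed dF_tangent)
    have "gbar (F p) ?z ?z = gbar (F p) ((w - y) - (w - dF p u)) ?z" by simp
    also have "\<dots> = gbar (F p) (w - y) ?z - gbar (F p) (w - dF p u) ?z"
      using T by (intro N.gbar_diff_left)
    also have "\<dots> = 0" using y z orth by auto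
    finally show "y = dF p u" using N.gbar_pos[OF T(1)] by fastforce
  qed
  show "tang p w = u"
    unfolding tan_part_def * by (rule inv_into_f_f[OF inj_dF u])
qed

text \<open>The first fundamental form of the immersion at the point with coordinates \<open>x\<close>.\<close>

definition induced :: "('m, 'e) chart \<Rightarrow> 'e \<Rightarrow> 'e \<Rightarrow> 'e \<Rightarrow> real" where
  "induced c x u v = gbar (F (cinv c x)) (dF (cinv c x) (coord_vec A c u (cinv c x)))
     (dF (cinv c x) (coord_vec A c v (cinv c x)))"

text \<open>The tangential part of \<open>w\<close> represents the linear form \<open>z \<mapsto> g(w, dF z)\<close> with respect to the first
  fundamental form, so \<open>smooth_riesz\<close> gives its coordinates by a formula that is uniform over the
  chart.\<close>

lemma smooth_tangential_formula:
  assumes c: "c \<in> A"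
  obtains E :: "'e \<Rightarrow> 'e \<Rightarrow> 'e" where "\<forall>b\<in>Basis. smooth_on (snd c ` fst c) (E b)"
    and "\<forall>x\<in>snd c ` fst c. \<forall>b\<in>Basis. induced c x (E b x) (E b x) \<noteq> 0"
    and "\<forall>q\<in>fst c. \<forall>w\<in>tangent_space B (F q). \<forall>z\<in>tangent_space A q.
      gbar (F q) (w - dF q (coord_vec A c (\<Sum>b\<in>Basis.
          (gbar (F q) w (dF q (coord_vec A c (E b (snd c q)) q)) *
          inverse (induced c (snd c q) (E b (snd c q)) (E b (snd c q)))) *\<^sub>R E b (snd c q)) q))
        (dF q z) = 0"
proof -
  let ?S = "snd c ` fst c"
  have 1: "induced c x (u + v) w = induced c x u w + induced c x v w"
    and 2: "induced c x (a *\<^sub>R u) w = a * induced c x u w"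
    and 3: "induced c x u w = induced c x w u" if "x \<in> ?S" for x u v w a
    using A.coord_vec_add[OF c A.cinv_in_domain[OF c that]]
      A.coord_vec_scaleR[OF c A.cinv_in_domain[OF c that]] N.gbar_sym[OF dF_tangent dF_tangent]
    by (auto simp: induced_def dF_add dF_scaleR dF_tangent N.gbar_add_left N.gbar_scale_left)
  have 4: "induced c x u u > 0" if "x \<in> ?S" "u \<noteq> 0" for x u
  proof -
    let ?q = "cinv c x" and ?v = "coord_vec A c u (cinv c x)"
    have q: "?q \<in> fst c" using A.cinv_in_domain[OF c that(1)] .
    have v: "?v \<in> tangent_space A ?q" by (rule A.coord_vec_tangent[OF c q])
    have "?v \<noteq> 0" using A.coord_vec_chart[OF c q, of u] that(2) by auto
    then have "dF ?q ?v \<noteq> 0"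
      using inj_onD[OF inj_dF _ v A.tangent_space_closed(1)] linear_0[OF linear_dF] by metis
    then show ?thesis unfolding induced_def by (intro N.gbar_pos dF_tangent)
  qed
  have 5: "smooth_on ?S (\<lambda>x. induced c x (u x) (v x))" if "smooth_on ?S u" "smooth_on ?S v" for u v
    by (rule smooth_on_cong[OF A.chart_homeomorphism(2)[OF c] _
          smooth_over_gbar[OF c that[THEN smooth_over_dF[OF c]]]])
      (auto simp: induced_def A.cinv_chart[OF c])
  obtain E :: "'e \<Rightarrow> 'e \<Rightarrow> 'e" where E: "\<forall>b\<in>Basis. smooth_on ?S (E b)"
    "\<forall>x\<in>?S. \<forall>b\<in>Basis. induced c x (E b x) (E b x) \<noteq> 0"
    "\<forall>x\<in>?S. \<forall>\<beta> z. linear \<beta> \<longrightarrow>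
      induced c x (\<Sum>b\<in>Basis. (\<beta> (E b x) * inverse (induced c x (E b x) (E b x))) *\<^sub>R E b x) z = \<beta> z"
    by (rule smooth_riesz[of ?S "induced c", OF A.chart_homeomorphism(2)[OF c] 1 2 3 4 5])
  show ?thesis
  proof (rule that[OF E(1,2)], intro ballI)
    fix q w z assume q: "q \<in> fst c" and w: "w \<in> tangent_space B (F q)" and z: "z \<in> tangent_space A q"
    let ?\<beta> = "\<lambda>z. gbar (F q) w (dF q (coord_vec A c z q))"
    let ?u = "\<Sum>b\<in>Basis. (gbar (F q) w (dF q (coord_vec A c (E b (snd c q)) q)) *
          inverse (induced c (snd c q) (E b (snd c q)) (E b (snd c q)))) *\<^sub>R E b (snd c q)"
    have lin: "linear ?\<beta>"
      by (rule linearI) (simp_all add: A.coord_vec_add[OF c q] A.coord_vec_scaleR[OF c q]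
          dF_add dF_scaleR N.gbar_add_right N.gbar_scale_right dF_tangent w)
    have "induced c (snd c q) ?u (z c) = ?\<beta> (z c)"
      using q by (intro E(3)[rule_format] lin) auto
    then have "gbar (F q) (dF q (coord_vec A c ?u q)) (dF q (coord_vec A c (z c) q)) =
        gbar (F q) w (dF q (coord_vec A c (z c) q))"
      by (simp only: induced_def A.cinv_chart[OF c q])
    then show "gbar (F q) (w - dF q (coord_vec A c ?u q)) (dF q z) = 0"
      using A.tangent_eq_coord_vec[OF c q z]
      by (simp only: N.gbar_diff_left dF_tangent w)
  qed
qed

lemma tan_part:
  assumes w: "w \<in> tangent_space B (F p)"
  shows "tang p w \<in> tangent_space A p"
    and "\<And>z. z \<in> tangent_space A p \<Longrightarrow> gbar (F p) (w - dF p (tang p w)) (dF p z) = 0"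
    and "nor_part A B gbar F p w = w - dF p (tang p w)"
proof -
  obtain c where c: "c \<in> A" "p \<in> fst c" using A.chart_at by blast
  obtain u where u: "\<forall>z\<in>tangent_space A p. gbar (F p) (w - dF p (coord_vec A c u p)) (dF p z) = 0"
  proof (rule smooth_tangential_formula[OF c(1)], goal_cases)
    case (1 E)
    show ?case by (rule 1(1), rule ballI, rule 1(4)[rule_format, OF c(2) w])
  qed
  note * = oproj_tangent[OF w A.coord_vec_tangent[OF c] u[rule_format]]
  show "tang p w \<in> tangent_space A p" using * A.coord_vec_tangent[OF c] by simp
  show "nor_part A B gbar F p w = w - dF p (tang p w)" unfolding nor_part_def using * by simp
  show "gbar (F p) (w - dF p (tang p w)) (dF p z) = 0" if "z \<in> tangent_space A p" for z
    using * u that by simp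
qed

lemma tan_part_field:
  assumes W: "\<And>c. c \<in> A \<Longrightarrow> smooth_over c W"
  shows "vector_field_on A UNIV (\<lambda>p. tang p (W p))"
  unfolding vector_field_on_def
proof (intro conjI ballI)
  show "tang p (W p) \<in> tangent_space A p" for p
    using smooth_over_tangent[OF W[OF A.chart_at(1)] A.chart_at(2)] by (rule tan_part(1))
  fix c assume c: "c \<in> A"
  let ?S = "snd c ` fst c"
  have S: "open ?S" using c by (rule A.chart_homeomorphism)
  obtain E :: "'e \<Rightarrow> 'e \<Rightarrow> 'e" where E: "\<forall>b\<in>Basis. smooth_on ?S (E b)"
    "\<forall>x\<in>?S. \<forall>b\<in>Basis. induced c x (E b x) (E b x) \<noteq> 0"
    "\<forall>q\<in>fst c. \<forall>w\<in>tangent_space B (F q). \<forall>z\<in>tangent_space A q.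
      gbar (F q) (w - dF q (coord_vec A c (\<Sum>b\<in>Basis.
          (gbar (F q) w (dF q (coord_vec A c (E b (snd c q)) q)) *
          inverse (induced c (snd c q) (E b (snd c q)) (E b (snd c q)))) *\<^sub>R E b (snd c q)) q))
        (dF q z) = 0"
    by (rule smooth_tangential_formula[OF c])
  let ?u = "\<lambda>x. \<Sum>b\<in>Basis. (gbar (F (cinv c x)) (W (cinv c x))
      (dF (cinv c x) (coord_vec A c (E b (snd c (cinv c x))) (cinv c x))) *
      inverse (gbar (F (cinv c x)) (dF (cinv c x) (coord_vec A c (E b (snd c (cinv c x))) (cinv c x)))
        (dF (cinv c x) (coord_vec A c (E b (snd c (cinv c x))) (cinv c x))))) *\<^sub>R E b x"
  have "smooth_on ?S ?u"
    using E(1,2) c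
    by (intro smooth_on_sum smooth_on_scaleR smooth_on_mult smooth_on_inverse S E(1)[rule_format]
        smooth_over_gbar[OF c] smooth_over_dF[OF c] W[OF c])
      (auto simp: induced_def A.chart_cinv)
  then have "smooth_on ?S (\<lambda>x. tang (cinv c x) (W (cinv c x)) c)"
  proof (rule smooth_on_cong[OF S, rotated])
    fix x assume "x \<in> ?S"
    then obtain q where q: "q \<in> fst c" "x = snd c q" "cinv c x = q"
      using c by (auto simp: A.cinv_chart)
    have w: "W q \<in> tangent_space B (F q)" using smooth_over_tangent[OF W[OF c] q(1)] .
    have "tang q (W q) = coord_vec A c (?u x) q"
    proof (rule oproj_tangent(2)[OF w A.coord_vec_tangent[OF c q(1)]])
      fix z assume z: "z \<in> tangent_space A q"
      have eq: "?u x = (\<Sum>b\<in>Basis. (gbar (F q) (W q) (dF q (coord_vec A c (E b (snd c q)) q)) *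
          inverse (induced c (snd c q) (E b (snd c q)) (E b (snd c q)))) *\<^sub>R E b (snd c q))"
        unfolding induced_def q(3) using q c by (simp add: A.cinv_chart)
      show "gbar (F q) (W q - dF q (coord_vec A c (?u x) q)) (dF q z) = 0"
        unfolding eq by (rule E(3)[rule_format, OF q(1) w z])
    qed
    then show "?u x = tang (cinv c x) (W (cinv c x)) c"
      by (simp add: q(3) A.coord_vec_chart[OF c q(1)])
  qed
  then show "smooth_on (snd c ` (fst c \<inter> UNIV)) (\<lambda>x. tang (cinv c x) (W (cinv c x)) c)" by simp
qed

lemma T_op_field:
  assumes "vector_field_on A UNIV Y"
  shows "vector_field_on A UNIV (\<lambda>p. T_op A B gbar J F p (Y p))"
  unfolding T_op_def by (intro tan_part_field smooth_over_J smooth_over_dF_field assms)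

lemma N_op_eq: "N_op A B gbar J F p v = J (F p) (dF p v) - dF p (T_op A B gbar J F p v)"
  unfolding N_op_def T_op_def by (rule tan_part(3)[OF N.J_tangent[OF dF_tangent]])

lemma T_op_tangent: "T_op A B gbar J F p v \<in> tangent_space A p"
  unfolding T_op_def by (rule tan_part(1)[OF N.J_tangent[OF dF_tangent]])

lemma N_op_orthogonal:
  "z \<in> tangent_space A p \<Longrightarrow> gbar (F p) (N_op A B gbar J F p v) (dF p z) = 0"
  unfolding N_op_eq T_op_def by (rule tan_part(2)[OF N.J_tangent[OF dF_tangent]])

lemma smooth_over_N_op:
  assumes "c \<in> A" "vector_field_on A UNIV Y"
  shows "smooth_over c (\<lambda>p. N_op A B gbar J F p (Y p))"
  unfolding N_op_eq by (intro smooth_over_diff smooth_over_J smooth_over_dF_field T_op_field assms)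

lemma shape_op_field:
  assumes "\<And>c. c \<in> A \<Longrightarrow> smooth_over c V" "vector_field_on A UNIV X"
  shows "vector_field_on A UNIV (\<lambda>p. shape_op A B gbar nabla F V p (X p))"
proof -
  have "vector_field_on A UNIV (\<lambda>p. tang p (cov p (X p) V))"
    by (intro tan_part_field smooth_over_cov assms)
  then show ?thesis
    unfolding shape_op_def vector_field_on_def
    by (auto intro!: A.tangent_space_closed smooth_on_minus A.chart_homeomorphism)
qed

text \<open>This is the Weingarten formula, with only the tangential part of the derivative being visible to
  \<open>dF z\<close>.\<close>

lemma gbar_shape_op:
  assumes "diff_along p V" "z \<in> tangent_space A p"
  shows "gbar (F p) (dF p (shape_op A B gbar nabla F V p v)) (dF p z) =
    - gbar (F p) (cov p v V) (dF p z)"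
  using tan_part(2)[OF cov_tangent[OF assms(1)] assms(2), of v] cov_tangent[OF assms(1)]
  by (simp add: shape_op_def linear_neg[OF linear_dF] N.gbar_minus_left dF_tangent N.gbar_diff_left)

end

section \<open>Product manifolds\<close>

definition product_chart :: "('a, 'd) chart \<Rightarrow> ('b, 'e) chart \<Rightarrow> ('a \<times> 'b, 'd \<times> 'e) chart" where
  "product_chart c1 c2 = (fst c1 \<times> fst c2, map_prod (snd c1) (snd c2))"

lemma product_chart_in_atlas: "c1 \<in> A1 \<Longrightarrow> c2 \<in> A2 \<Longrightarrow> product_chart c1 c2 \<in> product_atlas A1 A2"
  by (force simp: product_atlas_def product_chart_def)

lemma product_atlasE:
  assumes "c \<in> product_atlas A1 A2"
  obtains c1 c2 where "c1 \<in> A1" "c2 \<in> A2" "c = product_chart c1 c2"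
proof -
  obtain z where "z \<in> A1 \<times> A2" "c = (\<lambda>(c1, c2). product_chart c1 c2) z"
    using assms unfolding product_atlas_def product_chart_def by (rule imageE)
  then show ?thesis using that by auto
qed

locale product_manifold = M1: manifold A1 + M2: manifold A2
  for A1 :: "('a::{t2_space,second_countable_topology}, 'd::euclidean_space) chart set"
    and A2 :: "('b::{t2_space,second_countable_topology}, 'e::euclidean_space) chart set"
begin

lemma product_chart_image:
  "snd (product_chart c1 c2) ` (U \<times> V) = (snd c1 ` U) \<times> (snd c2 ` V)"
  by (auto simp: product_chart_def map_prod_def image_iff)

text \<open>Outside of the image of the chart, \<open>cinv\<close> has arbitrary values, and the two sides may differ.\<close>

lemma cinv_product_chart:
  assumes "c1 \<in> A1" "c2 \<in> A2" "x \<in> snd c1 ` fst c1" "y \<in> snd c2 ` fst c2"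
  shows "cinv (product_chart c1 c2) (x, y) = (cinv c1 x, cinv c2 y)"
proof -
  have "inj_on (snd (product_chart c1 c2)) (fst (product_chart c1 c2))"
    using assms(1,2)
    by (intro inj_on_inverseI[where g = "\<lambda>z. (cinv c1 (fst z), cinv c2 (snd z))"])
      (auto simp: product_chart_def M1.cinv_chart M2.cinv_chart)
  moreover have "(cinv c1 x, cinv c2 y) \<in> fst (product_chart c1 c2)"
    using assms by (auto simp: product_chart_def M1.cinv_chart M2.cinv_chart)
  moreover have "snd (product_chart c1 c2) (cinv c1 x, cinv c2 y) = (x, y)"
    using assms by (auto simp: product_chart_def M1.chart_cinv M2.chart_cinv)
  ultimately show ?thesis unfolding cinv_def[of "product_chart c1 c2"] by (metis inv_into_f_f)
qed

lemma smooth_manifold_product: "smooth_manifold (product_atlas A1 A2)"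
  unfolding smooth_manifold_def
proof (intro conjI ballI)
  have "p \<in> (\<Union>c\<in>product_atlas A1 A2. fst c)" for p
  proof -
    have "p \<in> fst (product_chart (chart_at A1 (fst p)) (chart_at A2 (snd p)))"
      using M1.chart_at M2.chart_at by (simp add: product_chart_def mem_Times_iff)
    then show ?thesis using product_chart_in_atlas[OF M1.chart_at(1) M2.chart_at(1)] by blast
  qed
  then show "(\<Union>c\<in>product_atlas A1 A2. fst c) = UNIV" by blast
next
  fix c assume "c \<in> product_atlas A1 A2"
  then obtain c1 c2 where c: "c1 \<in> A1" "c2 \<in> A2" "c = product_chart c1 c2"
    by (rule product_atlasE)
  have fc: "fst c = fst c1 \<times> fst c2" by (simp add: c product_chart_def)
  have sc: "snd c p = (snd c1 (fst p), snd c2 (snd p))" for p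
    by (cases p) (simp add: c product_chart_def)
  have im: "snd c ` fst c = (snd c1 ` fst c1) \<times> (snd c2 ` fst c2)"
    unfolding fc unfolding c by (rule product_chart_image)
  show "open (fst c)" unfolding fc
    using c by (intro open_Times M1.chart_homeomorphism M2.chart_homeomorphism)
  show "open (snd c ` fst c)" unfolding im
    using c by (intro open_Times M1.chart_homeomorphism M2.chart_homeomorphism)
  have ci: "cinv c z = (cinv c1 (fst z), cinv c2 (snd z))" if "z \<in> snd c ` fst c" for z
    using that cinv_product_chart[OF c(1,2), of "fst z" "snd z", folded c(3)]
    unfolding im by (simp add: mem_Times_iff)
  show "homeomorphism (fst c) (snd c ` fst c) (snd c) (cinv c)"
    unfolding homeomorphism_def
  proof (intro conjI ballI refl)
    have fst_snd: "continuous_on S fst" "continuous_on S snd"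
      for S :: "('x::topological_space \<times> 'y::topological_space) set"
      by (rule continuous_on_fst continuous_on_snd, rule continuous_on_id)+
    have "continuous_on (fst c1) (snd c1)" "continuous_on (fst c2) (snd c2)"
      using M1.chart_homeomorphism(3)[OF c(1)] M2.chart_homeomorphism(3)[OF c(2)]
      by (simp_all add: homeomorphism_def)
    then have "continuous_on (fst c) (\<lambda>p. (snd c1 (fst p), snd c2 (snd p)))"
      using continuous_on_compose2[OF _ fst_snd(1)[of "fst c"], of "fst c1" "snd c1"]
        continuous_on_compose2[OF _ fst_snd(2)[of "fst c"], of "fst c2" "snd c2"]
      by (intro continuous_on_Pair) (auto simp: fc)
    then show "continuous_on (fst c) (snd c)" by (simp only: sc[abs_def, symmetric])
    have "continuous_on (snd c ` fst c) (\<lambda>z. (cinv c1 (fst z), cinv c2 (snd z)))"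
      using continuous_on_compose2[OF M1.continuous_on_cinv[OF c(1)] fst_snd(1)[of "snd c ` fst c"]]
        continuous_on_compose2[OF M2.continuous_on_cinv[OF c(2)] fst_snd(2)[of "snd c ` fst c"]]
      unfolding im by (intro continuous_on_Pair) auto
    then show "continuous_on (snd c ` fst c) (cinv c)"
      by (rule continuous_on_eq) (simp only: ci)
    show *: "cinv c (snd c p) = p" if "p \<in> fst c" for p
    proof -
      have in_image: "snd c p \<in> snd c ` fst c" using that by (rule imageI)
      have "fst p \<in> fst c1" "snd p \<in> fst c2" using that by (simp_all add: fc mem_Times_iff)
      then show ?thesis
        using ci[OF in_image] by (simp add: sc M1.cinv_chart[OF c(1)] M2.cinv_chart[OF c(2)])
    qed
    show "snd c (cinv c z) = z" if "z \<in> snd c ` fst c" for z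
      using that * by auto
    show "cinv c ` snd c ` fst c = fst c"
      using * by (simp add: image_image)
  qed
next
  fix c c' assume "c \<in> product_atlas A1 A2" "c' \<in> product_atlas A1 A2"
  then obtain c1 c2 c1' c2' where c: "c1 \<in> A1" "c2 \<in> A2" "c = product_chart c1 c2"
    "c1' \<in> A1" "c2' \<in> A2" "c' = product_chart c1' c2'"
    by (elim product_atlasE)
  let ?S1 = "snd c1 ` (fst c1 \<inter> fst c1')" and ?S2 = "snd c2 ` (fst c2 \<inter> fst c2')"
  have im: "snd c ` (fst c \<inter> fst c') = ?S1 \<times> ?S2"
    unfolding c by (simp add: product_chart_image[symmetric])
      (simp add: product_chart_def Times_Int_Times)
  have op: "open ?S1" "open ?S2"
    using c by (auto intro: M1.open_chart_image M2.open_chart_image M1.chart_homeomorphism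
        M2.chart_homeomorphism)
  then have "open (?S1 \<times> ?S2)" by (rule open_Times)
  then have "smooth_on (?S1 \<times> ?S2) (\<lambda>z. ((snd c1' \<circ> cinv c1) (fst z), (snd c2' \<circ> cinv c2) (snd z)))"
    using c op
    by (intro smooth_on_Pair smooth_on_compose[OF _ op(1) _ M1.transition_smooth]
        smooth_on_compose[OF _ op(2) _ M2.transition_smooth]
        smooth_on_linear[OF bounded_linear_fst _ smooth_on_ident]
        smooth_on_linear[OF bounded_linear_snd _ smooth_on_ident]) auto
  then show "smooth_on (snd c ` (fst c \<inter> fst c')) (snd c' \<circ> cinv c)"
    unfolding im
  proof (rule smooth_on_cong[OF \<open>open (?S1 \<times> ?S2)\<close>, rotated])
    fix z assume "z \<in> ?S1 \<times> ?S2"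
    then have "cinv c z = (cinv c1 (fst z), cinv c2 (snd z))"
      using c(1,2) cinv_product_chart[OF c(1,2), of "fst z" "snd z", folded c(3)] by auto
    then show "((snd c1' \<circ> cinv c1) (fst z), (snd c2' \<circ> cinv c2) (snd z)) = (snd c' \<circ> cinv c) z"
      using c by (simp add: product_chart_def)
  qed
qed

end

sublocale product_manifold \<subseteq> manifold "product_atlas A1 A2"
  by (rule manifold.intro[OF smooth_manifold_product])

context product_manifold
begin

abbreviation "M \<equiv> product_atlas A1 A2"

lemma product_chart_domain: "p \<in> fst (product_chart c1 c2) \<longleftrightarrow> fst p \<in> fst c1 \<and> snd p \<in> fst c2"
  by (cases p) (simp add: product_chart_def)

lemma product_chart_apply: "snd (product_chart c1 c2) p = (snd c1 (fst p), snd c2 (snd p))"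
  by (cases p) (simp add: product_chart_def)

context
  fixes c1 c2 p
  assumes c: "c1 \<in> A1" "c2 \<in> A2" and p: "fst p \<in> fst c1" "snd p \<in> fst c2"
begin

lemma pc: "product_chart c1 c2 \<in> M" "p \<in> fst (product_chart c1 c2)"
  using c p by (auto simp: product_chart_in_atlas product_chart_domain)

lemma product_image_nbhd:
  "open ((snd c1 ` fst c1) \<times> (snd c2 ` fst c2))"
  "snd (product_chart c1 c2) p \<in> (snd c1 ` fst c1) \<times> (snd c2 ` fst c2)"
  using c p by (auto intro: open_Times M1.chart_homeomorphism M2.chart_homeomorphism
      simp: product_chart_apply)

text \<open>In a product chart the projections are linear, so their differentials are the projections of the
  components. For this reason the two distributions can be read off the components in such a chart.\<close>

lemma differential_fst:
  assumes v: "v \<in> tangent_space M p"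
  shows "differential M A1 fst p v = coord_vec A1 c1 (fst (v (product_chart c1 c2))) (fst p)"
proof
  fix d
  show "differential M A1 fst p v d = coord_vec A1 c1 (fst (v (product_chart c1 c2))) (fst p) d"
  proof (cases "d \<in> A1 \<and> fst p \<in> fst d")
    case True
    then have d: "d \<in> A1" "fst p \<in> fst d" by auto
    have "((\<lambda>z. (snd d \<circ> cinv c1) (fst z)) has_derivative
        (\<lambda>h. frechet_derivative (snd d \<circ> cinv c1) (at (snd c1 (fst p))) (fst h)))
        (at (snd (product_chart c1 c2) p))"
      using M1.transition_differentiable[OF c(1) d(1) p(1) d(2)]
      by (intro has_derivative_compose[OF bounded_linear_imp_has_derivative[OF bounded_linear_fst]])
        (simp add: product_chart_apply frechet_derivative_works o_def)
    then have *: "(((\<lambda>q. snd d (fst q)) \<circ> cinv (product_chart c1 c2)) has_derivative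
        (\<lambda>h. frechet_derivative (snd d \<circ> cinv c1) (at (snd c1 (fst p))) (fst h)))
        (at (snd (product_chart c1 c2) p))"
      by (rule has_derivative_transform_within_open[OF _ product_image_nbhd])
        (use c in \<open>auto simp: cinv_product_chart\<close>)
    have "differential M A1 fst p v d = pder M p v (\<lambda>q. snd d (fst q))"
      using d by (simp add: differential_def pder_def o_def)
    also have "\<dots> = frechet_derivative (snd d \<circ> cinv c1) (at (snd c1 (fst p)))
        (fst (v (product_chart c1 c2)))"
      unfolding pder_chart[OF pc v differentiableI[OF *]] frechet_derivative_eqI[OF *] ..
    finally show ?thesis using d by (simp add: coord_vec_def)
  qed (auto simp: differential_def coord_vec_def)
qed

lemma differential_snd:
  assumes v: "v \<in> tangent_space M p"
  shows "differential M A2 snd p v = coord_vec A2 c2 (snd (v (product_chart c1 c2))) (snd p)"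
proof
  fix d
  show "differential M A2 snd p v d = coord_vec A2 c2 (snd (v (product_chart c1 c2))) (snd p) d"
  proof (cases "d \<in> A2 \<and> snd p \<in> fst d")
    case True
    then have d: "d \<in> A2" "snd p \<in> fst d" by auto
    have "((\<lambda>z. (snd d \<circ> cinv c2) (snd z)) has_derivative
        (\<lambda>h. frechet_derivative (snd d \<circ> cinv c2) (at (snd c2 (snd p))) (snd h)))
        (at (snd (product_chart c1 c2) p))"
      using M2.transition_differentiable[OF c(2) d(1) p(2) d(2)]
      by (intro has_derivative_compose[OF bounded_linear_imp_has_derivative[OF bounded_linear_snd]])
        (simp add: product_chart_apply frechet_derivative_works o_def)
    then have *: "(((\<lambda>q. snd d (snd q)) \<circ> cinv (product_chart c1 c2)) has_derivative
        (\<lambda>h. frechet_derivative (snd d \<circ> cinv c2) (at (snd c2 (snd p))) (snd h)))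
        (at (snd (product_chart c1 c2) p))"
      by (rule has_derivative_transform_within_open[OF _ product_image_nbhd])
        (use c in \<open>auto simp: cinv_product_chart\<close>)
    have "differential M A2 snd p v d = pder M p v (\<lambda>q. snd d (snd q))"
      using d by (simp add: differential_def pder_def o_def)
    also have "\<dots> = frechet_derivative (snd d \<circ> cinv c2) (at (snd c2 (snd p)))
        (snd (v (product_chart c1 c2)))"
      unfolding pder_chart[OF pc v differentiableI[OF *]] frechet_derivative_eqI[OF *] ..
    finally show ?thesis using d by (simp add: coord_vec_def)
  qed (auto simp: differential_def coord_vec_def)
qed

lemma TM1_chart:
  assumes v: "v \<in> tangent_space M p"
  shows "v \<in> TM1 A1 A2 p \<longleftrightarrow> snd (v (product_chart c1 c2)) = 0"
proof -
  have "coord_vec A2 c2 u (snd p) = 0 \<longleftrightarrow> u = 0" for u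
    using M2.coord_vec_chart[OF c(2) p(2), of u] M2.coord_vec_scaleR[OF c(2) p(2), of 0 u] by auto
  then show ?thesis using v by (simp add: TM1_def differential_snd)
qed

lemma TM2_chart:
  assumes v: "v \<in> tangent_space M p"
  shows "v \<in> TM2 A1 A2 p \<longleftrightarrow> fst (v (product_chart c1 c2)) = 0"
proof -
  have "coord_vec A1 c1 u (fst p) = 0 \<longleftrightarrow> u = 0" for u
    using M1.coord_vec_chart[OF c(1) p(1), of u] M1.coord_vec_scaleR[OF c(1) p(1), of 0 u] by auto
  then show ?thesis using v by (simp add: TM2_def differential_fst)
qed

lemma TM1_coord_vec: "coord_vec M (product_chart c1 c2) (a, 0) p \<in> TM1 A1 A2 p"
  using TM1_chart[OF coord_vec_tangent[OF pc]] by (simp add: coord_vec_chart[OF pc])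

lemma TM2_coord_vec: "coord_vec M (product_chart c1 c2) (0, z) p \<in> TM2 A1 A2 p"
  using TM2_chart[OF coord_vec_tangent[OF pc]] by (simp add: coord_vec_chart[OF pc])

lemma TM1_cases:
  assumes "v \<in> TM1 A1 A2 p"
  obtains a where "v = coord_vec M (product_chart c1 c2) (a, 0) p"
proof (rule that)
  have v: "v \<in> tangent_space M p" using assms by (simp add: TM1_def)
  show "v = coord_vec M (product_chart c1 c2) (fst (v (product_chart c1 c2)), 0) p"
    using tangent_eq_coord_vec[OF pc v] TM1_chart[OF v] assms by (metis prod.collapse)
qed

lemma TM2_cases:
  assumes "v \<in> TM2 A1 A2 p"
  obtains z where "v = coord_vec M (product_chart c1 c2) (0, z) p"
proof (rule that)
  have v: "v \<in> tangent_space M p" using assms by (simp add: TM2_def)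
  show "v = coord_vec M (product_chart c1 c2) (0, snd (v (product_chart c1 c2))) p"
    using tangent_eq_coord_vec[OF pc v] TM2_chart[OF v] assms by (metis prod.collapse)
qed

end

lemma product_chart_at:
  obtains c1 c2 where "c1 \<in> A1" "c2 \<in> A2" "fst p \<in> fst c1" "snd p \<in> fst c2"
  using M1.chart_at M2.chart_at that by blast

lemma subspace_TM1: "subspace (TM1 A1 A2 p)"
proof -
  obtain c1 c2 where c: "c1 \<in> A1" "c2 \<in> A2" "fst p \<in> fst c1" "snd p \<in> fst c2"
    by (rule product_chart_at)
  have "TM1 A1 A2 p = {v \<in> tangent_space M p. snd (v (product_chart c1 c2)) = 0}"
    using TM1_chart[OF c] by (auto simp: TM1_def)
  then show ?thesis
    using subspace_tangent_space[of p] by (simp add: subspace_def)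
qed

end

section \<open>Warped products with invariant fiber\<close>

lemma riemannianD:
  assumes "riemannian_manifold A g"
    and "u \<in> tangent_space A p" "v \<in> tangent_space A p" "w \<in> tangent_space A p"
  shows "g p (u + v) w = g p u w + g p v w" "g p (a *\<^sub>R u) v = a * g p u v"
    and "u \<noteq> 0 \<Longrightarrow> g p u u > 0"
  using assms unfolding riemannian_manifold_def by blast+

lemma riemannian_nonneg:
  assumes "riemannian_manifold A g" "u \<in> tangent_space A p"
  shows "g p u u \<ge> 0"
  using riemannianD(3)[OF assms assms(2,2)] riemannianD(2)[OF assms assms(2,2), of 0]
  by (cases "u = 0") (auto simp: less_imp_le)

locale warped_product_invariant_fiber =
  N: locally_metallic_space B gbar J nabla
  for B :: "('n::{t2_space,second_countable_topology}, 'f::euclidean_space) chart set"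
    and gbar J nabla +
  fixes A1 :: "('a::{t2_space,second_countable_topology}, 'd::euclidean_space) chart set"
    and g1 :: "('a, 'd) metric"
    and A2 :: "('b::{t2_space,second_countable_topology}, 'e::euclidean_space) chart set"
    and g2 :: "('b, 'e) metric"
    and f :: "'a \<Rightarrow> real" and F :: "'a \<times> 'b \<Rightarrow> 'n"
  assumes warped_product: "warped_product_pointwise_bi_slant A1 g1 A2 g2 f B gbar J F"
    and invariant: "\<And>x. invariant_submanifold A2 B J (\<lambda>y. F (x, y))"

sublocale warped_product_invariant_fiber \<subseteq> P: product_manifold A1 A2
  using warped_product
  by unfold_locales (simp_all add: warped_product_pointwise_bi_slant_def riemannian_manifold_def)

context warped_product_invariant_fiber
begin

abbreviation "M \<equiv> product_atlas A1 A2"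
abbreviation "D1 \<equiv> TM1 A1 A2"
abbreviation "D2 \<equiv> TM2 A1 A2"
abbreviation "dF \<equiv> differential M B F"

lemma g1: "riemannian_manifold A1 g1" and g2: "riemannian_manifold A2 g2" and f_pos: "f x > 0"
  and bi_slant: "pointwise_bi_slant_submanifold M (warped_metric A1 g1 A2 g2 f) B gbar J F D1 D2"
  using warped_product by (simp_all add: warped_product_pointwise_bi_slant_def)

lemmas bi_slantD = bi_slant[unfolded pointwise_bi_slant_submanifold_def isometric_immersion_def]

lemma smooth_F: "smooth_map M B F"
  by (rule bi_slantD[THEN conjunct1, THEN conjunct1])

lemma isometric: "u \<in> tangent_space M p \<Longrightarrow> v \<in> tangent_space M p \<Longrightarrow>
    gbar (F p) (dF p u) (dF p v) = warped_metric A1 g1 A2 g2 f p u v"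
  by (rule bi_slantD[THEN conjunct1, THEN conjunct2, rule_format])

lemma D_tangent: "u \<in> D1 p \<Longrightarrow> u \<in> tangent_space M p" "u \<in> D2 p \<Longrightarrow> u \<in> tangent_space M p"
  by (simp_all add: TM1_def TM2_def)

lemma D_orthogonal: "u \<in> D1 p \<Longrightarrow> v \<in> D2 p \<Longrightarrow> gbar (F p) (dF p u) (dF p v) = 0"
  unfolding isometric[OF D_tangent(1) D_tangent(2)]
  by (rule bi_slantD[THEN conjunct2, THEN conjunct2, THEN conjunct2, THEN conjunct1, rule_format])

lemmas D_split = bi_slantD[THEN conjunct2, THEN conjunct2, THEN conjunct2, THEN conjunct2,
    THEN conjunct1, THEN spec]

lemma J_D_orthogonal: "u \<in> D1 p \<Longrightarrow> v \<in> D2 p \<Longrightarrow> gbar (F p) (J (F p) (dF p u)) (dF p v) = 0"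
  by (rule bi_slantD[THEN conjunct2, THEN conjunct2, THEN conjunct2, THEN conjunct2,
        THEN conjunct2, THEN conjunct1, rule_format, THEN conjunct1])

lemma D_decomposition:
  assumes "v \<in> tangent_space M p"
  obtains u w where "u \<in> D1 p" "w \<in> D2 p" "v = u + w"
proof -
  have "v \<in> {u + w | u w. u \<in> D1 p \<and> w \<in> D2 p}"
    using assms D_split[of p, THEN conjunct1] by simp
  then show ?thesis using that by blast
qed

lemma D_inter: "u \<in> D1 p \<Longrightarrow> u \<in> D2 p \<Longrightarrow> u = 0"
  using D_split[of p, THEN conjunct2] by blast

lemma warped_metric_chart:
  assumes c: "c1 \<in> A1" "c2 \<in> A2" "fst p \<in> fst c1" "snd p \<in> fst c2"
    and "u \<in> tangent_space M p" "v \<in> tangent_space M p"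
  shows "warped_metric A1 g1 A2 g2 f p u v =
    g1 (fst p) (coord_vec A1 c1 (fst (u (product_chart c1 c2))) (fst p))
      (coord_vec A1 c1 (fst (v (product_chart c1 c2))) (fst p)) +
    (f (fst p))\<^sup>2 * g2 (snd p) (coord_vec A2 c2 (snd (u (product_chart c1 c2))) (snd p))
      (coord_vec A2 c2 (snd (v (product_chart c1 c2))) (snd p))"
  using assms by (simp add: warped_metric_def P.differential_fst[OF c] P.differential_snd[OF c])

lemma warped_metric_definite:
  assumes u: "u \<in> tangent_space M p" and "warped_metric A1 g1 A2 g2 f p u u = 0"
  shows "u = 0"
proof -
  obtain c1 c2 where c: "c1 \<in> A1" "c2 \<in> A2" "fst p \<in> fst c1" "snd p \<in> fst c2"
    by (rule P.product_chart_at)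
  let ?u1 = "coord_vec A1 c1 (fst (u (product_chart c1 c2))) (fst p)"
  let ?u2 = "coord_vec A2 c2 (snd (u (product_chart c1 c2))) (snd p)"
  have T: "?u1 \<in> tangent_space A1 (fst p)" "?u2 \<in> tangent_space A2 (snd p)"
    by (intro P.M1.coord_vec_tangent P.M2.coord_vec_tangent c)+
  have "g1 (fst p) ?u1 ?u1 + (f (fst p))\<^sup>2 * g2 (snd p) ?u2 ?u2 = 0"
    using assms(2) unfolding warped_metric_chart[OF c u u] .
  moreover have "g1 (fst p) ?u1 ?u1 \<ge> 0" "g2 (snd p) ?u2 ?u2 \<ge> 0"
    by (rule riemannian_nonneg[OF g1 T(1)], rule riemannian_nonneg[OF g2 T(2)])
  moreover have "(f (fst p))\<^sup>2 > 0" using f_pos[of "fst p"] by simp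
  ultimately have "g1 (fst p) ?u1 ?u1 = 0" "g2 (snd p) ?u2 ?u2 = 0"
    by (smt (verit) mult_pos_pos mult_nonneg_nonneg)+
  then have "?u1 = 0" "?u2 = 0"
    using riemannianD(3)[OF g1 T(1) T(1) T(1)] riemannianD(3)[OF g2 T(2) T(2) T(2)] by auto
  then have "u (product_chart c1 c2) = 0"
    using P.M1.coord_vec_chart[OF c(1,3)] P.M2.coord_vec_chart[OF c(2,4)]
    by (metis prod_eqI fst_zero snd_zero zero_fun_apply)
  then show ?thesis
    using P.tangent_vec_eqI[OF P.pc[OF c] u P.tangent_space_closed(1)] by simp
qed

lemma warped_metric_add:
  assumes u: "u \<in> tangent_space M p" and v: "v \<in> tangent_space M p" and w: "w \<in> tangent_space M p"
  shows "warped_metric A1 g1 A2 g2 f p (u + v) w =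
    warped_metric A1 g1 A2 g2 f p u w + warped_metric A1 g1 A2 g2 f p v w"
proof -
  obtain c1 c2 where c: "c1 \<in> A1" "c2 \<in> A2" "fst p \<in> fst c1" "snd p \<in> fst c2"
    by (rule P.product_chart_at)
  have T1: "coord_vec A1 c1 a (fst p) \<in> tangent_space A1 (fst p)" for a
    by (intro P.M1.coord_vec_tangent c)
  have T2: "coord_vec A2 c2 a (snd p) \<in> tangent_space A2 (snd p)" for a
    by (intro P.M2.coord_vec_tangent c)
  show ?thesis
    unfolding warped_metric_chart[OF c P.tangent_space_closed(2)[OF u v] w]
      warped_metric_chart[OF c u w] warped_metric_chart[OF c v w]
      plus_fun_apply fst_add snd_add P.M1.coord_vec_add[OF c(1,3)] P.M2.coord_vec_add[OF c(2,4)]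
      riemannianD(1)[OF g1 T1 T1 T1] riemannianD(1)[OF g2 T2 T2 T2]
    by (simp add: distrib_left)
qed

text \<open>The map \<open>F\<close> is isometric for the warped metric, which is definite because \<open>f\<close> has no zero.\<close>

lemma immersion_F: "immersion M B F"
  unfolding immersion_def
proof (intro conjI allI inj_onI smooth_F)
  fix p u v
  assume u: "u \<in> tangent_space M p" and v: "v \<in> tangent_space M p" and eq: "dF p u = dF p v"
  let ?g = "warped_metric A1 g1 A2 g2 f p"
  let ?w = "u - v"
  have w: "?w \<in> tangent_space M p" using u v by (rule P.tangent_space_closed)
  have "?g (?w + v) ?w = ?g ?w ?w + ?g v ?w"
    by (rule warped_metric_add[OF w v w])
  moreover have "?g u ?w = ?g v ?w"
    using isometric[OF u w] isometric[OF v w] eq by simp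
  ultimately have "?g ?w ?w = 0" by simp
  from warped_metric_definite[OF w this] show "u = v" by simp
qed

end

sublocale warped_product_invariant_fiber \<subseteq>
  I: immersed_submanifold "product_atlas A1 A2" B gbar J nabla F
  by unfold_locales (rule immersion_F)

context warped_product_invariant_fiber
begin

text \<open>The \<open>D\<^sub>2\<close>-part of \<open>v\<close> has the same inner products with \<open>D\<^sub>2\<close> as \<open>v\<close>, and it vanishes if it is orthogonal
  to itself.\<close>

lemma D1_iff:
  assumes v: "v \<in> tangent_space M p"
  shows "v \<in> D1 p \<longleftrightarrow> (\<forall>z\<in>D2 p. gbar (F p) (dF p v) (dF p z) = 0)"
proof
  assume orth: "\<forall>z\<in>D2 p. gbar (F p) (dF p v) (dF p z) = 0"
  obtain u w where uw: "u \<in> D1 p" "w \<in> D2 p" "v = u + w"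
    using D_decomposition[OF v] .
  have "gbar (F p) (dF p v) (dF p w) = gbar (F p) (dF p u) (dF p w) + gbar (F p) (dF p w) (dF p w)"
    unfolding uw(3) I.dF_add by (intro N.gbar_add_left I.dF_tangent)
  then have "gbar (F p) (dF p w) (dF p w) = 0"
    using orth uw D_orthogonal by simp
  then have "w = 0"
    using warped_metric_definite D_tangent(2)[OF uw(2)] isometric by simp
  then show "v \<in> D1 p" using uw by simp
qed (use D_orthogonal in blast)

text \<open>The leaves \<open>{x} \<times> M\<^sub>2\<close> have the tangent spaces \<open>D\<^sub>2\<close>. This carries the invariance of the fibers over to
  the distribution \<open>D\<^sub>2\<close>, as \<open>J_D2\<close> expresses in coordinates.\<close>

lemma leaf_differential:
  assumes c: "c1 \<in> A1" "c2 \<in> A2" "fst p \<in> fst c1" "snd p \<in> fst c2"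
  shows "differential A2 B (\<lambda>y. F (fst p, y)) (snd p) (coord_vec A2 c2 z (snd p)) =
    dF p (coord_vec M (product_chart c1 c2) (0, z) p)"
proof -
  interpret L: immersed_submanifold A2 B gbar J nabla "\<lambda>y. F (fst p, y)"
    by unfold_locales (use invariant in \<open>simp add: invariant_submanifold_def\<close>)
  let ?c = "product_chart c1 c2"
  note pc = P.pc[OF c]
  show ?thesis
  proof
    fix d
    show "differential A2 B (\<lambda>y. F (fst p, y)) (snd p) (coord_vec A2 c2 z (snd p)) d =
      dF p (coord_vec M ?c (0, z) p) d"
    proof (cases "d \<in> B \<and> F p \<in> fst d")
      case True
      then have d: "d \<in> B" "F p \<in> fst d" by auto
      let ?\<Phi> = "snd d \<circ> F \<circ> cinv ?c" and ?x = "snd c1 (fst p)" and ?y = "snd c2 (snd p)"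
      have xy: "snd ?c p = (?x, ?y)" by (rule P.product_chart_apply)
      have "(?\<Phi> has_derivative frechet_derivative ?\<Phi> (at (?x, ?y))) (at (?x, ?y))"
        unfolding xy[symmetric]
        by (rule smooth_on_has_derivative[OF I.smooth_F[OF pc(1) d(1)]]) (use pc d in blast)
      moreover have "((\<lambda>y. (?x, y)) has_derivative (\<lambda>h. (0, h))) (at ?y)"
        by (intro has_derivative_Pair has_derivative_const has_derivative_ident)
      ultimately have "((\<lambda>y. ?\<Phi> (?x, y)) has_derivative
          (\<lambda>h. frechet_derivative ?\<Phi> (at (?x, ?y)) (0, h))) (at ?y)"
        by (rule has_derivative_compose[rotated])
      then have "((snd d \<circ> (\<lambda>y. F (fst p, y)) \<circ> cinv c2) has_derivative
          (\<lambda>h. frechet_derivative ?\<Phi> (at (?x, ?y)) (0, h))) (at ?y)"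
        by (rule has_derivative_transform_within_open[OF _ P.M2.chart_homeomorphism(2)[OF c(2)]])
          (use c in \<open>auto simp: P.cinv_product_chart P.M1.cinv_chart\<close>)
      from frechet_derivative_eqI[OF this] show ?thesis
        using L.dF_coord_vec[OF c(2,4) d(1), of z] I.dF_coord_vec[OF pc d, of "(0, z)"] d xy by simp
    qed (auto simp: differential_def)
  qed
qed

lemma J_D2:
  assumes c: "c1 \<in> A1" "c2 \<in> A2" "fst p \<in> fst c1" "snd p \<in> fst c2"
  obtains z' where "J (F p) (dF p (coord_vec M (product_chart c1 c2) (0, z) p)) =
    dF p (coord_vec M (product_chart c1 c2) (0, z') p)"
proof -
  let ?d = "differential A2 B (\<lambda>y. F (fst p, y)) (snd p)"
  have "J (F p) ` (?d ` tangent_space A2 (snd p)) \<subseteq> ?d ` tangent_space A2 (snd p)"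
    using invariant[of "fst p"] unfolding invariant_submanifold_def by (metis prod.collapse)
  then have "J (F p) (?d (coord_vec A2 c2 z (snd p))) \<in> ?d ` tangent_space A2 (snd p)"
    using P.M2.coord_vec_tangent[OF c(2,4)] by blast
  then obtain w where w: "w \<in> tangent_space A2 (snd p)" "J (F p) (?d (coord_vec A2 c2 z (snd p))) = ?d w"
    by blast
  show ?thesis
  proof (rule that)
    show "J (F p) (dF p (coord_vec M (product_chart c1 c2) (0, z) p)) =
        dF p (coord_vec M (product_chart c1 c2) (0, w c2) p)"
      using w(2) unfolding leaf_differential[OF c, symmetric]
        P.M2.tangent_eq_coord_vec[OF c(2,4) w(1), symmetric] .
  qed
qed

lemma induced_metric_base:
  assumes c: "c1 \<in> A1" "c2 \<in> A2" "fst p \<in> fst c1" "snd p \<in> fst c2"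
  shows "gbar (F p) (dF p (coord_vec M (product_chart c1 c2) (a, 0) p))
      (dF p (coord_vec M (product_chart c1 c2) (b, 0) p)) =
    g1 (fst p) (coord_vec A1 c1 a (fst p)) (coord_vec A1 c1 b (fst p))"
proof -
  have T: "coord_vec A2 c2 0 (snd p) \<in> tangent_space A2 (snd p)"
    by (rule P.M2.coord_vec_tangent[OF c(2,4)])
  have "coord_vec A2 c2 0 (snd p) = 0 *\<^sub>R coord_vec A2 c2 0 (snd p)"
    using P.M2.coord_vec_scaleR[OF c(2,4), of 0 0] by simp
  then have "g2 (snd p) (coord_vec A2 c2 0 (snd p)) (coord_vec A2 c2 0 (snd p)) = 0"
    using riemannianD(2)[OF g2 T T T, of 0] by simp
  then show ?thesis
    by (simp add: isometric P.coord_vec_tangent[OF P.pc[OF c]]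
        warped_metric_chart[OF c] P.coord_vec_chart[OF P.pc[OF c]])
qed

text \<open>On the first factor the warped metric is the one of the base, which is constant along the
  fibers.\<close>

lemma pder_base_metric:
  assumes c: "c1 \<in> A1" "c2 \<in> A2" "fst p \<in> fst c1" "snd p \<in> fst c2"
  defines "E \<equiv> coord_vec M (product_chart c1 c2)"
  shows "pder M p (E (0, z) p) (\<lambda>q. gbar (F q) (dF q (E (a, 0) q)) (dF q (E (b, 0) q))) = 0"
proof -
  let ?c = "product_chart c1 c2" and ?\<phi> = "\<lambda>q. gbar (F q) (dF q (E (a, 0) q)) (dF q (E (b, 0) q))"
  let ?\<psi> = "?\<phi> \<circ> cinv (product_chart c1 c2)" and ?x = "snd c1 (fst p)" and ?y = "snd c2 (snd p)"
  let ?S = "(snd c1 ` fst c1) \<times> (snd c2 ` fst c2)"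
  note pc = P.pc[OF c]
  have S: "open ?S" "(?x, ?y) \<in> ?S"
    using P.product_image_nbhd[OF c] by (auto simp: P.product_chart_apply)
  have dif: "?\<psi> differentiable (at (?x, ?y))"
    using P.pdiff_in_chart[OF pc I.pder_gbar(1)[OF I.diff_along_dF_coord_vec[OF pc]
          I.diff_along_dF_coord_vec[OF pc], of "(a, 0)" "(b, 0)"]]
    by (simp add: E_def P.product_chart_apply)
  let ?D = "frechet_derivative ?\<psi> (at (?x, ?y))"
  \<comment> \<open>The function does not change when the second coordinate is replaced by \<open>?y\<close>; by the chain
      rule its derivative then factors through the first coordinate.\<close>
  have "((\<lambda>w. (fst w, ?y)) has_derivative (\<lambda>h. (fst h, 0))) (at (?x, ?y))"
    by (intro has_derivative_Pair has_derivative_const has_derivative_fst has_derivative_ident)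
  moreover have "(?\<psi> has_derivative ?D) (at (fst (?x, ?y), ?y))"
    using dif by (simp add: frechet_derivative_works)
  ultimately have "((\<lambda>w. ?\<psi> (fst w, ?y)) has_derivative (\<lambda>h. ?D (fst h, 0))) (at (?x, ?y))"
    by (rule has_derivative_compose)
  then have "(?\<psi> has_derivative (\<lambda>h. ?D (fst h, 0))) (at (?x, ?y))"
  proof (rule has_derivative_transform_within_open[OF _ S])
    fix w assume "w \<in> ?S"
    then obtain x y where w: "w = (x, y)" "x \<in> snd c1 ` fst c1" "y \<in> snd c2 ` fst c2" by auto
    have y': "?y \<in> snd c2 ` fst c2" using c by blast
    have "?\<psi> (x, y) = g1 (cinv c1 x) (coord_vec A1 c1 a (cinv c1 x)) (coord_vec A1 c1 b (cinv c1 x))"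
      if "y \<in> snd c2 ` fst c2" for y
      using induced_metric_base[OF c(1,2), of "(cinv c1 x, cinv c2 y)" a b]
        P.M1.cinv_in_domain[OF c(1) w(2)] P.M2.cinv_in_domain[OF c(2) that]
      by (simp add: E_def P.cinv_product_chart[OF c(1,2) w(2) that])
    from this[OF w(3)] this[OF y'] show "?\<psi> (fst w, ?y) = ?\<psi> w" by (simp only: w(1) fst_conv)
  qed
  from fun_cong[OF frechet_derivative_eqI[OF this], of "(0, z)"] have "?D (0, z) = ?D (0, 0)"
    by (simp only: fst_conv)
  also have "\<dots> = 0"
    using linear_0[OF linear_frechet_derivative[OF dif]] by (simp add: zero_prod_def)
  finally have "?D (0, z) = 0" .
  moreover have "pder M p (E (0, z) p) ?\<phi> = ?D (0, z)"
    using P.pder_chart[OF pc P.coord_vec_tangent[OF pc], of ?\<phi> "(0, z)"] dif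
    by (simp add: E_def P.product_chart_apply P.coord_vec_chart[OF pc])
  ultimately show ?thesis by simp
qed

text \<open>Let \<open>s(a, b) = g(b, \<nabla>\<^sub>a z)\<close> for coordinate fields \<open>a\<close>, \<open>b\<close> of the base and \<open>z\<close> of the fiber. From
  \<open>g(b, z) = 0\<close> one gets \<open>s(a, b) = - g(\<nabla>\<^sub>a b, z)\<close>, which is symmetric because \<open>\<nabla>\<^sub>a b = \<nabla>\<^sub>b a\<close>. As \<open>g(a, b)\<close>
  is constant along the fibers and \<open>\<nabla>\<^sub>z a = \<nabla>\<^sub>a z\<close>, \<open>\<nabla>\<^sub>z b = \<nabla>\<^sub>b z\<close>, the form \<open>s\<close> is also
  antisymmetric. Hence it vanishes.\<close>

lemma base_totally_geodesic:
  assumes c: "c1 \<in> A1" "c2 \<in> A2" "fst p \<in> fst c1" "snd p \<in> fst c2"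
  defines "E \<equiv> coord_vec M (product_chart c1 c2)"
  shows "gbar (F p) (I.cov p (E (a, 0) p) (\<lambda>q. dF q (E (b, 0) q))) (dF p (E (0, z) p)) = 0"
    and "gbar (F p) (dF p (E (b, 0) p)) (I.cov p (E (a, 0) p) (\<lambda>q. dF q (E (0, z) q))) = 0"
proof -
  note pc = P.pc[OF c]
  let ?E = "\<lambda>w q. dF q (E w q)"
  let ?U = "fst (product_chart c1 c2)"
  have U: "open ?U" "p \<in> ?U" using pc P.chart_homeomorphism(1) by auto
  have di: "I.diff_along p (?E w)" for w
    unfolding E_def by (rule I.diff_along_dF_coord_vec[OF pc])
  have sy: "I.cov p (E u p) (?E w) = I.cov p (E w p) (?E u)" for u w
    unfolding E_def by (rule I.cov_coord_vec_symmetric[OF pc])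
  have T: "?E w p \<in> tangent_space B (F p)" "I.cov p v (?E w) \<in> tangent_space B (F p)" for w v
    by (rule I.dF_tangent) (rule I.cov_tangent[OF di])
  define s where "s a b = gbar (F p) (?E (b, 0) p) (I.cov p (E (a, 0) p) (?E (0, z)))" for a b
  have "\<forall>q\<in>?U. gbar (F q) (?E (b, 0) q) (?E (0, z) q) = 0" for b
    using c unfolding E_def
    by (auto intro!: D_orthogonal P.TM1_coord_vec P.TM2_coord_vec simp: P.product_chart_domain)
  from I.cov_orthogonal[OF U this di di]
  have 1: "gbar (F p) (I.cov p (E (a, 0) p) (?E (b, 0))) (?E (0, z) p) = - s a b" for a b
    by (simp add: s_def)
  have 2: "s a b = s b a" using 1[of a b] 1[of b a] sy[of "(a, 0)" "(b, 0)"] by simp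
  have "pder M p (E (0, z) p) (\<lambda>q. gbar (F q) (?E (a, 0) q) (?E (b, 0) q)) = 0"
    unfolding E_def by (rule pder_base_metric[OF c])
  then have "gbar (F p) (I.cov p (E (0, z) p) (?E (a, 0))) (?E (b, 0) p) +
      gbar (F p) (?E (a, 0) p) (I.cov p (E (0, z) p) (?E (b, 0))) = 0"
    using I.pder_gbar(2)[OF di di] by simp
  then have "s a b + s b a = 0"
    unfolding s_def sy[of "(0, z)"] using N.gbar_sym[OF T(2) T(1)] by simp
  with 2 have "s a b = 0" by simp
  then show "gbar (F p) (dF p (E (b, 0) p)) (I.cov p (E (a, 0) p) (\<lambda>q. dF q (E (0, z) q))) = 0"
    "gbar (F p) (I.cov p (E (a, 0) p) (\<lambda>q. dF q (E (b, 0) q))) (dF p (E (0, z) p)) = 0"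
    using 1[of a b] by (simp_all add: s_def)
qed

text \<open>For \<open>v\<close> in \<open>D\<^sub>1\<close>, \<open>Jv\<close> is orthogonal to \<open>D\<^sub>2\<close>, and so is its normal part; hence its tangential part is
  orthogonal to \<open>D\<^sub>2\<close> as well.\<close>

lemma T_op_D1:
  assumes "v \<in> D1 p"
  shows "T_op M B gbar J F p v \<in> D1 p"
proof (rule D1_iff[OF I.T_op_tangent, THEN iffD2], rule ballI)
  fix z assume z: "z \<in> D2 p"
  have "gbar (F p) (J (F p) (dF p v) - dF p (T_op M B gbar J F p v)) (dF p z) = 0"
    unfolding I.N_op_eq[symmetric] by (rule I.N_op_orthogonal[OF D_tangent(2)[OF z]])
  then show "gbar (F p) (dF p (T_op M B gbar J F p v)) (dF p z) = 0"
    using J_D_orthogonal[OF assms z]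
    by (simp add: N.gbar_diff_left I.dF_tangent N.J_tangent)
qed

lemma T_proj_D1:
  assumes "v \<in> D1 p"
  shows "T_proj M B gbar J F D1 D2 p v = T_op M B gbar J F p v" (is "_ = ?w")
  unfolding T_proj_def proj_along_def
proof (rule the_equality)
  have w: "?w \<in> D1 p" by (rule T_op_D1[OF assms])
  obtain c1 c2 where c: "c1 \<in> A1" "c2 \<in> A2" "fst p \<in> fst c1" "snd p \<in> fst c2"
    by (rule P.product_chart_at)
  have "0 \<in> D2 p" using P.TM2_chart[OF c P.tangent_space_closed(1)] by simp
  then show "?w \<in> D1 p \<and> ?w - ?w \<in> D2 p" using w by simp
  fix u assume u: "u \<in> D1 p \<and> ?w - u \<in> D2 p"
  then have "?w - u \<in> D1 p" using w by (intro subspace_diff[OF P.subspace_TM1]) auto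
  from D_inter[OF this conjunct2[OF u]] show "u = ?w" by simp
qed

text \<open>The vectors \<open>U\<close>, \<open>TU\<close> and \<open>Z\<close> at \<open>p\<close> are extended by coordinate fields of a product chart. The rules
  for the induced connection move the derivative from \<open>NU\<close> to \<open>Z\<close>, then from \<open>JZ\<close> to \<open>U\<close>, where
  \<open>base_totally_geodesic\<close> applies.\<close>

lemma shape_op_D1:
  assumes U: "vector_field_on M UNIV U" "\<And>q. U q \<in> D1 q" and x: "x \<in> D1 p"
  shows "shape_op M B gbar nabla F (\<lambda>q. N_op M B gbar J F q (U q)) p x \<in> D1 p"
proof -
  let ?V = "\<lambda>q. N_op M B gbar J F q (U q)"
  obtain c1 c2 where c: "c1 \<in> A1" "c2 \<in> A2" "fst p \<in> fst c1" "snd p \<in> fst c2"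
    by (rule P.product_chart_at)
  note pc = P.pc[OF c]
  let ?c = "product_chart c1 c2"
  let ?O = "fst ?c"
  have O: "open ?O" "p \<in> ?O" using pc P.chart_homeomorphism(1) by auto
  define E where "E = coord_vec M ?c"
  have di: "I.diff_along p (\<lambda>q. dF q (E w q))" for w
    unfolding E_def by (rule I.diff_along_dF_coord_vec[OF pc])
  have V: "I.diff_along p ?V"
    by (rule I.smooth_over_diff_along[OF pc I.smooth_over_N_op[OF pc(1) U(1)]])
  have T: "I.cov p x ?V \<in> tangent_space B (F p)" "I.cov p x (\<lambda>q. dF q (E w q)) \<in> tangent_space B (F p)" for w
    by (rule I.cov_tangent, fact)+
  obtain a where a: "x = E (a, 0) p"
    unfolding E_def using P.TM1_cases[OF c x] .
  obtain b where b: "U p = E (b, 0) p"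
    unfolding E_def using P.TM1_cases[OF c U(2)] .
  obtain b' where b': "T_op M B gbar J F p (U p) = E (b', 0) p"
    unfolding E_def using P.TM1_cases[OF c T_op_D1[OF U(2)]] .
  have normal: "gbar (F p) (I.cov p x ?V) (dF p (E (0, z) p)) = 0" for z
  proof -
    let ?Z = "\<lambda>q. dF q (E (0, z) q)"
    have "\<forall>q\<in>?O. gbar (F q) (?V q) (?Z q) = 0"
      unfolding E_def by (intro ballI I.N_op_orthogonal P.coord_vec_tangent pc)
    then have "gbar (F p) (I.cov p x ?V) (?Z p) = - gbar (F p) (?V p) (I.cov p x ?Z)"
      by (rule I.cov_orthogonal[OF O _ V di])
    also have "gbar (F p) (?V p) (I.cov p x ?Z) =
        gbar (F p) (J (F p) (dF p (U p))) (I.cov p x ?Z) - gbar (F p) (dF p (E (b', 0) p)) (I.cov p x ?Z)"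
      unfolding I.N_op_eq b' by (intro N.gbar_diff_left N.J_tangent I.dF_tangent T)
    also have "gbar (F p) (dF p (E (b', 0) p)) (I.cov p x ?Z) = 0"
      unfolding a E_def by (rule base_totally_geodesic(2)[OF c])
    also have "gbar (F p) (J (F p) (dF p (U p))) (I.cov p x ?Z) =
        gbar (F p) (dF p (E (b, 0) p)) (I.cov p x (\<lambda>q. J (F q) (?Z q)))"
      unfolding I.cov_J(2)[OF di] b by (rule N.metallic[OF I.dF_tangent T(2)])
    also have "\<dots> = - gbar (F p) (I.cov p x (\<lambda>q. dF q (E (b, 0) q))) (J (F p) (?Z p))"
    proof -
      have "gbar (F q) (dF q (E (b, 0) q)) (J (F q) (?Z q)) = 0" if "q \<in> ?O" for q
      proof -
        have q: "fst q \<in> fst c1" "snd q \<in> fst c2" using that by (simp_all add: P.product_chart_domain)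
        have "gbar (F q) (J (F q) (dF q (E (b, 0) q))) (?Z q) = 0"
          unfolding E_def
          by (rule J_D_orthogonal[OF P.TM1_coord_vec[OF c(1,2) q] P.TM2_coord_vec[OF c(1,2) q]])
        then show ?thesis using N.metallic[OF I.dF_tangent I.dF_tangent] by simp
      qed
      then have "\<forall>q\<in>?O. gbar (F q) (dF q (E (b, 0) q)) (J (F q) (?Z q)) = 0" by blast
      from I.cov_orthogonal[OF O this di I.cov_J(1)[OF di]] show ?thesis by simp
    qed
    also have "gbar (F p) (I.cov p x (\<lambda>q. dF q (E (b, 0) q))) (J (F p) (?Z p)) = 0"
    proof -
      obtain z' where "J (F p) (?Z p) = dF p (E (0, z') p)"
        unfolding E_def using J_D2[OF c] .
      then show ?thesis
        unfolding a E_def using base_totally_geodesic(1)[OF c] by simp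
    qed
    finally show ?thesis by simp
  qed
  have shape: "shape_op M B gbar nabla F ?V p x \<in> tangent_space M p"
    unfolding shape_op_def by (intro P.tangent_space_closed I.tan_part(1) T)
  show ?thesis
  proof (rule D1_iff[OF shape, THEN iffD2], rule ballI)
    fix w assume w: "w \<in> D2 p"
    obtain z where "w = E (0, z) p" unfolding E_def using P.TM2_cases[OF c w] .
    then show "gbar (F p) (dF p (shape_op M B gbar nabla F ?V p x)) (dF p w) = 0"
      using I.gbar_shape_op[OF V D_tangent(2)[OF w]] normal by simp
  qed
qed

end

theorem theorem6p3:
  fixes Ath :: "('a::{t2_space,second_countable_topology}, 'd::euclidean_space) chart set"
    and gth :: "('a, 'd) metric"
    and AT :: "('b::{t2_space,second_countable_topology}, 'e::euclidean_space) chart set"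
    and gT :: "('b, 'e) metric"
    and B :: "('n::{t2_space,second_countable_topology}, 'f::euclidean_space) chart set"
    and gbar :: "('n, 'f) metric"
    and J :: "('n, 'f) endo_field"
    and nabla :: "('n, 'f) connection"
    and f :: "'a \<Rightarrow> real"
    and F :: "'a \<times> 'b \<Rightarrow> 'n"
    and \<theta> :: "'a \<times> 'b \<Rightarrow> real"
  defines "M \<equiv> product_atlas Ath AT"
    and "D1 \<equiv> TM1 Ath AT" and "D2 \<equiv> TM2 Ath AT"
  assumes "locally_metallic B gbar J nabla"
    and "warped_product_pointwise_semi_slant Ath gth AT gT f B gbar J F"
    and "\<And>y. pointwise_slant_submanifold Ath B gbar J (\<lambda>x. F (x, y)) (\<lambda>x. \<theta> (x, y))"
    and "\<And>x y. 0 < \<theta> (x, y) \<and> \<theta> (x, y) < pi / 2"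
    and "\<And>x. invariant_submanifold AT B J (\<lambda>y. F (x, y))"
    and "X \<in> smooth_sections M D1" and "Y \<in> smooth_sections M D1"
  defines "N \<equiv> N_op M B gbar J F" and "T1 \<equiv> T_proj M B gbar J F D1 D2"
    and "A \<equiv> shape_op M B gbar nabla F"
  shows "(\<lambda>p. A (\<lambda>q. N q (T1 q (Y q))) p (X p) - A (\<lambda>q. N q (T1 q (X q))) p (Y p))
           \<in> smooth_sections M D1"
proof -
  interpret W: warped_product_invariant_fiber B gbar J nabla Ath gth AT gT f F
    using assms(4,5,8)
    by unfold_locales (simp_all add: warped_product_pointwise_semi_slant_def)
  \<comment> \<open>Each term of the difference is a section of \<open>D1\<close>; exchanging \<open>X\<close> and \<open>Y\<close> gives the other one.\<close>
  have section_of_D1: "vector_field_on M UNIV (\<lambda>p. A (\<lambda>q. N q (T1 q (V q))) p (U p)) \<and>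
      (\<forall>p. A (\<lambda>q. N q (T1 q (V q))) p (U p) \<in> D1 p)"
    if "U \<in> smooth_sections M D1" "V \<in> smooth_sections M D1" for U V
  proof -
    have U: "vector_field_on M UNIV U" "\<And>p. U p \<in> D1 p"
      and V: "vector_field_on M UNIV V" "\<And>p. V p \<in> D1 p"
      using that by (auto simp: smooth_sections_def)
    have T1: "(\<lambda>q. N q (T1 q (V q))) = (\<lambda>q. N q (T_op M B gbar J F q (V q)))"
      using W.T_proj_D1 V(2) unfolding T1_def M_def D1_def D2_def by simp
    have TV: "vector_field_on M UNIV (\<lambda>q. T_op M B gbar J F q (V q))"
      using W.I.T_op_field V(1) unfolding M_def by blast
    show ?thesis
    proof (intro conjI allI)
      show "vector_field_on M UNIV (\<lambda>p. A (\<lambda>q. N q (T1 q (V q))) p (U p))"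
        unfolding T1 using W.I.shape_op_field[OF W.I.smooth_over_N_op] TV U(1)
        unfolding A_def N_def M_def by blast
      show "A (\<lambda>q. N q (T1 q (V q))) p (U p) \<in> D1 p" for p
        unfolding T1 using W.shape_op_D1 TV U(2) W.T_op_D1 V(2)
        unfolding A_def N_def M_def D1_def by blast
    qed
  qed
  show ?thesis
    unfolding smooth_sections_def
  proof (intro CollectI conjI allI)
    let ?P = "\<lambda>p. A (\<lambda>q. N q (T1 q (Y q))) p (X p)" and ?Q = "\<lambda>p. A (\<lambda>q. N q (T1 q (X q))) p (Y p)"
    have P: "vector_field_on M UNIV ?P" "\<And>p. ?P p \<in> D1 p"
      and Q: "vector_field_on M UNIV ?Q" "\<And>p. ?Q p \<in> D1 p"
      using section_of_D1 assms(9,10) by auto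
    show "?P p - ?Q p \<in> D1 p" for p
      using subspace_diff[OF W.P.subspace_TM1] P(2) Q(2) unfolding D1_def by blast
    show "vector_field_on M UNIV (\<lambda>p. ?P p - ?Q p)"
      using W.P.vector_field_diff[OF open_UNIV] P(1) Q(1) unfolding M_def by blast
  qed
qed

end
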